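(* Let $\mathbf{F}$ be a field and let $A=(A_{\alpha\beta})$ be an $n\times m$ partitioned matrix over $\mathbf{F}$ of type $(n_1,\dots,n_\mu;m_1,\dots,m_\nu)$, i.e. $A_{\alpha\beta}$ is an $n_\alpha\times m_\beta$ block, $\sum_\alpha n_\alpha=n$, $\sum_\beta m_\beta=m$. Suppose that $\operatorname{rank} A_{\alpha\beta}\le 1$ for every $\alpha=1,\dots,\mu$ and $\beta=1,\dots,\nu$. Then the DM-decomposition of $A$ (as defined in the context) can be computed in polynomial time; that is, one can compute in polynomial time a maximal chain of $\mathcal{S}_{\max}$ together with nonsingular matrices $E,F$ of the form described in the context such that $E^{\top}AF$ is the DM-decomposition of $A$.
   Context: Let $U=\mathbf{F}^n$, $V=\mathbf{F}^m$ (column vectors), and regard $A$ as the bilinear form $(x,y)\mapsto x^{\top}Ay$ on $U\times V$. Let $U_\alpha\subseteq U$ be the subspace of vectors supported on the coordinates of the $\alpha$-th row block, and $V_\beta\subseteq V$ the subspace of vectors supported on the coordinates of the $\beta$-th column block, so $U=U_1\oplus\cdots\oplus U_\mu$ and $V=V_1\oplus\cdots\oplus V_\nu$. Let $\mathcal{L}$ be the lattice of subspaces of $U$ of the form $X_1\oplus\cdots\oplus X_\mu$ with $X_\alpha\subseteq U_\alpha$, and $\mathcal{M}$ the lattice of subspaces of $V$ of the form $Y_1\oplus\cdots\oplus Y_\nu$ with $Y_\beta\subseteq V_\beta$. A pair $(X,Y)\in\mathcal{L}\times\mathcal{M}$ is stable if $x^{\top}Ay=0$ for all $x\in X,y\in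 Y$; it is maximum if $\dim X+\dim Y$ is maximum among stable pairs. Let $\mathcal{S}_{\max}$ be the set of maximum stable pairs, partially ordered by $(X,Y)\preceq(X',Y')$ iff $X\subseteq X'$ (this is a lattice). Take a maximal chain $(X^0,Y^0)\prec\cdots\prec(X^h,Y^h)$ in $\mathcal{S}_{\max}$, put $i_k=\dim X^k$, $j_k=\dim Y^k$, and choose a basis $e_1,\dots,e_n$ of $U$ such that each $e_i$ lies in some $U_\alpha$ and $e_1,\dots,e_{i_k}$ is a basis of $X^k$ for all $k$, and a basis $f_1,\dots,f_m$ of $V$ such that each $f_j$ lies in some $V_\beta$ and $f_1,\dots,f_{j_k}$ is a basis of $Y^k$ for all $k$. With $E=(e_n\ e_{n-1}\ \cdots\ e_1)$ and $F=(f_1\ \cdots\ f_m)$, the matrix $E^{\top}AF$ is block upper-triangular and is called the DM-decomposition of $A$; $E$ and $F$ are block-diagonal nonsingular matrices (blocks of sizes $n_\alpha$, resp. $m_\beta$) times permutation matrices. *)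

theory Defs
  imports
    "Jordan_Normal_Form.Matrix"
    "Jordan_Normal_Form.VS_Connect"
    "Jordan_Normal_Form.DL_Rank"
    "HOL-Combinatorics.Permutations"
begin

section \<open>Partitioned matrices and the DM-decomposition\<close>

text \<open>
  A type \<open>(n\<^sub>1,\<dots>,n\<^sub>\<mu>; m\<^sub>1,\<dots>,m\<^sub>\<nu>)\<close> is a pair of lists \<open>ns\<close>, \<open>ms\<close>; then
  \<open>n = sum_list ns\<close> and \<open>m = sum_list ms\<close>.  Indices of blocks, rows and columns start at 0.
  Empty blocks are allowed.
\<close>

definition offset :: "nat list \<Rightarrow> nat \<Rightarrow> nat" where
  "offset ns \<alpha> = sum_list (take \<alpha> ns)"

definition block :: "nat list \<Rightarrow> nat list \<Rightarrow> 'a mat \<Rightarrow> nat \<Rightarrow> nat \<Rightarrow> 'a mat" where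
  "block ns ms A \<alpha> \<beta> =
     mat (ns ! \<alpha>) (ms ! \<beta>) (\<lambda>(i, j). A $$ (offset ns \<alpha> + i, offset ms \<beta> + j))"

definition is_subspace :: "nat \<Rightarrow> 'a :: field vec set \<Rightarrow> bool" where
  "is_subspace n X \<longleftrightarrow> VectorSpace.subspace class_ring X (module_vec TYPE('a) n)"

definition subspace_dim :: "nat \<Rightarrow> 'a :: field vec set \<Rightarrow> nat" where
  "subspace_dim n X = vectorspace.dim class_ring ((module_vec TYPE('a) n)\<lparr>carrier := X\<rparr>)"

definition is_basis :: "nat \<Rightarrow> 'a :: field vec set \<Rightarrow> 'a vec list \<Rightarrow> bool" where
  "is_basis n X vs \<longleftrightarrow> distinct vs \<and>
     vectorspace.basis class_ring ((module_vec TYPE('a) n)\<lparr>carrier := X\<rparr>) (set vs)"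

definition block_space :: "nat list \<Rightarrow> nat \<Rightarrow> 'a :: field vec set" where
  "block_space ns \<alpha> = {x \<in> carrier_vec (sum_list ns).
     \<forall>i < sum_list ns. x $ i \<noteq> 0 \<longrightarrow> offset ns \<alpha> \<le> i \<and> i < offset ns (Suc \<alpha>)}"

definition block_lattice :: "nat list \<Rightarrow> 'a :: field vec set set" where
  "block_lattice ns = {X. \<exists>Xs.
     (\<forall>\<alpha> < length ns. is_subspace (sum_list ns) (Xs \<alpha>) \<and> Xs \<alpha> \<subseteq> block_space ns \<alpha>) \<and>
     X = {finsum_vec TYPE('a) (sum_list ns) x {..<length ns} | x. \<forall>\<alpha> < length ns. x \<alpha> \<in> Xs \<alpha>}}"

definition stable_pair ::
    "nat list \<Rightarrow> nat list \<Rightarrow> 'a :: field mat \<Rightarrow> 'a vec set \<times> 'a vec set \<Rightarrow> bool" where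
  "stable_pair ns ms A = (\<lambda>(X, Y). X \<in> block_lattice ns \<and> Y \<in> block_lattice ms \<and>
     (\<forall>x \<in> X. \<forall>y \<in> Y. x \<bullet> (A *\<^sub>v y) = 0))"

definition pair_dim :: "nat list \<Rightarrow> nat list \<Rightarrow> 'a :: field vec set \<times> 'a vec set \<Rightarrow> nat" where
  "pair_dim ns ms = (\<lambda>(X, Y). subspace_dim (sum_list ns) X + subspace_dim (sum_list ms) Y)"

definition S_max ::
    "nat list \<Rightarrow> nat list \<Rightarrow> 'a :: field mat \<Rightarrow> ('a vec set \<times> 'a vec set) set" where
  "S_max ns ms A = {p. stable_pair ns ms A p \<and>
     (\<forall>q. stable_pair ns ms A q \<longrightarrow> pair_dim ns ms q \<le> pair_dim ns ms p)}"

definition pair_le :: "'a vec set \<times> 'a vec set \<Rightarrow> 'a vec set \<times> 'a vec set \<Rightarrow> bool" where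
  "pair_le p q \<longleftrightarrow> fst p \<subseteq> fst q"

definition pair_less :: "'a vec set \<times> 'a vec set \<Rightarrow> 'a vec set \<times> 'a vec set \<Rightarrow> bool" where
  "pair_less p q \<longleftrightarrow> pair_le p q \<and> p \<noteq> q"

definition maximal_chain ::
    "nat list \<Rightarrow> nat list \<Rightarrow> 'a :: field mat \<Rightarrow> ('a vec set \<times> 'a vec set) list \<Rightarrow> bool" where
  "maximal_chain ns ms A Cs \<longleftrightarrow> sorted_wrt pair_less Cs \<and>
     pred_on.maxchain (S_max ns ms A) pair_le (set Cs)"

text \<open>
  As \<open>k\<close> increases, \<open>X\<^sup>k\<close> grows and \<open>Y\<^sup>k\<close> shrinks.  In \<open>E\<close> the basis of \<open>U\<close> appears in reversed
  order, in \<open>F\<close> the basis of \<open>V\<close> appears in its own order.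
\<close>

definition adapted_basis :: "nat list \<Rightarrow> 'a :: field vec set list \<Rightarrow> 'a vec list \<Rightarrow> bool" where
  "adapted_basis ns Xs es \<longleftrightarrow>
     is_basis (sum_list ns) (carrier_vec (sum_list ns)) es \<and>
     (\<forall>e \<in> set es. \<exists>\<alpha> < length ns. e \<in> block_space ns \<alpha>) \<and>
     (\<forall>X \<in> set Xs. is_basis (sum_list ns) X (take (subspace_dim (sum_list ns) X) es))"

definition DM_decomposition ::
    "nat list \<Rightarrow> nat list \<Rightarrow> 'a :: field mat \<Rightarrow> ('a vec set \<times> 'a vec set) list \<Rightarrow>
     'a mat \<Rightarrow> 'a mat \<Rightarrow> 'a mat \<Rightarrow> bool" where
  "DM_decomposition ns ms A Cs E F D \<longleftrightarrow>
     maximal_chain ns ms A Cs \<and>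
     (\<exists>es fs. adapted_basis ns (map fst Cs) es \<and> adapted_basis ms (map snd Cs) fs \<and>
        E = mat_of_cols (sum_list ns) (rev es) \<and> F = mat_of_cols (sum_list ms) fs) \<and>
     D = E\<^sup>T * A * F"

definition block_diag_times_perm :: "nat list \<Rightarrow> 'a :: field mat \<Rightarrow> bool" where
  "block_diag_times_perm ns E \<longleftrightarrow> (\<exists>Bs \<pi>.
     length Bs = length ns \<and>
     (\<forall>\<alpha> < length ns. Bs ! \<alpha> \<in> carrier_mat (ns ! \<alpha>) (ns ! \<alpha>) \<and> invertible_mat (Bs ! \<alpha>)) \<and>
     \<pi> permutes {..<sum_list ns} \<and>
     E = diag_block_mat Bs *
           mat (sum_list ns) (sum_list ns) (\<lambda>(i, j). if i = \<pi> j then 1 else 0))"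


section \<open>Algebraic computation over a field\<close>

text \<open>
  Time is measured in the arithmetic (Blum--Shub--Smale, algebraic RAM) model: field elements are
  atomic, and the operations on them are \<open>0\<close>, \<open>1\<close>, \<open>+\<close>, \<open>-\<close>, \<open>*\<close>, \<open>/\<close> and the equality test.
  Control and addressing use natural numbers with addition, truncated subtraction and
  comparison.  There is deliberately no multiplication of natural numbers, so that after \<open>t\<close> steps
  all of them have \<open>O(t)\<close> more bits than the input, and no passage between field elements and
  natural numbers other than the tests.  Programs contain no field constants besides \<open>0\<close> and \<open>1\<close>.

  The memory consists of named scalars and two-dimensional arrays of both sorts, of which a program
  mentions finitely many.
  Every assignment and every test costs one unit.  The expressions in a program have constant size,
  so counting single operations instead changes the running time by a constant factor only.
  Division by zero yields \<open>0\<close>, as in HOL.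
\<close>

datatype nexp =
    NConst nat
  | NVar string
  | NArr string nexp nexp
  | NPlus nexp nexp
  | NMinus nexp nexp

datatype fexp =
    FZero
  | FOne
  | FVar string
  | FArr string nexp nexp
  | FPlus fexp fexp
  | FMinus fexp fexp
  | FTimes fexp fexp
  | FDiv fexp fexp

datatype bexp =
    NLess nexp nexp
  | NEq nexp nexp
  | FEq fexp fexp
  | BNot bexp
  | BAnd bexp bexp

datatype com =
    Skip
  | SetN string nexp
  | SetNArr string nexp nexp nexp
  | SetF string fexp
  | SetFArr string nexp nexp fexp
  | Seq com com
  | Cond bexp com com
  | While bexp com

record 'a store =
  nvar :: "string \<Rightarrow> nat"
  narr :: "string \<Rightarrow> nat \<Rightarrow> nat \<Rightarrow> nat"
  fvar :: "string \<Rightarrow> 'a"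
  farr :: "string \<Rightarrow> nat \<Rightarrow> nat \<Rightarrow> 'a"

fun nval :: "nexp \<Rightarrow> 'a store \<Rightarrow> nat" where
  "nval (NConst k) s = k"
| "nval (NVar x) s = nvar s x"
| "nval (NArr x a b) s = narr s x (nval a s) (nval b s)"
| "nval (NPlus a b) s = nval a s + nval b s"
| "nval (NMinus a b) s = nval a s - nval b s"

fun fval :: "fexp \<Rightarrow> 'a :: field store \<Rightarrow> 'a" where
  "fval FZero s = 0"
| "fval FOne s = 1"
| "fval (FVar x) s = fvar s x"
| "fval (FArr x a b) s = farr s x (nval a s) (nval b s)"
| "fval (FPlus a b) s = fval a s + fval b s"
| "fval (FMinus a b) s = fval a s - fval b s"
| "fval (FTimes a b) s = fval a s * fval b s"
| "fval (FDiv a b) s = fval a s / fval b s"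

fun bval :: "bexp \<Rightarrow> 'a :: field store \<Rightarrow> bool" where
  "bval (NLess a b) s \<longleftrightarrow> nval a s < nval b s"
| "bval (NEq a b) s \<longleftrightarrow> nval a s = nval b s"
| "bval (FEq a b) s \<longleftrightarrow> fval a s = fval b s"
| "bval (BNot b) s \<longleftrightarrow> \<not> bval b s"
| "bval (BAnd a b) s \<longleftrightarrow> bval a s \<and> bval b s"

definition upd2 :: "('k \<Rightarrow> nat \<Rightarrow> nat \<Rightarrow> 'b) \<Rightarrow> 'k \<Rightarrow> nat \<Rightarrow> nat \<Rightarrow> 'b \<Rightarrow> 'k \<Rightarrow> nat \<Rightarrow> nat \<Rightarrow> 'b" where
  "upd2 f x i j v = f(x := (f x)(i := (f x i)(j := v)))"

text \<open>\<open>runs c s t s'\<close>: started in \<open>s\<close>, the program \<open>c\<close> halts in \<open>s'\<close> after \<open>t\<close> steps.\<close>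

inductive runs :: "com \<Rightarrow> 'a :: field store \<Rightarrow> nat \<Rightarrow> 'a store \<Rightarrow> bool" where
  Skip: "runs Skip s 1 s"
| SetN: "runs (SetN x e) s 1 (s\<lparr>nvar := (nvar s)(x := nval e s)\<rparr>)"
| SetNArr: "runs (SetNArr x a b e) s 1
     (s\<lparr>narr := upd2 (narr s) x (nval a s) (nval b s) (nval e s)\<rparr>)"
| SetF: "runs (SetF x e) s 1 (s\<lparr>fvar := (fvar s)(x := fval e s)\<rparr>)"
| SetFArr: "runs (SetFArr x a b e) s 1
     (s\<lparr>farr := upd2 (farr s) x (nval a s) (nval b s) (fval e s)\<rparr>)"
| Seq: "runs c1 s t1 s1 \<Longrightarrow> runs c2 s1 t2 s2 \<Longrightarrow> runs (Seq c1 c2) s (t1 + t2) s2"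
| CondTrue: "bval b s \<Longrightarrow> runs c1 s t s' \<Longrightarrow> runs (Cond b c1 c2) s (1 + t) s'"
| CondFalse: "\<not> bval b s \<Longrightarrow> runs c2 s t s' \<Longrightarrow> runs (Cond b c1 c2) s (1 + t) s'"
| WhileFalse: "\<not> bval b s \<Longrightarrow> runs (While b c) s 1 s"
| WhileTrue: "bval b s \<Longrightarrow> runs c s t1 s1 \<Longrightarrow> runs (While b c) s1 t2 s2 \<Longrightarrow>
     runs (While b c) s (1 + t1 + t2) s2"

inductive_cases runs_SkipE: "runs Skip s t s'"
inductive_cases runs_SetNE: "runs (SetN x e) s t s'"
inductive_cases runs_SetNArrE: "runs (SetNArr x a b e) s t s'"
inductive_cases runs_SetFE: "runs (SetF x e) s t s'"
inductive_cases runs_SetFArrE: "runs (SetFArr x a b e) s t s'"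
inductive_cases runs_SeqE: "runs (Seq c1 c2) s t s'"
inductive_cases runs_CondE: "runs (Cond b c1 c2) s t s'"
inductive_cases runs_WhileE: "runs (While b c) s t s'"

lemma runs_deterministic:
  "runs c s t s' \<Longrightarrow> runs c s u s'' \<Longrightarrow> u = t \<and> s'' = s'"
proof (induction arbitrary: u s'' rule: runs.induct)
  case (Seq c1 s t1 s1 c2 t2 s2)
  obtain u1 r u2 where u: "u = u1 + u2" and r: "runs c1 s u1 r" "runs c2 r u2 s''"
    using Seq.prems by (rule runs_SeqE)
  from Seq.IH(1)[OF r(1)] Seq.IH(2) r(2) u show ?case by simp
next
  case (CondTrue b s c1 t s' c2)
  obtain u' where "u = Suc u'" and r: "runs c1 s u' s''"
    by (rule runs_CondE[OF CondTrue.prems]) (use CondTrue.hyps in simp_all)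
  with CondTrue.IH[OF r] show ?case by simp
next
  case (CondFalse b s c2 t s' c1)
  obtain u' where "u = Suc u'" and r: "runs c2 s u' s''"
    by (rule runs_CondE[OF CondFalse.prems]) (use CondFalse.hyps in simp_all)
  with CondFalse.IH[OF r] show ?case by simp
next
  case (WhileFalse b s c)
  show ?case by (rule runs_WhileE[OF WhileFalse.prems]) (use WhileFalse.hyps in simp_all)
next
  case (WhileTrue b s c t1 s1 t2 s2)
  obtain u1 r u2 where u: "u = Suc (u1 + u2)" and r: "runs c s u1 r" "runs (While b c) r u2 s''"
    by (rule runs_WhileE[OF WhileTrue.prems]) (use WhileTrue.hyps in simp_all)
  from WhileTrue.IH(1)[OF r(1)] WhileTrue.IH(2) r(2) u show ?case by simp
qed (erule runs_SkipE runs_SetNE runs_SetNArrE runs_SetFE runs_SetFArrE, simp)+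

text \<open>
  All memory cells that do not hold the input are 0.
\<close>

definition input_store :: "nat list \<Rightarrow> nat list \<Rightarrow> 'a :: field mat \<Rightarrow> 'a store" where
  "input_store ns ms A = \<lparr>
     nvar = (\<lambda>_. 0)(''n'' := sum_list ns, ''m'' := sum_list ms,
                    ''mu'' := length ns, ''nu'' := length ms),
     narr = (\<lambda>_ _ _. 0)(''ns'' := (\<lambda>\<alpha> j. if \<alpha> < length ns \<and> j = 0 then ns ! \<alpha> else 0),
                        ''ms'' := (\<lambda>\<beta> j. if \<beta> < length ms \<and> j = 0 then ms ! \<beta> else 0)),
     fvar = (\<lambda>_. 0),
     farr = (\<lambda>_ _ _. 0)(''A'' := (\<lambda>i j. if i < sum_list ns \<and> j < sum_list ms
                                          then A $$ (i, j) else 0))\<rparr>"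

definition output_mat :: "'a store \<Rightarrow> string \<Rightarrow> nat \<Rightarrow> nat \<Rightarrow> 'a mat" where
  "output_mat s x r c = mat r c (\<lambda>(i, j). farr s x i j)"

text \<open>
  The chain is output through its length and its dimensions \<open>i\<^sub>k\<close>, \<open>j\<^sub>k\<close>: the space \<open>X\<^sup>k\<close> is
  spanned by the last \<open>i\<^sub>k\<close> columns of \<open>E\<close>, and \<open>Y\<^sup>k\<close> by the first \<open>j\<^sub>k\<close> columns of \<open>F\<close>.
\<close>

definition output_chain ::
    "nat list \<Rightarrow> nat list \<Rightarrow> 'a :: field store \<Rightarrow> ('a vec set \<times> 'a vec set) list \<Rightarrow> bool" where
  "output_chain ns ms s Cs \<longleftrightarrow>
     length Cs = nvar s ''h'' + 1 \<and>
     (\<forall>k \<le> nvar s ''h''.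
        narr s ''i'' k 0 = subspace_dim (sum_list ns) (fst (Cs ! k)) \<and>
        narr s ''j'' k 0 = subspace_dim (sum_list ms) (snd (Cs ! k)))"

definition input_size :: "nat list \<Rightarrow> nat list \<Rightarrow> nat" where
  "input_size ns ms = sum_list ns + sum_list ms + length ns + length ms"

end

theory Submission
  imports Defs
begin

text \<open>
  Block-diagonal row and column operations bring \<open>A\<close> to a matrix \<open>B\<close> together with a matching of
  rows to columns in which every matched entry is nonzero and is the only nonzero entry of its
  block.  For such a matrix the maximum stable pairs are the coordinate pairs given by the vertex
  covers of the bipartite graph of nonzero entries, so that the DM-decomposition of \<open>A\<close> is the
  classical one of that graph.

  The normal form exists because the blocks have rank at most 1: pivoting on any nonzero entry in a
  free column clears the rest of its block, so the entry can replace the old partner of its row in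
  the matching.  A free column \<open>c\<close> at minimal distance from the free rows is treated first.  The rows
  closer to the free rows vanish in \<open>c\<close> and are not changed by the pivot, so the column that becomes
  free is closer.  Hence after at most \<open>n + 1\<close> pivots the matching grows.

  When no free column can be reached, the sets of rows closed under reachability give all maximum
  stable pairs, and adding the reachability sets of the rows in the order of their cardinality
  yields a maximal chain.
\<close>

section \<open>Programs with bounded loops\<close>

text \<open>Rank at most 1 enters as the vanishing of the 2x2 minors inside a block, which
  operations between rows or columns of one block preserve. Other matched entries survive a pivot
  because the pivot row, where it meets their block, vanishes there; likewise the column. Optimality
  is a duality of Koenig type. The spaces of a stable pair need not be coordinate spaces, but they
  are closed under projection to a block. Evaluating the form on projections to the block of an
  isolated entry leaves a single product, so a matched row and its column are never both in use.
  Hence each matched pair contributes at most one dimension. A pivot alters the graph of nonzero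
  entries, so an augmenting path found beforehand cannot simply be followed. The search is repeated
  after each pivot, and the pair (number of free rows, distance to a free column) decreases
  lexicographically. Order by cardinality works because a reachability set strictly inside another
  is smaller: its row has been treated before, so no closed set fits between consecutive members.
  The running time is read off the syntax: all loops are bounded by input cells that no program
  overwrites.\<close>

datatype prog =
    PSkip
  | PSetN string nexp
  | PSetNArr string nexp nexp nexp
  | PSetF string fexp
  | PSetFArr string nexp nexp fexp
  | PSeq prog prog  (infixr ";;" 60)
  | PIf bexp prog prog
  | PFor string nexp prog

definition setn :: "string \<Rightarrow> nat \<Rightarrow> 'a store \<Rightarrow> 'a store" where
  "setn x v s = s\<lparr>nvar := (nvar s)(x := v)\<rparr>"

definition setf :: "string \<Rightarrow> 'a \<Rightarrow> 'a store \<Rightarrow> 'a store" where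
  "setf x v s = s\<lparr>fvar := (fvar s)(x := v)\<rparr>"

definition setna :: "string \<Rightarrow> nat \<Rightarrow> nat \<Rightarrow> nat \<Rightarrow> 'a store \<Rightarrow> 'a store" where
  "setna x i j v s = s\<lparr>narr := upd2 (narr s) x i j v\<rparr>"

definition setfa :: "string \<Rightarrow> nat \<Rightarrow> nat \<Rightarrow> 'a \<Rightarrow> 'a store \<Rightarrow> 'a store" where
  "setfa x i j v s = s\<lparr>farr := upd2 (farr s) x i j v\<rparr>"

lemma set_simps [simp]:
  "nvar (setn x v s) y = (if y = x then v else nvar s y)"
  "narr (setn x v s) = narr s" "fvar (setn x v s) = fvar s" "farr (setn x v s) = farr s"
  "nvar (setf x u s) = nvar s" "narr (setf x u s) = narr s"
  "fvar (setf x u s) y = (if y = x then u else fvar s y)" "farr (setf x u s) = farr s"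
  "nvar (setna x i j v s) = nvar s" "fvar (setna x i j v s) = fvar s"
    "farr (setna x i j v s) = farr s"
  "narr (setna x i j v s) y a b = (if y = x \<and> a = i \<and> b = j then v else narr s y a b)"
  "nvar (setfa x i j u s) = nvar s" "fvar (setfa x i j u s) = fvar s"
    "narr (setfa x i j u s) = narr s"
  "farr (setfa x i j u s) y a b = (if y = x \<and> a = i \<and> b = j then u else farr s y a b)"
  by (auto simp: setn_def setf_def setna_def setfa_def upd2_def)

lemma set_other [simp]:
  "y \<noteq> x \<Longrightarrow> narr (setna x i j v s) y = narr s y"
  "y \<noteq> x \<Longrightarrow> farr (setfa x i j u s) y = farr s y"
  by (auto simp: setna_def setfa_def upd2_def)

text \<open>The while loop evaluates its bound before every pass, whereas \<open>sem\<close>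
  evaluates it once; the side conditions of \<open>wf_prog\<close> make the two agree.\<close>

primrec compile :: "prog \<Rightarrow> com" where
  "compile PSkip = Skip"
| "compile (PSetN x e) = SetN x e"
| "compile (PSetNArr x a b e) = SetNArr x a b e"
| "compile (PSetF x e) = SetF x e"
| "compile (PSetFArr x a b e) = SetFArr x a b e"
| "compile (p ;; q) = Seq (compile p) (compile q)"
| "compile (PIf b p q) = Cond b (compile p) (compile q)"
| "compile (PFor x e p) = Seq (SetN x (NConst 0))
     (While (NLess (NVar x) e) (Seq (compile p) (SetN x (NPlus (NVar x) (NConst 1)))))"

text \<open>A loop leaves its counter at the value of the bound, as the compiled loop does when its
  test finally fails.\<close>

primrec sem :: "prog \<Rightarrow> 'a :: field store \<Rightarrow> 'a store" where
  "sem PSkip = (\<lambda>s. s)"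
| "sem (PSetN x e) = (\<lambda>s. setn x (nval e s) s)"
| "sem (PSetNArr x a b e) = (\<lambda>s. setna x (nval a s) (nval b s) (nval e s) s)"
| "sem (PSetF x e) = (\<lambda>s. setf x (fval e s) s)"
| "sem (PSetFArr x a b e) = (\<lambda>s. setfa x (nval a s) (nval b s) (fval e s) s)"
| "sem (p ;; q) = (\<lambda>s. sem q (sem p s))"
| "sem (PIf b p q) = (\<lambda>s. if bval b s then sem p s else sem q s)"
| "sem (PFor x e p) = (\<lambda>s. setn x (nval e s)
     (fold (\<lambda>i t. sem p (setn x i t)) [0..<nval e s] s))"

primrec written_vars :: "prog \<Rightarrow> string set" where
  "written_vars PSkip = {}" | "written_vars (PSetN x e) = {x}" | "written_vars (PSetNArr x a b e) =
    {}"
| "written_vars (PSetF x e) = {}" | "written_vars (PSetFArr x a b e) = {}"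
| "written_vars (p ;; q) = written_vars p \<union> written_vars q" | "written_vars (PIf b p q) =
  written_vars p \<union> written_vars q" | "written_vars (PFor x e p) = insert x (written_vars p)"

primrec written_narrs :: "prog \<Rightarrow> string set" where
  "written_narrs PSkip = {}" | "written_narrs (PSetN x e) =
    {}" | "written_narrs (PSetNArr x a b e) = {x}"
| "written_narrs (PSetF x e) = {}" | "written_narrs (PSetFArr x a b e) = {}"
| "written_narrs (p ;; q) = written_narrs p \<union> written_narrs q" | "written_narrs (PIf b p q) =
  written_narrs p \<union> written_narrs q" | "written_narrs (PFor x e p) = written_narrs p"

primrec written_farrs :: "prog \<Rightarrow> string set" where
  "written_farrs PSkip = {}" | "written_farrs (PSetN x e) =
    {}" | "written_farrs (PSetNArr x a b e) = {}"
| "written_farrs (PSetF x e) = {}" | "written_farrs (PSetFArr x a b e) = {x}"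
| "written_farrs (p ;; q) = written_farrs p \<union> written_farrs q" | "written_farrs (PIf b p q) =
  written_farrs p \<union> written_farrs q" | "written_farrs (PFor x e p) = written_farrs p"

lemma fold_inv: "(\<And>i t. P t \<Longrightarrow> P (f i t)) \<Longrightarrow> P s \<Longrightarrow> P (fold f xs s)"
  by (induction xs arbitrary: s) auto

lemma sem_frame_n: "x \<notin> written_vars p \<Longrightarrow> nvar (sem p s) x = nvar s x"
proof (induction p arbitrary: s)
  case (PFor y e p)
  have "nvar (fold (\<lambda>i t. sem p (setn y i t)) xs s) x = nvar s x" for xs
    using PFor by (intro fold_inv[where P = "\<lambda>t. nvar t x = nvar s x"]) auto
  then show ?case using PFor by auto
qed auto

lemma sem_frame_na: "x \<notin> written_narrs p \<Longrightarrow> narr (sem p s) x = narr s x"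
proof (induction p arbitrary: s)
  case (PFor y e p)
  have "narr (fold (\<lambda>i t. sem p (setn y i t)) xs s) x = narr s x" for xs
    using PFor by (intro fold_inv[where P = "\<lambda>t. narr t x = narr s x"]) auto
  then show ?case using PFor by auto
qed auto

lemma sem_frame_fa: "x \<notin> written_farrs p \<Longrightarrow> farr (sem p s) x = farr s x"
proof (induction p arbitrary: s)
  case (PFor y e p)
  have "farr (fold (\<lambda>i t. sem p (setn y i t)) xs s) x = farr s x" for xs
    using PFor by (intro fold_inv[where P = "\<lambda>t. farr t x = farr s x"]) auto
  then show ?case using PFor by auto
qed auto

lemmas frame = sem_frame_n sem_frame_na sem_frame_fa

text \<open>The input cells that bound all loops and that no program may write.\<close>

definition dim_vars :: "string set" where "dim_vars = {''n'', ''m'', ''mu'', ''nu''}"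
definition dim_arrs :: "string set" where "dim_arrs = {''ns'', ''ms''}"

text \<open>The index of an array cell is unrestricted, because \<open>dims_le\<close> bounds all
  cells of a protected array at once.\<close>

primrec bound_ok :: "nexp \<Rightarrow> bool" where
  "bound_ok (NConst k) = True" | "bound_ok (NVar x) \<longleftrightarrow> x \<in> dim_vars"
| "bound_ok (NArr x a b) \<longleftrightarrow> x \<in> dim_arrs" | "bound_ok (NPlus a b) \<longleftrightarrow> bound_ok a \<and> bound_ok b"
| "bound_ok (NMinus a b) \<longleftrightarrow> False"

text \<open>The variable of the polynomial stands for the input size, which dominates every
  protected cell; hence the same monomial for all of them.\<close>

primrec bound_poly :: "nexp \<Rightarrow> nat poly" where
  "bound_poly (NConst k) = [:k:]" | "bound_poly (NVar x) = [:0, 1:]"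
| "bound_poly (NArr x a b) = [:0, 1:]" | "bound_poly (NPlus a b) = bound_poly a + bound_poly b"
| "bound_poly (NMinus a b) = 0"

primrec nexp_vars :: "nexp \<Rightarrow> string set" where
  "nexp_vars (NConst k) = {}" | "nexp_vars (NVar x) = {x}" | "nexp_vars (NArr x a b) =
    nexp_vars a \<union> nexp_vars b"
| "nexp_vars (NPlus a b) = nexp_vars a \<union> nexp_vars b" | "nexp_vars (NMinus a b) =
  nexp_vars a \<union> nexp_vars b"

primrec nexp_arrs :: "nexp \<Rightarrow> string set" where
  "nexp_arrs (NConst k) = {}" | "nexp_arrs (NVar x) = {}" | "nexp_arrs (NArr x a b) =
    insert x (nexp_arrs a \<union> nexp_arrs b)"
| "nexp_arrs (NPlus a b) = nexp_arrs a \<union> nexp_arrs b" | "nexp_arrs (NMinus a b) =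
  nexp_arrs a \<union> nexp_arrs b"

text \<open>In a loop the body can change neither the counter nor anything that the bound reads,
  including cells inside array indices. The number of passes is thus fixed on entry.\<close>

primrec wf_prog :: "prog \<Rightarrow> bool" where
  "wf_prog PSkip = True" | "wf_prog (PSetN x e) \<longleftrightarrow> x \<notin> dim_vars" | "wf_prog (PSetNArr x a b e) \<longleftrightarrow>
    x \<notin> dim_arrs"
| "wf_prog (PSetF x e) = True" | "wf_prog (PSetFArr x a b e) = True"
| "wf_prog (p ;; q) \<longleftrightarrow> wf_prog p \<and> wf_prog q" | "wf_prog (PIf b p q) \<longleftrightarrow> wf_prog p \<and> wf_prog q"
| "wf_prog (PFor x e p) \<longleftrightarrow> wf_prog p \<and> x \<notin> dim_vars \<and> x \<notin> written_vars p \<and> bound_ok e \<and>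
     nexp_vars e \<inter> insert x (written_vars p) = {} \<and> nexp_arrs e \<inter> written_narrs p = {}"

text \<open>Both branches of a conditional are added, which replaces a maximum by a polynomial. A
  loop pays for initializing the counter and for the last, failing test; each pass pays for its test
  and the increment, whence \<open>cost p + 2\<close>.\<close>

primrec cost :: "prog \<Rightarrow> nat poly" where
  "cost PSkip = 1" | "cost (PSetN x e) = 1" | "cost (PSetNArr x a b e) = 1"
| "cost (PSetF x e) = 1" | "cost (PSetFArr x a b e) = 1"
| "cost (p ;; q) = cost p + cost q" | "cost (PIf b p q) = 1 + cost p + cost q"
| "cost (PFor x e p) = 2 + bound_poly e * (cost p + 2)"

section \<open>Running time of compiled programs\<close>

definition dims_le :: "nat \<Rightarrow> 'a store \<Rightarrow> bool" where
  "dims_le N s \<longleftrightarrow> (\<forall>x\<in>dim_vars. nvar s x \<le> N) \<and> (\<forall>x\<in>dim_arrs. \<forall>i j. narr s x i j \<le> N)"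

lemma nval_cong:
  "(\<And>x. x \<in> nexp_vars e \<Longrightarrow> nvar s x = nvar t x) \<Longrightarrow> (\<And>x. x \<in> nexp_arrs e \<Longrightarrow> narr s x = narr t x) \<Longrightarrow>
   nval e s = nval e t"
  by (induction e) auto

lemma nval_le_bound: "bound_ok e \<Longrightarrow> dims_le N s \<Longrightarrow> nval e s \<le> poly (bound_poly e) N"
  by (induction e) (auto simp: dims_le_def intro: add_mono)

lemma wf_prog_writes: "wf_prog p \<Longrightarrow> written_vars p \<inter> dim_vars = {} \<and> written_narrs p \<inter> dim_arrs = {}"
  by (induction p) auto

lemma dims_le_sem: "wf_prog p \<Longrightarrow> dims_le N s \<Longrightarrow> dims_le N (sem p s)"
  using wf_prog_writes[of p] sem_frame_n[of _ p s] sem_frame_na[of _ p s]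
  unfolding dims_le_def by (metis disjoint_iff)

text \<open>Induction on the program. The bound on the dimensions is carried along by
  \<open>dims_le_sem\<close>, so an inner loop obeys the same polynomial wherever it is
  entered.\<close>

lemma runs_compile:
  assumes "wf_prog p" "dims_le N s"
  shows "\<exists>t. runs (compile p) s t (sem p s) \<and> t \<le> poly (cost p) N"
  using assms
proof (induction p arbitrary: s)
  case (PSeq p q)
  obtain t1 where t1: "runs (compile p) s t1 (sem p s)" "t1 \<le> poly (cost p) N"
    using PSeq.IH(1)[of s] PSeq.prems by auto
  obtain t2 where t2: "runs (compile q) (sem p s) t2 (sem q (sem p s))" "t2 \<le> poly (cost q) N"
    using PSeq.IH(2)[of "sem p s"] PSeq.prems dims_le_sem by auto
  show ?case
    using runs.Seq[OF t1(1) t2(1)] t1(2) t2(2) by (auto intro!: exI[of _ "t1 + t2"])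
next
  case (PIf b p q)
  show ?case
  proof (cases "bval b s")
    case True
    obtain t where "runs (compile p) s t (sem p s)" "t \<le> poly (cost p) N"
      using PIf.IH(1)[of s] PIf.prems by auto
    then show ?thesis using True runs.CondTrue[OF True] by (auto intro!: exI[of _ "1 + t"])
  next
    case False
    obtain t where "runs (compile q) s t (sem q s)" "t \<le> poly (cost q) N"
      using PIf.IH(2)[of s] PIf.prems by auto
    then show ?thesis using False runs.CondFalse[OF False] by (auto intro!: exI[of _ "1 + t"])
  qed
next
  case (PFor x e p)
  let ?N = "nval e s"
  let ?F = "\<lambda>i t :: 'a store. sem p (setn x i t)"
  let ?c = "Seq (compile p) (SetN x (NPlus (NVar x) (NConst 1)))"
  have xp: "nvar (sem p t) x = nvar t x" for t :: "'a store"
    using PFor.prems by (intro sem_frame_n) auto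
  \<comment> \<open>\<open>k\<close> counts the passes that remain, so the counter stands at
    \<open>?N - k\<close>. The third premise, that the bound still evaluates to \<open>?N\<close>,
    is re-established after each pass from the frame conditions.\<close>
  have "\<exists>u. runs (While (NLess (NVar x) e) ?c) (setn x (?N - k) t) u
            (setn x ?N (fold ?F [?N - k..<?N] t)) \<and> u \<le> 1 + k * (poly (cost p) N + 2)"
    if "k \<le> ?N" "dims_le N t" "nval e (setn x (?N - k) t) = ?N" for k t
    using that
  proof (induction k arbitrary: t)
    case 0
    have "nvar (setn x ?N t) x = ?N" by simp
    then have "\<not> bval (NLess (NVar x) e) (setn x ?N t)"
      using 0(3) unfolding bval.simps nval.simps diff_zero by simp
    from runs.WhileFalse[OF this, of ?c] show ?case by auto
  next
    case (Suc k)
    let ?i = "?N - Suc k" and ?t = "setn x (?N - Suc k) t"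
    have b: "bval (NLess (NVar x) e) ?t" using Suc.prems by auto
    have dt: "dims_le N ?t" using Suc.prems PFor.prems by (auto simp: dims_le_def)
    obtain u where u: "runs (compile p) ?t u (sem p ?t)" "u \<le> poly (cost p) N"
      using PFor.IH[OF _ dt] PFor.prems by auto
    have i: "Suc ?i = ?N - k" using Suc.prems by auto
    have r: "runs ?c ?t (u + 1) (setn x (?N - k) (sem p ?t))"
      using runs.Seq[OF u(1) runs.SetN[of x "NPlus (NVar x) (NConst 1)"]] i
      by (simp add: xp setn_def[symmetric])
    have nv: "nval e (setn x (?N - k) (sem p ?t)) = nval e ?t"
    proof (rule nval_cong)
      fix y assume "y \<in> nexp_vars e"
      then have "y \<noteq> x" "y \<notin> written_vars p" using PFor.prems(1) by auto
      then show "nvar (setn x (?N - k) (sem p ?t)) y = nvar ?t y" by (simp add: sem_frame_n)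
    next
      fix y assume "y \<in> nexp_arrs e"
      then have "y \<notin> written_narrs p" using PFor.prems(1) by auto
      then show "narr (setn x (?N - k) (sem p ?t)) y = narr ?t y" by (simp add: sem_frame_na)
    qed
    obtain v where v: "runs (While (NLess (NVar x) e) ?c) (setn x (?N - k) (sem p ?t)) v
            (setn x ?N (fold ?F [?N - k..<?N] (sem p ?t)))" "v \<le> 1 + k * (poly (cost p) N + 2)"
      using Suc.IH[of "sem p ?t"] Suc.prems nv dt dims_le_sem[OF _ dt] PFor.prems by auto
    have "[?i..<?N] = ?i # [?N - k..<?N]" using i Suc.prems
        by (metis upt_rec diff_Suc_less less_eq_Suc_le zero_less_Suc order_less_le_trans)
    then have "fold ?F [?i..<?N] t = fold ?F [?N - k..<?N] (sem p ?t)" by simp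
    then show ?case using runs.WhileTrue[OF b r v(1)] u(2) v(2)
      by (intro exI[of _ "1 + (u + 1) + v"]) auto
  qed
  moreover have "nval e (setn x 0 s) = ?N"
    using PFor.prems(1) by (intro nval_cong) auto
  ultimately obtain u where u: "runs (While (NLess (NVar x) e) ?c) (setn x 0 s) u
       (sem (PFor x e p) s)" "u \<le> 1 + ?N * (poly (cost p) N + 2)"
    using PFor.prems(2) by (metis diff_self_eq_0 order_refl sem.simps(8))
  have "?N * (poly (cost p) N + 2) \<le> poly (bound_poly e) N * (poly (cost p) N + 2)"
    using nval_le_bound PFor.prems by (intro mult_right_mono) auto
  moreover have "runs (SetN x (NConst 0)) s 1 (setn x 0 s)"
    using runs.SetN[of x "NConst 0" s] by (simp add: setn_def[symmetric])
  from runs.Seq[OF this u(1)] have "runs (compile (PFor x e p)) s (1 + u) (sem (PFor x e p) s)"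
    by simp
  ultimately show ?case using u(2)
    by (intro exI[of _ "1 + u"]) (simp add: algebra_simps)
qed (auto intro: runs.intros exI[of _ 1] simp: setn_def setf_def setna_def setfa_def simp del:
  One_nat_def)

section \<open>A loop rule with built-in frame condition\<close>

definition framed :: "prog \<Rightarrow> 'a store \<Rightarrow> 'a store \<Rightarrow> bool" where
  "framed p s t \<longleftrightarrow> (\<forall>x. x \<notin> written_vars p \<longrightarrow> nvar t x = nvar s x) \<and>
     (\<forall>x. x \<notin> written_narrs p \<longrightarrow> narr t x = narr s x) \<and> (\<forall>x. x \<notin> written_farrs p \<longrightarrow> farr t x =
       farr s x)"

lemma framed_simps:
  assumes "framed p s t"
  shows "x \<notin> written_vars p \<Longrightarrow> nvar t x = nvar s x" "x \<notin> written_narrs p \<Longrightarrow> narr t x = narr s x"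
    "x \<notin> written_farrs p \<Longrightarrow> farr t x = farr s x"
  using assms by (auto simp: framed_def)

text \<open>The invariant describes the store before the counter is set for the next pass, which
  explains \<open>setn\<close> in the second and third premises. Intermediate stores are
  \<open>framed\<close>, so an invariant need mention only cells that the loop changes.\<close>

lemma sem_for_rule:
  assumes "I 0 s"
    and "\<And>i t. i < nval e s \<Longrightarrow> I i t \<Longrightarrow> framed (PFor x e p) s t \<Longrightarrow> I (Suc i) (sem p (setn x i t))"
    and "\<And>t. I (nval e s) t \<Longrightarrow> framed (PFor x e p) s t \<Longrightarrow> Q (setn x (nval e s) t)"
  shows "Q (sem (PFor x e p) s)"
proof -
  let ?f = "\<lambda>i t. sem p (setn x i t)"
  have fr: "framed (PFor x e p) s (fold ?f [0..<k] s)" for k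
    by (rule fold_inv) (auto simp: framed_def frame)
  have "I k (fold ?f [0..<k] s)" if "k \<le> nval e s" for k
    using that by (induction k) (auto simp: assms(1) intro: assms(2) fr)
  from assms(3)[OF this[of "nval e s"] fr] show ?thesis by simp
qed

section \<open>Pivoting and augmenting\<close>

definition rowop :: "(nat \<Rightarrow> 'a :: field) \<Rightarrow> nat \<Rightarrow> nat \<Rightarrow> nat \<Rightarrow> (nat \<Rightarrow> nat \<Rightarrow> 'a) \<Rightarrow> nat \<Rightarrow> nat \<Rightarrow> 'a"
  where
  "rowop g r n w B = (\<lambda>x y. if x < n \<and> y < w then B x y - g x * B r y else B x y)"

text \<open>Transposition: column operations and their properties are obtained as row operations on
  the transposed array, with \<open>n\<close> and \<open>m\<close> exchanged.\<close>

definition swap_args :: "(nat \<Rightarrow> nat \<Rightarrow> 'a) \<Rightarrow> nat \<Rightarrow> nat \<Rightarrow> 'a" where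
  "swap_args B = (\<lambda>x y. B y x)"

lemma swap_args_simps [simp]: "swap_args B x y = B y x" "swap_args (swap_args B) = B"
  by (auto simp: swap_args_def)

text \<open>
  The transformed matrix and the transformations are kept in a single array \<open>B\<close> of the shape
  \<open>[[P\<^sup>T A Q, P\<^sup>T], [Q, 0]]\<close>, so that a row or column operation updates all of them at once.
\<close>

definition minors :: "nat \<Rightarrow> nat \<Rightarrow> (nat \<Rightarrow> nat) \<Rightarrow> (nat \<Rightarrow> nat) \<Rightarrow> (nat \<Rightarrow> nat \<Rightarrow> 'a :: field) \<Rightarrow> bool"
  where
  "minors n m rb cb B \<longleftrightarrow> (\<forall>x<n. \<forall>x'<n. \<forall>y<m. \<forall>y'<m. rb x = rb x' \<longrightarrow> cb y = cb y' \<longrightarrow>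
     B x y * B x' y' = B x y' * B x' y)"

definition transformed :: "nat \<Rightarrow> nat \<Rightarrow> (nat \<Rightarrow> nat \<Rightarrow> 'a :: field) \<Rightarrow> (nat \<Rightarrow> nat \<Rightarrow> 'a) \<Rightarrow> bool" where
  "transformed n m A B \<longleftrightarrow> (\<forall>x<n. \<forall>y<m. B x y = (\<Sum>i<n. \<Sum>j<m. B x (m + i) * A i j * B (n + j) y))"

text \<open>The first part is block-diagonality of the row transformation. The second says that its
  transpose has trivial kernel; this form of invertibility passes through a row operation by mere
  substitution. For \<open>swap_args B\<close> both concern the column transformation.\<close>

definition rows_ok :: "nat \<Rightarrow> nat \<Rightarrow> (nat \<Rightarrow> nat) \<Rightarrow> (nat \<Rightarrow> nat \<Rightarrow> 'a :: field) \<Rightarrow> bool" where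
  "rows_ok n m rb B \<longleftrightarrow> (\<forall>x<n. \<forall>i<n. B x (m + i) \<noteq> 0 \<longrightarrow> rb x = rb i) \<and>
     (\<forall>v. (\<forall>x<n. (\<Sum>i<n. B x (m + i) * v i) = 0) \<longrightarrow> (\<forall>i<n. v i = 0))"

definition equivalent :: "nat \<Rightarrow> nat \<Rightarrow> (nat \<Rightarrow> nat) \<Rightarrow> (nat \<Rightarrow> nat) \<Rightarrow> (nat \<Rightarrow> nat \<Rightarrow> 'a :: field) \<Rightarrow> (nat \<Rightarrow>
  nat \<Rightarrow> 'a) \<Rightarrow> bool" where
  "equivalent n m rb cb A B \<longleftrightarrow> minors n m rb cb B \<and> transformed n m A B \<and>
     rows_ok n m rb B \<and> rows_ok m n cb (swap_args B)"

lemma minors_swap_args: "minors n m rb cb B \<Longrightarrow> minors m n cb rb (swap_args B)"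
  unfolding minors_def swap_args_simps by (simp add: mult.commute)

lemma transformed_swap_args: "transformed n m A B \<Longrightarrow> transformed m n (swap_args A) (swap_args B)"
proof -
  assume "transformed n m A B"
  moreover have "(\<Sum>i<n. \<Sum>j<m. B x (m + i) * A i j * B (n + j) y) =
    (\<Sum>j<m. \<Sum>i<n. B (n + j) y * A i j * B x (m + i))" for x y
    by (subst sum.swap) (simp add: mult_ac)
  ultimately show ?thesis by (simp add: transformed_def)
qed

lemma equivalent_swap_args: "equivalent n m rb cb A B \<Longrightarrow> equivalent m n cb rb (swap_args A)
  (swap_args B)"
  by (auto simp: equivalent_def minors_swap_args transformed_swap_args)

text \<open>Expanding the product leaves minors of the row pairs (x, x'), (x, r) and (r, x'). The
  last two occur with a multiplier; where that is nonzero, row \<open>r\<close> belongs to the same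
  block and the minor vanishes.\<close>

lemma minors_rowop:
  assumes "minors n m rb cb B" "r < n" "\<And>x. g x \<noteq> 0 \<Longrightarrow> rb x = rb r" "m \<le> w"
  shows "minors n m rb cb (rowop g r n w B)"
  unfolding minors_def
proof (intro allI impI)
  fix x x' y y'
  assume h: "x < n" "x' < n" "y < m" "y' < m" "rb x = rb x'" "cb y = cb y'"
  have 1: "B x y * B x' y' = B x y' * B x' y" using assms(1) h by (simp add: minors_def)
  have 2: "g x' * (B x y * B r y') = g x' * (B x y' * B r y)"
  proof (cases "g x' = 0")
    case False
    then have "B x y * B r y' = B x y' * B r y"
      using assms(1,2) assms(3)[OF False] h unfolding minors_def by auto
    then show ?thesis by simp
  qed simp
  have 3: "g x * (B r y * B x' y') = g x * (B r y' * B x' y)"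
  proof (cases "g x = 0")
    case False
    then have "B r y * B x' y' = B r y' * B x' y"
      using assms(1,2) assms(3)[OF False] h unfolding minors_def by auto
    then show ?thesis by simp
  qed simp
  have "(B x y - g x * B r y) * (B x' y' - g x' * B r y') =
        B x y * B x' y' - g x' * (B x y * B r y') - g x * (B r y * B x' y') +
          g x * g x' * (B r y * B r y')"
    by (simp add: algebra_simps)
  also have "\<dots> = (B x y' - g x * B r y') * (B x' y - g x' * B r y)"
    unfolding 1 2 3 by (simp add: algebra_simps)
  finally show "rowop g r n w B x y * rowop g r n w B x' y' =
    rowop g r n w B x y' * rowop g r n w B x' y"
    using h assms(4) by (simp add: rowop_def)
qed

text \<open>The identity is linear in row \<open>x\<close>. With \<open>w = m + n\<close> the
  operation acts alike on the matrix part of the row and on its part of the row transformation,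
  while the rows from \<open>n\<close> on, which hold the column transformation, stay fixed.\<close>

lemma transformed_rowop:
  assumes "transformed n m A B" "r < n" "w = m + n"
  shows "transformed n m A (rowop g r n w B)"
  unfolding transformed_def
proof (intro allI impI)
  fix x y assume h: "x < n" "y < m"
  let ?S = "\<lambda>x. \<Sum>i<n. \<Sum>j<m. B x (m + i) * A i j * B (n + j) y"
  have "B x y = ?S x" "B r y = ?S r"
    using h assms(1,2) unfolding transformed_def by blast+
  moreover have "rowop g r n w B x y = B x y - g x * B r y"
    using h assms(3) by (simp add: rowop_def)
  ultimately have "rowop g r n w B x y = ?S x - g x * ?S r" by metis
  also have "\<dots> = (\<Sum>i<n. \<Sum>j<m. (B x (m + i) - g x * B r (m + i)) * A i j * B (n + j) y)"
    by (simp only: sum_distrib_left sum_subtractf[symmetric] left_diff_distrib mult.assoc)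
  also have "\<dots> = (\<Sum>i<n. \<Sum>j<m. rowop g r n w B x (m + i) * A i j * rowop g r n w B (n + j) y)"
    using h assms by (intro sum.cong refl) (auto simp: rowop_def)
  finally show "rowop g r n w B x y = \<dots>" .
qed

text \<open>As \<open>g r = 0\<close>, row \<open>r\<close> is kept and its equation can be added
  back to the others, so a vector annihilated by the new rows is annihilated by the old
  ones.\<close>

lemma rows_ok_rowop:
  assumes "rows_ok n m rb B" "r < n" "g r = 0" "\<And>x. g x \<noteq> 0 \<Longrightarrow> rb x = rb r" "w = m + n"
  shows "rows_ok n m rb (rowop g r n w B)"
  unfolding rows_ok_def
proof (intro conjI allI impI)
  fix x i assume h: "x < n" "i < n" "rowop g r n w B x (m + i) \<noteq> 0"
  then have "B x (m + i) \<noteq> 0 \<or> g x \<noteq> 0 \<and> B r (m + i) \<noteq> 0" using assms(5)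
    by (auto simp: rowop_def split: if_splits)
  then show "rb x = rb i"
  proof
    assume "B x (m + i) \<noteq> 0"
    then show ?thesis using assms(1) h(1,2) unfolding rows_ok_def by blast
  next
    assume a: "g x \<noteq> 0 \<and> B r (m + i) \<noteq> 0"
    then have "rb r = rb i" using assms(1,2) h(2) unfolding rows_ok_def by blast
    then show ?thesis using assms(4) a by simp
  qed
next
  fix v i assume v: "\<forall>x<n. (\<Sum>i<n. rowop g r n w B x (m + i) * v i) = 0" and i: "i < n"
  have e: "(\<Sum>i<n. B x (m + i) * v i) - g x * (\<Sum>i<n. B r (m + i) * v i) = 0" if "x < n" for x
  proof -
    have "(\<Sum>i<n. rowop g r n w B x (m + i) * v i) = (\<Sum>i<n. (B x (m + i) - g x * B r (m + i)) * v i)"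
      using that assms(5) by (intro sum.cong) (auto simp: rowop_def)
    also have "\<dots> = (\<Sum>i<n. B x (m + i) * v i) - g x * (\<Sum>i<n. B r (m + i) * v i)"
      by (simp only: sum_distrib_left sum_subtractf left_diff_distrib mult.assoc)
    finally show ?thesis using v that by simp
  qed
  have "(\<Sum>i<n. B r (m + i) * v i) = 0" using e[OF assms(2)] assms(3) by simp
  then have "\<forall>x<n. (\<Sum>i<n. B x (m + i) * v i) = 0" using e by simp
  with assms(1) i show "v i = 0" unfolding rows_ok_def by blast
qed

lemma rows_ok_rowop_swap_args:
  assumes "rows_ok m n cb (swap_args B)"
  shows "rows_ok m n cb (swap_args (rowop g r n w B))"
proof -
  have "swap_args (rowop g r n w B) x (n + i) = swap_args B x (n + i)" for x i
    by (simp add: rowop_def)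
  then show ?thesis using assms unfolding rows_ok_def by presburger
qed

lemma equivalent_rowop:
  assumes "equivalent n m rb cb A B" "r < n" "g r = 0" "\<And>x. g x \<noteq> 0 \<Longrightarrow> rb x = rb r" "w = m + n"
  shows "equivalent n m rb cb A (rowop g r n w B)"
  using assms(1) minors_rowop[of n m rb cb B r g w, OF _ assms(2,4)] transformed_rowop[OF _
    assms(2,5), of A B g]
    rows_ok_rowop[of n m rb B r g w, OF _ assms(2-5)] rows_ok_rowop_swap_args[of m n cb B g r w]
      assms(5)
  unfolding equivalent_def by simp

section \<open>Isolated entries under pivoting\<close>

definition isolated :: "nat \<Rightarrow> nat \<Rightarrow> (nat \<Rightarrow> nat) \<Rightarrow> (nat \<Rightarrow> nat) \<Rightarrow> (nat \<Rightarrow> nat \<Rightarrow> 'a :: field) \<Rightarrow> nat \<Rightarrow>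
  nat \<Rightarrow> bool" where
  "isolated n m rb cb B r c \<longleftrightarrow> B r c \<noteq> 0 \<and>
     (\<forall>x<n. \<forall>y<m. rb x = rb r \<longrightarrow> cb y = cb c \<longrightarrow> B x y \<noteq> 0 \<longrightarrow> x = r \<and> y = c)"

lemma isolated_swap_args [simp]: "isolated m n cb rb (swap_args B) c r \<longleftrightarrow> isolated n m rb cb B r c"
  by (auto simp: isolated_def)

text \<open>A row in the block row of the isolated entry changes only if row \<open>r\<close> lies
  in that block row too. Being different from \<open>r'\<close>, row \<open>r\<close> then vanishes
  on the columns of the block, so nothing changes there.\<close>

lemma isolated_rowop:
  assumes "isolated n m rb cb B r' c'" "r < n" "r \<noteq> r'" "r' < n" "c' < m"
    "\<And>x. g x \<noteq> 0 \<Longrightarrow> rb x = rb r"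
  shows "isolated n m rb cb (rowop g r n w B) r' c'"
proof -
  have e: "rowop g r n w B x y = B x y" if "x < n" "y < m" "rb x = rb r'" "cb y = cb c'" for x y
  proof (cases "g x = 0")
    case False
    then have "B r y = 0" using assms(1-5) assms(6)[OF False] that unfolding isolated_def by metis
    then show ?thesis by (simp add: rowop_def)
  qed (simp add: rowop_def)
  from assms(1) show ?thesis unfolding isolated_def by (simp add: e assms(4,5))
qed

definition elim_coeff :: "(nat \<Rightarrow> nat) \<Rightarrow> (nat \<Rightarrow> nat \<Rightarrow> 'a :: field) \<Rightarrow> nat \<Rightarrow> nat \<Rightarrow> nat \<Rightarrow> 'a" where
  "elim_coeff rb B r c x = (if x \<noteq> r \<and> rb x = rb r then B x c / B r c else 0)"

definition elim_rows :: "nat \<Rightarrow> nat \<Rightarrow> (nat \<Rightarrow> nat) \<Rightarrow> nat \<Rightarrow> nat \<Rightarrow> (nat \<Rightarrow> nat \<Rightarrow> 'a :: field) \<Rightarrow> nat \<Rightarrow> nat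
  \<Rightarrow> 'a" where
  "elim_rows n m rb r c B = rowop (elim_coeff rb B r c) r n (m + n) B"

text \<open>The operations run over the whole width of the array, hence also over the stored
  transformations, but only combine rows of one block row and columns of one block column. The first
  elimination leaves row \<open>r\<close> as it is, so the second still finds the original pivot
  row.\<close>

definition pivot where
  "pivot n m rb cb r c B = swap_args (elim_rows m n cb c r (swap_args (elim_rows n m rb r c B)))"

lemma equivalent_elim_rows:
  "equivalent n m rb cb A B \<Longrightarrow> r < n \<Longrightarrow> equivalent n m rb cb A (elim_rows n m rb r c B)"
  unfolding elim_rows_def
  by (rule equivalent_rowop) (auto simp: elim_coeff_def split: if_splits)

lemma equivalent_pivot:
  assumes "equivalent n m rb cb A B" "r < n" "c < m"
  shows "equivalent n m rb cb A (pivot n m rb cb r c B)"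
  unfolding pivot_def
  using equivalent_swap_args[OF equivalent_elim_rows[OF equivalent_swap_args[OF
    equivalent_elim_rows[OF assms(1,2)]] assms(3)]]
  by (simp add: swap_args_def)

lemma isolated_elim_rows:
  assumes "isolated n m rb cb B r' c'" "r < n" "r \<noteq> r'" "r' < n" "c' < m"
  shows "isolated n m rb cb (elim_rows n m rb r c B) r' c'"
  unfolding elim_rows_def
  by (rule isolated_rowop[OF assms]) (auto simp: elim_coeff_def split: if_splits)

lemma isolated_pivot_other:
  assumes "isolated n m rb cb B r' c'" "r < n" "r \<noteq> r'" "r' < n" "c < m" "c \<noteq> c'" "c' < m"
  shows "isolated n m rb cb (pivot n m rb cb r c B) r' c'"
proof -
  have "isolated m n cb rb (swap_args (elim_rows n m rb r c B)) c' r'"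
    using isolated_elim_rows assms by simp
  from isolated_elim_rows[OF this assms(5,6,7,4)] show ?thesis
    using isolated_swap_args[of m n cb rb "pivot n m rb cb r c B" c' r'] by (simp add: pivot_def)
qed

text \<open>The row elimination clears column \<open>c\<close> in the block row of \<open>r\<close>.
  As the pivot is nonzero, the vanishing minors then clear the other rows of the block completely;
  this is the use of rank at most 1. Only row \<open>r\<close> is left to the column
  elimination.\<close>

lemma isolated_pivot:
  assumes "minors n m rb cb B" "r < n" "c < m" "B r c \<noteq> 0"
  shows "isolated n m rb cb (pivot n m rb cb r c B) r c"
proof -
  let ?B = "elim_rows n m rb r c B"
  have row: "?B r y = B r y" for y by (simp add: elim_rows_def rowop_def elim_coeff_def)
  have m1: "minors n m rb cb ?B" unfolding elim_rows_def
    by (rule minors_rowop) (use assms in \<open>auto simp: elim_coeff_def split: if_splits\<close>)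
  have col: "?B x c = 0" if "x < n" "rb x = rb r" "x \<noteq> r" for x
    using that assms by (simp add: elim_rows_def rowop_def elim_coeff_def)
  have z: "?B x y = 0" if "x < n" "rb x = rb r" "x \<noteq> r" "y < m" "cb y = cb c" for x y
  proof -
    have "?B x y * ?B r c = ?B x c * ?B r y" using m1 that assms(2,3) unfolding minors_def by blast
    then show ?thesis using col[OF that(1-3)] row[of c] assms(4) by simp
  qed
  have p: "pivot n m rb cb r c B x y = (if y < m \<and> x < n + m then
      ?B x y - elim_coeff cb (swap_args ?B) c r y * ?B x c else ?B x y)" for x y
    by (simp add: pivot_def elim_rows_def[of m n] rowop_def)
  show ?thesis unfolding isolated_def
  proof (intro conjI allI impI)
    show "pivot n m rb cb r c B r c \<noteq> 0" using assms(4) by (simp add: p row elim_coeff_def)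
  next
    fix x y assume h: "x < n" "y < m" "rb x = rb r" "cb y = cb c" "pivot n m rb cb r c B x y \<noteq> 0"
    show "x = r"
    proof (rule ccontr)
      assume "x \<noteq> r"
      then show False using h z[of x y] col[of x] by (simp add: p split: if_splits)
    qed
    then show "y = c"
      using h assms by (auto simp: p row elim_coeff_def split: if_splits)
  qed
qed

text \<open>With a zero in column \<open>c\<close> the row multiplier is 0, and the column
  operations subtract multiples of that zero.\<close>

lemma pivot_row_unchanged:
  assumes "x < n" "y < m" "B x c = 0"
  shows "pivot n m rb cb r c B x y = B x y"
  using assms by (auto simp: pivot_def elim_rows_def rowop_def elim_coeff_def)

text \<open>Partners are stored shifted by 1, so that 0 marks an unmatched row or column.\<close>

definition matching :: "nat \<Rightarrow> nat \<Rightarrow> (nat \<Rightarrow> nat) \<Rightarrow> (nat \<Rightarrow> nat) \<Rightarrow> bool" where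
  "matching n m mr mc \<longleftrightarrow>
     (\<forall>r<n. mr r \<noteq> 0 \<longrightarrow> mr r \<le> m \<and> mc (mr r - 1) = Suc r) \<and>
     (\<forall>c<m. mc c \<noteq> 0 \<longrightarrow> mc c \<le> n \<and> mr (mc c - 1) = Suc c)"

definition normalized where
  "normalized n m rb cb A B mr mc \<longleftrightarrow> equivalent n m rb cb A B \<and> matching n m mr mc \<and>
     (\<forall>r<n. mr r \<noteq> 0 \<longrightarrow> isolated n m rb cb B r (mr r - 1))"

definition rematch_col :: "nat \<Rightarrow> nat \<Rightarrow> (nat \<Rightarrow> nat) \<Rightarrow> (nat \<Rightarrow> nat) \<Rightarrow> nat \<Rightarrow> nat" where
  "rematch_col r c mr mc = (if mr r = 0 then mc else mc(mr r - 1 := 0))(c := Suc r)"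

lemma matching_rematch:
  assumes "matching n m mr mc" "r < n" "c < m" "mc c = 0"
  shows "matching n m (mr(r := Suc c)) (rematch_col r c mr mc)"
proof -
  have a: "mr x \<le> m" "mc (mr x - 1) = Suc x" if "x < n" "mr x \<noteq> 0" for x
    using assms(1) that by (auto simp: matching_def)
  have b: "mc y \<le> n" "mr (mc y - 1) = Suc y" if "y < m" "mc y \<noteq> 0" for y
    using assms(1) that by (auto simp: matching_def)
  show ?thesis unfolding matching_def
  proof (intro conjI allI impI)
    fix x assume x: "x < n" "(mr(r := Suc c)) x \<noteq> 0"
    show "(mr(r := Suc c)) x \<le> m" using x a assms by auto
    show "rematch_col r c mr mc ((mr(r := Suc c)) x - 1) = Suc x"
    proof (cases "x = r")
      case False
      then have x': "mr x \<noteq> 0" using x by simp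
      have "mr x - 1 \<noteq> c" using a(2)[OF x(1) x'] assms(4) by auto
      moreover have "mr r \<noteq> 0 \<Longrightarrow> mr x - 1 \<noteq> mr r - 1"
        using a(2)[OF x(1) x'] a(2)[OF assms(2)] False by (metis nat.inject)
      ultimately show ?thesis using False a(2)[OF x(1) x'] by (auto simp: rematch_col_def)
    qed (simp add: rematch_col_def)
  next
    fix y assume y: "y < m" "rematch_col r c mr mc y \<noteq> 0"
    show "rematch_col r c mr mc y \<le> n"
      using y b[of y] assms by (auto simp: rematch_col_def split: if_splits)
    show "(mr(r := Suc c)) (rematch_col r c mr mc y - 1) = Suc y"
    proof (cases "y = c")
      case False
      then have y': "rematch_col r c mr mc y = mc y" "mc y \<noteq> 0" "mr r = 0 \<or> y \<noteq> mr r - 1"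
        using y by (auto simp: rematch_col_def split: if_splits)
      then have "mc y - 1 \<noteq> r" using b(2)[OF y(1) y'(2)] by auto
      then show ?thesis using y' b(2)[OF y(1) y'(2)] by simp
    qed (simp add: rematch_col_def)
  qed
qed

text \<open>The entry formerly matched in row \<open>r\<close> need not stay isolated; it leaves the
  matching. All other matched entries avoid row \<open>r\<close> and, \<open>c\<close> being free,
  also column \<open>c\<close>.\<close>

lemma normalized_pivot:
  assumes "normalized n m rb cb A B mr mc" "r < n" "c < m" "mc c = 0" "B r c \<noteq> 0"
  shows "normalized n m rb cb A (pivot n m rb cb r c B) (mr(r := Suc c)) (rematch_col r c mr mc)"
proof -
  have *: "isolated n m rb cb (pivot n m rb cb r c B) x ((mr(r := Suc c)) x - 1)"
    if x: "x < n" "(mr(r := Suc c)) x \<noteq> 0" for x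
  proof (cases "x = r")
    case True
    then show ?thesis using isolated_pivot assms by (auto simp: normalized_def equivalent_def)
  next
    case False
    then have x': "mr x \<noteq> 0" using x by simp
    have "mc (mr x - 1) = Suc x" "mr x - 1 < m"
      using assms(1) x(1) x' by (auto simp: normalized_def matching_def less_eq_Suc_le)
    moreover from this have "c \<noteq> mr x - 1" using assms(4) by auto
    moreover have "isolated n m rb cb B x (mr x - 1)" using assms(1) x(1) x'
      by (simp add: normalized_def)
    ultimately show ?thesis using isolated_pivot_other[of n m rb cb B x "mr x - 1" r c] assms x(1)
      False by simp
  qed
  show ?thesis using assms matching_rematch equivalent_pivot * unfolding normalized_def by blast
qed

section \<open>Alternating levels and the progress made by a pivot\<close>

definition free_rows :: "nat \<Rightarrow> (nat \<Rightarrow> nat) \<Rightarrow> nat set" where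
  "free_rows n mr = {x. x < n \<and> mr x = 0}"

text \<open>
  One step along an alternating path leads from a row \<open>z\<close> through a nonzero entry to a matched column
  and on to the partner \<open>x\<close> of that column.
\<close>

primrec level :: "nat \<Rightarrow> (nat \<Rightarrow> nat \<Rightarrow> 'a :: zero) \<Rightarrow> (nat \<Rightarrow> nat) \<Rightarrow> nat set \<Rightarrow> nat \<Rightarrow> nat set" where
  "level n B mr S 0 = S"
| "level n B mr S (Suc k) =
     level n B mr S k \<union> {x. x < n \<and> mr x \<noteq> 0 \<and> (\<exists>z \<in> level n B mr S k. B z (mr x - 1) \<noteq> 0)}"

definition exposes :: "nat \<Rightarrow> (nat \<Rightarrow> nat \<Rightarrow> 'a :: zero) \<Rightarrow> (nat \<Rightarrow> nat) \<Rightarrow> nat set \<Rightarrow> bool" where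
  "exposes m B mc S \<longleftrightarrow> (\<exists>z \<in> S. \<exists>c<m. mc c = 0 \<and> B z c \<noteq> 0)"

lemma level_subset: "S \<subseteq> {..<n} \<Longrightarrow> level n B mr S k \<subseteq> {..<n}"
  by (induction k) auto

lemma level_mono: "j \<le> k \<Longrightarrow> level n B mr S j \<subseteq> level n B mr S k"
  by (rule lift_Suc_mono_le) auto

lemma level_stable_Suc: "level n B mr S (Suc k) = level n B mr S k \<Longrightarrow> k \<le> j \<Longrightarrow> level n B mr S j =
  level n B mr S k"
  by (rotate_tac, induction j rule: dec_induct) auto

text \<open>If the first \<open>n + 1\<close> steps were all proper, level \<open>n + 1\<close>
  would have more than \<open>n\<close> elements; and once a step adds nothing, no later one
  does.\<close>

lemma level_stable:
  assumes "S \<subseteq> {..<n}"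
  shows "level n B mr S k \<subseteq> level n B mr S n"
proof -
  let ?L = "level n B mr S"
  have "\<exists>j\<le>n. ?L (Suc j) = ?L j"
  proof (rule ccontr)
    assume "\<not> ?thesis"
    then have ne: "?L (Suc j) \<noteq> ?L j" if "j \<le> n" for j using that by blast
    have "j \<le> card (?L j)" if "j \<le> Suc n" for j
      using that
    proof (induction j)
      case (Suc j)
      have "?L j \<subset> ?L (Suc j)" using ne[of j] Suc.prems by auto
      moreover have "finite (?L (Suc j))" using level_subset[OF assms] by (rule finite_subset) simp
      ultimately have "card (?L j) < card (?L (Suc j))" by (intro psubset_card_mono)
      then show ?case using Suc by simp
    qed simp
    from this[of "Suc n"] have "Suc n \<le> card (?L (Suc n))" by simp
    also have "\<dots> \<le> n" using card_mono[OF _ level_subset[OF assms, of B mr "Suc n"]] by simp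
    finally show False by simp
  qed
  then obtain j where j: "j \<le> n" "?L (Suc j) = ?L j" by blast
  show ?thesis
  proof (cases "j \<le> k")
    case True
    then have "?L k = ?L j" by (rule level_stable_Suc[OF j(2)])
    then show ?thesis using level_mono[OF j(1), of n B mr S] by auto
  next
    case False
    then show ?thesis using j(1) by (intro level_mono) simp
  qed
qed

text \<open>A lexicographic descent of the number of free rows and the least exposing level. The
  pivot may be any nonzero entry in a free column whose row lies in level \<open>d\<close>;
  \<open>min\<close> makes \<open>d\<close> the first exposing level.\<close>

lemma pivot_progress:
  fixes B :: "nat \<Rightarrow> nat \<Rightarrow> 'a :: field" and rb cb :: "nat \<Rightarrow> nat"
  assumes "matching n m mr mc" and r: "r \<in> level n B mr (free_rows n mr) d"
    and c: "c < m" "mc c = 0" "B r c \<noteq> 0"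
    and min: "\<And>j. j < d \<Longrightarrow> \<not> exposes m B mc (level n B mr (free_rows n mr) j)"
  defines "B' \<equiv> pivot n m rb cb r c B" and "mr' \<equiv> mr(r := Suc c)" and "mc' \<equiv> rematch_col r c mr mc"
  shows "card (free_rows n mr') < card (free_rows n mr) \<or>
    free_rows n mr' = free_rows n mr \<and> d > 0 \<and> exposes m B' mc' (level n B' mr' (free_rows n mr') (d
      - 1))"
proof (cases "mr r = 0")
  case True
  have "r < n" using r level_subset[of "free_rows n mr" n] by (auto simp: free_rows_def)
  then have "free_rows n mr' \<subset> free_rows n mr" using True by (auto simp: free_rows_def mr'_def)
  moreover have "finite (free_rows n mr)" by (simp add: free_rows_def)
  ultimately show ?thesis using psubset_card_mono by blast
next
  case False
  let ?F = "free_rows n mr"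
  let ?L = "level n B mr ?F"
  have F: "free_rows n mr' = ?F" using False by (auto simp: free_rows_def mr'_def)
  have z: "B x c = 0" if "x \<in> ?L j" "j < d" for x j
    using min[OF that(2)] that(1) c unfolding exposes_def by blast
  have rn: "r \<notin> ?L j" if "j < d" for j using z that c(3) by blast
  have d: "d > 0" using r False by (cases d) (auto simp: free_rows_def)
  have Ln: "?L j \<subseteq> {..<n}" for j by (rule level_subset) (auto simp: free_rows_def)
  have same: "B' x y = B x y" if "x \<in> ?L j" "j < d" "y < m" for x j y
    using pivot_row_unchanged[of x n y m B c rb cb r] z[OF that(1,2)] that Ln unfolding B'_def
      by blast
  have mle: "mr x - 1 < m" if "x < n" "mr x \<noteq> 0" for x
    using assms(1) that by (auto simp: matching_def less_eq_Suc_le)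
  \<comment> \<open>A path of fewer than \<open>d\<close> steps uses only entries in rows that the
    pivot leaves alone, and it avoids \<open>r\<close>, the only row whose partner changes.\<close>
  have sub: "?L j \<subseteq> level n B' mr' ?F j" if "j < d" for j
    using that
  proof (induction j)
    case (Suc j)
    show ?case
    proof
      fix x assume x: "x \<in> ?L (Suc j)"
      show "x \<in> level n B' mr' ?F (Suc j)"
      proof (cases "x \<in> ?L j")
        case True
        then show ?thesis using Suc by auto
      next
        case False
        then obtain w where w: "x < n" "mr x \<noteq> 0" "w \<in> ?L j" "B w (mr x - 1) \<noteq> 0" using x by auto
        have "x \<noteq> r" using rn[OF Suc.prems] x by blast
        then have "mr' x = mr x" by (simp add: mr'_def)
        moreover have "B' w (mr x - 1) = B w (mr x - 1)" using same[OF w(3)] Suc.prems mle w by simp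
        moreover have "w \<in> level n B' mr' ?F j" using Suc w by auto
        ultimately show ?thesis using w by auto
      qed
    qed
  qed simp
  \<comment> \<open>\<open>r\<close> first appears at level \<open>d\<close>, so some
    \<open>w\<close> one level lower has a nonzero entry in the old partner column of
    \<open>r\<close>. Rematching frees just that column.\<close>
  have "r \<in> ?L (Suc (d - 1))" "r \<notin> ?L (d - 1)" using r rn d by auto
  then obtain w where w: "w \<in> ?L (d - 1)" "B w (mr r - 1) \<noteq> 0" "r < n" by auto
  have l: "mr r - 1 < m" using mle w(3) False by simp
  have "mc (mr r - 1) = Suc r" using assms(1) w(3) False by (simp add: matching_def)
  then have "mc' (mr r - 1) = 0" using c False by (auto simp: mc'_def rematch_col_def)
  moreover have "B' w (mr r - 1) \<noteq> 0" using same[OF w(1) _ l] d w(2) by simp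
  moreover have "w \<in> level n B' mr' ?F (d - 1)" using sub[of "d - 1"] d w(1) by auto
  ultimately have "exposes m B' mc' (level n B' mr' ?F (d - 1))"
    unfolding exposes_def using l by blast
  then show ?thesis using F d by simp
qed

section \<open>Closed row sets and chains of them\<close>

definition unmatched :: "nat \<Rightarrow> (nat \<Rightarrow> nat) \<Rightarrow> nat set \<Rightarrow> nat set" where
  "unmatched m mc L = {c. c < m \<and> (mc c = 0 \<or> mc c - 1 \<notin> L)}"

text \<open>In the language of Koenig's theorem, the rows outside \<open>L\<close> and the columns
  matched into \<open>L\<close> cover all nonzero entries, and \<open>L\<close> with
  \<open>unmatched m mc L\<close> is the complementary independent set. Free columns count as
  unmatched, so rows of a closed set have zeros there.\<close>

definition closed_set :: "nat \<Rightarrow> nat \<Rightarrow> (nat \<Rightarrow> nat \<Rightarrow> 'a :: zero) \<Rightarrow> (nat \<Rightarrow> nat) \<Rightarrow> (nat \<Rightarrow> nat) \<Rightarrow> nat set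
  \<Rightarrow> bool" where
  "closed_set n m B mr mc L \<longleftrightarrow>
     free_rows n mr \<subseteq> L \<and> L \<subseteq> {..<n} \<and> (\<forall>r\<in>L. \<forall>c\<in>unmatched m mc L. B r c = 0)"

definition reach :: "nat \<Rightarrow> (nat \<Rightarrow> nat \<Rightarrow> 'a :: zero) \<Rightarrow> (nat \<Rightarrow> nat) \<Rightarrow> nat \<Rightarrow> nat set" where
  "reach n B mr r = level n B mr {r} n"

locale matched =
  fixes n m :: nat and B :: "nat \<Rightarrow> nat \<Rightarrow> 'a :: zero" and mr mc :: "nat \<Rightarrow> nat"
  assumes matching: "matching n m mr mc"
begin

abbreviation "rows_closed \<equiv> closed_set n m B mr mc"
abbreviation "R \<equiv> reach n B mr"

lemma partner_of_row: "r < n \<Longrightarrow> mr r \<noteq> 0 \<Longrightarrow> mr r - 1 < m \<and> mc (mr r - 1) = Suc r"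
proof -
  assume h: "r < n" "mr r \<noteq> 0"
  then have "mr r \<le> m \<and> mc (mr r - 1) = Suc r" using matching unfolding matching_def by blast
  moreover from this h(2) have "mr r - 1 < m" by linarith
  ultimately show ?thesis by blast
qed

lemma partner_of_col: "c < m \<Longrightarrow> mc c \<noteq> 0 \<Longrightarrow> mc c - 1 < n \<and> mr (mc c - 1) = Suc c"
proof -
  assume h: "c < m" "mc c \<noteq> 0"
  then have "mc c \<le> n \<and> mr (mc c - 1) = Suc c" using matching unfolding matching_def by blast
  moreover from this h(2) have "mc c - 1 < n" by linarith
  ultimately show ?thesis by blast
qed

lemma level_n_step:
  assumes "S \<subseteq> {..<n}" "z \<in> level n B mr S n" "x < n" "mr x \<noteq> 0" "B z (mr x - 1) \<noteq> 0"
  shows "x \<in> level n B mr S n"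
proof -
  have "x \<in> level n B mr S (Suc n)" using assms by auto
  then show ?thesis using level_stable[OF assms(1)] by blast
qed

text \<open>If a step left \<open>L\<close>, the partner column of the row reached would be
  unmatched and yet have a nonzero entry in a row of \<open>L\<close>.\<close>

lemma level_le_closed:
  assumes "rows_closed L" "S \<subseteq> L"
  shows "level n B mr S k \<subseteq> L"
proof (induction k)
  case (Suc k)
  have "x \<in> L" if "x < n" "mr x \<noteq> 0" "z \<in> L" "B z (mr x - 1) \<noteq> 0" for x z
  proof (rule ccontr)
    assume "x \<notin> L"
    then have "mr x - 1 \<in> unmatched m mc L" using partner_of_row[OF that(1,2)]
      by (simp add: unmatched_def)
    then show False using that(3,4) assms(1) by (simp add: closed_set_def)
  qed
  with Suc show ?case by auto
qed (use assms in simp)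

lemma self_reach: "r \<in> R r"
  using level_mono[of 0 n n B mr "{r}"] by (simp add: reach_def)

lemma reach_subset: "r < n \<Longrightarrow> R r \<subseteq> {..<n}"
  unfolding reach_def by (rule level_subset) simp

lemma reach_closed: "rows_closed L \<Longrightarrow> r \<in> L \<Longrightarrow> R r \<subseteq> L"
  unfolding reach_def by (rule level_le_closed) auto

lemma reach_trans:
  assumes "r < n" "x \<in> R r"
  shows "R x \<subseteq> R r"
proof -
  have "level n B mr {x} k \<subseteq> R r" for k
    by (induction k) (use assms level_n_step[of "{r}"] in \<open>auto simp: reach_def\<close>)
  then show ?thesis by (simp add: reach_def)
qed

text \<open>The alternative \<open>L = {}\<close> serves the initial set. A nonzero entry in a row
  of the level set leads to a matched column or into the columns matched to the set, since no free
  column is exposed; the partner of a matched one lies in the level set, which is stable under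
  further steps.\<close>

lemma closed_extend:
  assumes "L = {} \<or> rows_closed L" "S \<subseteq> {..<n}" "\<not> exposes m B mc (level n B mr S n)"
    "free_rows n mr \<subseteq> L \<union> level n B mr S n"
  shows "rows_closed (L \<union> level n B mr S n)"
  unfolding closed_set_def
proof (intro conjI ballI)
  show "L \<union> level n B mr S n \<subseteq> {..<n}"
    using assms(1) level_subset[OF assms(2)] by (auto simp: closed_set_def)
  fix r c assume r: "r \<in> L \<union> level n B mr S n" and c: "c \<in> unmatched m mc (L \<union> level n B mr S n)"
  show "B r c = 0"
  proof (cases "r \<in> L")
    case True
    then show ?thesis using assms(1) c by (auto simp: closed_set_def unmatched_def)
  next
    case False
    then have rS: "r \<in> level n B mr S n" using r by simp
    show ?thesis
    proof (rule ccontr)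
      assume nz: "B r c \<noteq> 0"
      then have mcc: "mc c \<noteq> 0" "c < m" using assms(3) rS c
        by (auto simp: exposes_def unmatched_def)
      then have "mc c - 1 \<in> level n B mr S n"
        using level_n_step[OF assms(2) rS, of "mc c - 1"] partner_of_col[of c] nz by simp
      then show False using c mcc by (auto simp: unmatched_def)
    qed
  qed
qed (rule assms(4))

text \<open>Consequently a row that reaches a free column belongs to no closed set; the chain has to
  avoid such rows.\<close>

lemma closed_not_exposes:
  assumes "rows_closed L" "S \<subseteq> L"
  shows "\<not> exposes m B mc (level n B mr S k)"
  using level_le_closed[OF assms, of k] assms(1) by (auto simp: exposes_def closed_set_def
    unmatched_def)

text \<open>The invariant of a construction from below: up to its last member the chain admits no
  refinement, so closed sets can only be added at the top.\<close>

definition saturated :: "nat set list \<Rightarrow> bool" where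
  "saturated Ls \<longleftrightarrow> Ls \<noteq> [] \<and> (\<forall>L\<in>set Ls. rows_closed L) \<and> sorted_wrt (\<subset>) Ls \<and>
     (\<forall>L. rows_closed L \<longrightarrow> (\<forall>L'\<in>set Ls. L \<subseteq> L' \<or> L' \<subseteq> L) \<longrightarrow> L \<in> set Ls \<or> last Ls \<subseteq> L)"

text \<open>Closed sets contain the free rows, hence everything reachable from them; so this is the
  least closed set.\<close>

lemma saturated_initial:
  assumes "\<not> exposes m B mc (level n B mr (free_rows n mr) n)"
  shows "saturated [level n B mr (free_rows n mr) n]"
proof -
  have "rows_closed ({} \<union> level n B mr (free_rows n mr) n)"
    using level_mono[of 0 n n B mr "free_rows n mr"]
    by (intro closed_extend assms) (auto simp: free_rows_def)
  then show ?thesis using level_le_closed by (auto simp: saturated_def closed_set_def)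
qed

lemma sorted_wrt_psubset_last: "sorted_wrt (\<subset>) Ls \<Longrightarrow> L \<in> set Ls \<Longrightarrow> L \<subseteq> last Ls"
  by (induction Ls) auto

text \<open>A closed set strictly between \<open>last Ls\<close> and the new set would contain some
  \<open>g\<close> in \<open>R x\<close> outside \<open>last Ls\<close>. By \<open>small\<close> the
  set \<open>R g\<close> is no smaller than \<open>R x\<close>; being included in it, it is equal,
  so the intermediate set already contains \<open>R x\<close>.\<close>

lemma saturated_extend:
  assumes sat: "saturated Ls" and x: "x < n" "x \<notin> last Ls" "\<not> exposes m B mc (R x)"
    and small: "\<And>z. z < n \<Longrightarrow> \<not> exposes m B mc (R z) \<Longrightarrow> card (R z) < card (R x) \<Longrightarrow> z \<in> last Ls"
  shows "saturated (Ls @ [last Ls \<union> R x])"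
proof -
  let ?M = "last Ls \<union> R x"
  have ne: "Ls \<noteq> []" and lc: "rows_closed (last Ls)" using sat by (auto simp: saturated_def)
  have Mc: "rows_closed ?M"
    using closed_extend[of "last Ls" "{x}"] lc x by (auto simp: reach_def closed_set_def)
  have lM: "last Ls \<subset> ?M" using x(2) self_reach[of x] by blast
  have sub: "L \<subseteq> last Ls" if "L \<in> set Ls" for L
    using sorted_wrt_psubset_last sat that by (auto simp: saturated_def)
  have so: "sorted_wrt (\<subset>) (Ls @ [?M])"
    using sat lM sub by (auto simp: saturated_def sorted_wrt_append)
  have max: "L \<in> set (Ls @ [?M]) \<or> ?M \<subseteq> L"
    if L: "rows_closed L" "\<forall>L'\<in>set (Ls @ [?M]). L \<subseteq> L' \<or> L' \<subseteq> L" for L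
  proof (rule ccontr)
    assume con: "\<not> ?thesis"
    then have "last Ls \<subseteq> L" "L \<subseteq> ?M" "L \<noteq> last Ls" "\<not> ?M \<subseteq> L"
      using L sat ne by (auto simp: saturated_def)
    then obtain g where g: "g \<in> L" "g \<notin> last Ls" "g \<in> R x" by blast
    have gn: "g < n" using g(3) reach_subset[OF x(1)] by auto
    have "\<not> exposes m B mc (R g)" using closed_not_exposes[OF L(1), of "{g}"] g(1)
        by (simp add: reach_def)
    then have "\<not> card (R g) < card (R x)" using small[OF gn] g(2) by blast
    moreover have "R g \<subseteq> R x" by (rule reach_trans[OF x(1) g(3)])
    moreover have "finite (R x)" using reach_subset[OF x(1)] by (rule finite_subset) simp
    ultimately have "R g = R x" by (metis card_subset_eq card_mono linorder_not_less le_antisym)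
    then have "R x \<subseteq> L" using reach_closed[OF L(1) g(1)] by simp
    then show False using \<open>last Ls \<subseteq> L\<close> \<open>\<not> ?M \<subseteq> L\<close> by blast
  qed
  show ?thesis
    unfolding saturated_def using Mc sat so max by (auto simp: saturated_def)
qed

text \<open>When \<open>last Ls\<close> holds every row that can occur in a closed set, no closed
  set can extend beyond it.\<close>

lemma saturated_final:
  assumes sat: "saturated Ls" and all: "\<And>z. z < n \<Longrightarrow> \<not> exposes m B mc (R z) \<Longrightarrow> z \<in> last Ls"
    and L: "rows_closed L" "\<And>L'. L' \<in> set Ls \<Longrightarrow> L \<subseteq> L' \<or> L' \<subseteq> L"
  shows "L \<in> set Ls"
proof -
  have "L \<subseteq> last Ls"
  proof
    fix z assume z: "z \<in> L"
    then have "z < n" using L(1) by (auto simp: closed_set_def)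
    moreover have "\<not> exposes m B mc (R z)"
      using closed_not_exposes[OF L(1), of "{z}"] z by (simp add: reach_def)
    ultimately show "z \<in> last Ls" by (rule all)
  qed
  moreover have "L \<in> set Ls \<or> last Ls \<subseteq> L" using sat L by (auto simp: saturated_def)
  moreover have "last Ls \<in> set Ls" using sat by (auto simp: saturated_def)
  ultimately show ?thesis by auto
qed

end

section \<open>Subspaces and block lattices\<close>

context vec_space
begin

lemma subspace_lin_indpt_iff:
  assumes "VectorSpace.subspace class_ring X V" "S \<subseteq> X"
  shows "LinearCombinations.module.lin_dep class_ring (vs X) S \<longleftrightarrow> lin_dep S"
    and "LinearCombinations.module.span class_ring (vs X) S = span S"
  using span_li_not_depend[OF assms(2)] assms(1) by (auto simp: VectorSpace.subspace_def)

text \<open>Independent subsets of \<open>X\<close> have at most \<open>n\<close> elements, so a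
  maximal one exists, and it spans.\<close>

lemma subspace_fin_dim:
  assumes X: "VectorSpace.subspace class_ring X V"
  shows "vectorspace.fin_dim class_ring (vs X)"
proof -
  interpret x: vectorspace class_ring "vs X" by (rule subspace_is_vs[OF X])
  have XV: "X \<subseteq> carrier V" using X by (auto simp: VectorSpace.subspace_def submodule_def)
  have "\<exists>A. finite A \<and> maximal A (\<lambda>S. S \<subseteq> carrier (vs X) \<and> x.lin_indpt S)"
  proof (rule maximal_exists[where N = n and B = "{}"])
    fix A assume A: "A \<subseteq> carrier (vs X) \<and> x.lin_indpt A"
    then have "lin_indpt A" "A \<subseteq> carrier V" using subspace_lin_indpt_iff[OF X] XV by auto
    then show "finite A \<and> card A \<le> n" using li_le_dim[OF fin_dim] dim_is_n by auto
  qed (auto simp: x.lin_dep_def)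
  then show ?thesis using x.max_li_is_gen unfolding x.fin_dim_def maximal_def by auto
qed

lemma basis_of_subspaceI:
  assumes "VectorSpace.subspace class_ring X V" "S \<subseteq> X" "lin_indpt S" "X \<subseteq> span S"
  shows "vectorspace.basis class_ring (vs X) S"
proof -
  interpret x: vectorspace class_ring "vs X" by (rule subspace_is_vs[OF assms(1)])
  have "span S \<subseteq> X" using span_is_subset[OF assms(2)] assms(1)
      by (auto simp: VectorSpace.subspace_def)
  then show ?thesis using assms subspace_lin_indpt_iff[OF assms(1,2)] unfolding x.basis_def by auto
qed

text \<open>A basis of \<open>X\<close> is independent in \<open>W\<close>; if the dimensions agree,
  it has enough elements to be a basis of \<open>W\<close>.\<close>

lemma subspace_dim_mono:
  assumes X: "VectorSpace.subspace class_ring X V" and W: "VectorSpace.subspace class_ring W V"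
    and XW: "X \<subseteq> W"
  shows "vectorspace.dim class_ring (vs X) \<le> vectorspace.dim class_ring (vs W)"
    and "vectorspace.dim class_ring (vs X) = vectorspace.dim class_ring (vs W) \<Longrightarrow> X = W"
proof -
  interpret w: vectorspace class_ring "vs W" by (rule subspace_is_vs[OF W])
  interpret x: vectorspace class_ring "vs X" by (rule subspace_is_vs[OF X])
  obtain b where b: "finite b" "x.basis b" using x.finite_basis_exists[OF subspace_fin_dim[OF X]]
    by blast
  then have bX: "b \<subseteq> X" "x.lin_indpt b" "x.span b = X" by (auto simp: x.basis_def)
  then have "lin_indpt b" "span b = X" using subspace_lin_indpt_iff[OF X] by auto
  then have li: "w.lin_indpt b" "w.span b = X" "b \<subseteq> carrier (vs W)"
    using subspace_lin_indpt_iff[OF W, of b] bX XW by auto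
  have d: "x.dim = card b" by (rule x.dim_basis[OF b])
  then show "x.dim \<le> w.dim" using w.li_le_dim[OF subspace_fin_dim[OF W] li(3,1)] by simp
  assume "x.dim = w.dim"
  then have "w.basis b" using w.dim_li_is_basis[OF subspace_fin_dim[OF W] b(1) li(3,1)] d by simp
  then show "X = W" using li(2) by (auto simp: w.basis_def)
qed

lemma mult_mat_vec_in_span:
  assumes A: "A \<in> carrier_mat n k" and d: "distinct (cols A)" and y: "y \<in> carrier_vec k"
  shows "A *\<^sub>v y \<in> span (set (cols A))"
proof -
  have "A *\<^sub>v y = lincomb (\<lambda>a. y $ find_first a (cols A)) (set (cols A))"
    using lincomb_eq_mat_mult[OF A y d] by simp
  then show ?thesis unfolding span_def by force
qed

end

text \<open>The span of the columns of \<open>P\<close> in \<open>I\<close>, where \<open>Q\<close> is the inverse of \<open>P\<close>.\<close>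

definition coord_space :: "nat \<Rightarrow> 'a :: field mat \<Rightarrow> nat set \<Rightarrow> 'a vec set" where
  "coord_space n Q I = {x \<in> carrier_vec n. \<forall>i<n. i \<notin> I \<longrightarrow> (Q *\<^sub>v x) $ i = 0}"

lemma is_subspaceI:
  assumes "X \<subseteq> carrier_vec n" "0\<^sub>v n \<in> X" "\<And>x y. x \<in> X \<Longrightarrow> y \<in> X \<Longrightarrow> x + y \<in> X"
    "\<And>c x. x \<in> X \<Longrightarrow> c \<cdot>\<^sub>v x \<in> X"
  shows "is_subspace n (X :: 'a :: field vec set)"
  unfolding is_subspace_def VectorSpace.subspace_def submodule_def
  using vec_vs[of n] vec_module[of n] assms by (auto simp: module_vec_simps)

lemma is_subspaceD:
  assumes "is_subspace n (X :: 'a :: field vec set)"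
  shows "X \<subseteq> carrier_vec n" "0\<^sub>v n \<in> X" "\<And>x y. x \<in> X \<Longrightarrow> y \<in> X \<Longrightarrow> x + y \<in> X"
    "\<And>c x. x \<in> X \<Longrightarrow> c \<cdot>\<^sub>v x \<in> X"
  using assms unfolding is_subspace_def VectorSpace.subspace_def submodule_def
    by (auto simp: module_vec_simps)

lemma is_subspace_coord_space:
  fixes Q :: "'a :: field mat"
  assumes "Q \<in> carrier_mat n n"
  shows "is_subspace n (coord_space n Q I)"
proof (rule is_subspaceI)
  fix x y :: "'a vec" and c :: 'a
  assume x: "x \<in> coord_space n Q I"
  then show "c \<cdot>\<^sub>v x \<in> coord_space n Q I"
    using assms by (auto simp: coord_space_def mult_mat_vec[of Q n n x c] simp del:
      index_mult_mat_vec)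
  assume "y \<in> coord_space n Q I"
  with x show "x + y \<in> coord_space n Q I"
    using assms by (auto simp: coord_space_def mult_add_distrib_mat_vec[of Q n n x y] simp del:
      index_mult_mat_vec)
qed (use assms in \<open>auto simp: coord_space_def\<close>)

lemma subspace_dim_mono:
  assumes "is_subspace n X" "is_subspace n W" "X \<subseteq> W"
  shows "subspace_dim n X \<le> subspace_dim n W" "subspace_dim n X = subspace_dim n W \<Longrightarrow> X = W"
  using vec_space.subspace_dim_mono[OF assms(1,2)[unfolded is_subspace_def] assms(3)]
  by (auto simp: subspace_dim_def)

lemma lin_indpt_cols:
  fixes P Q :: "'a :: field mat"
  assumes "P \<in> carrier_mat n n" "Q \<in> carrier_mat n n" "Q * P = 1\<^sub>m n"
  shows "distinct (cols P)" "LinearCombinations.module.lin_indpt class_ring (module_vec TYPE('a) n)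
    (set (cols P))"
proof -
  interpret vec_space "TYPE('a)" n .
  have "det Q * det P = 1" using det_mult[OF assms(2,1)] assms(3) by simp
  then have "det P \<noteq> 0" by auto
  then have r: "rank P = n" using det_rank_iff[OF assms(1)] by blast
  then show d: "distinct (cols P)" using non_distinct_low_rank[OF assms(1)] by auto
  show "lin_indpt (set (cols P))" using full_rank_lin_indpt[OF assms(1) r d] .
qed

text \<open>Every \<open>x\<close> is \<open>P\<close> applied to \<open>Q *\<^sub>v x\<close>,
  whose coordinates outside \<open>js\<close> vanish, so the columns in \<open>js\<close> span. A
  list is used because prefixes of an ordered basis are wanted later.\<close>

lemma is_basis_coord_space:
  fixes P Q :: "'a :: field mat"
  assumes P: "P \<in> carrier_mat n n" "Q \<in> carrier_mat n n" "Q * P = 1\<^sub>m n" "P * Q = 1\<^sub>m n"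
    and js: "distinct js" "set js \<subseteq> {..<n}"
  shows "is_basis n (coord_space n Q (set js)) (map (col P) js)"
proof -
  interpret vec_space "TYPE('a)" n .
  let ?X = "coord_space n Q (set js)"
  define R where "R = mat_of_cols n (map (col P) js)"
  have R: "R \<in> carrier_mat n (length js)"
    unfolding R_def using mat_of_cols_carrier(1)[of n "map (col P) js"] by simp
  have cR: "cols R = map (col P) js" unfolding R_def using P(1) by (intro cols_mat_of_cols) auto
  note li = lin_indpt_cols[OF P(1-3)]
  have "inj_on (col P) {..<n}"
    using li(1) P(1) by (auto simp: inj_on_def distinct_conv_nth)
  then have d: "distinct (map (col P) js)"
    using js by (simp add: distinct_map inj_on_subset)
  have sub: "set (map (col P) js) \<subseteq> set (cols P)"
    using js P(1) by (auto simp: cols_def)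
  have lis: "lin_indpt (set (map (col P) js))" using subset_li_is_li[OF li(2) sub] .
  have QP: "(Q *\<^sub>v col P j) $ i = (if i = j then 1 else 0)" if "i < n" "j < n" for i j
  proof -
    have "(Q *\<^sub>v col P j) $ i = (Q * P) $$ (i, j)" using that P(1,2) by simp
    then show ?thesis using P(3) that by simp
  qed
  have "?X \<subseteq> span (set (map (col P) js))"
  proof
    fix x assume x: "x \<in> ?X"
    let ?y = "Q *\<^sub>v x"
    let ?z = "vec (length js) (\<lambda>k. ?y $ (js ! k))"
    have xc: "x \<in> carrier_vec n" using x by (simp add: coord_space_def)
    have "x = P *\<^sub>v ?y" using assoc_mult_mat_vec[OF P(1,2) xc] P(4) xc by simp
    also have "\<dots> = R *\<^sub>v ?z"
    proof
      fix i assume i: "i < dim_vec (R *\<^sub>v ?z)"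
      then have i': "i < n" using R by simp
      have "(P *\<^sub>v ?y) $ i = (\<Sum>j<n. P $$ (i, j) * ?y $ j)"
        using i' P(1,2) by (simp add: scalar_prod_def atLeast0LessThan)
      also have "\<dots> = (\<Sum>j\<in>set js. P $$ (i, j) * ?y $ j)"
        using js x by (intro sum.mono_neutral_right) (auto simp: coord_space_def)
      also have "\<dots> = (\<Sum>k<length js. P $$ (i, js ! k) * ?y $ (js ! k))"
        by (rule sum.reindex_bij_betw[symmetric]) (rule bij_betw_nth, use js in auto)
      also have "\<dots> = (R *\<^sub>v ?z) $ i"
        using i' R js P(1) by (auto simp: scalar_prod_def atLeast0LessThan R_def mat_of_cols_index
          subset_iff intro!: sum.cong)
      finally show "(P *\<^sub>v ?y) $ i = (R *\<^sub>v ?z) $ i" .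
    qed (use P(1) R in simp)
    also have "\<dots> \<in> span (set (cols R))"
      by (rule mult_mat_vec_in_span[OF R]) (use d cR in auto)
    finally show "x \<in> span (set (map (col P) js))" unfolding cR .
  qed
  moreover have "set (map (col P) js) \<subseteq> ?X"
    using js P(1) QP by (auto simp: coord_space_def)
  moreover have "VectorSpace.subspace class_ring ?X V"
    using is_subspace_coord_space[OF P(2)] by (simp add: is_subspace_def)
  ultimately show ?thesis using basis_of_subspaceI[OF _ _ lis] d by (simp add: is_basis_def)
qed

lemma subspace_dim_basis:
  assumes "is_subspace n (X :: 'a :: field vec set)" "is_basis n X bs"
  shows "subspace_dim n X = length bs"
proof -
  interpret vec_space "TYPE('a)" n .
  interpret x: vectorspace class_ring "vs X"
    using assms(1) subspace_is_vs by (simp add: is_subspace_def)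
  show ?thesis using x.dim_basis[of "set bs"] assms(2)
    by (simp add: is_basis_def subspace_dim_def distinct_card)
qed

lemma subspace_dim_coord_space:
  assumes P: "P \<in> carrier_mat n n" "Q \<in> carrier_mat n n" "Q * P = 1\<^sub>m n" "P * Q = 1\<^sub>m n"
    and I: "I \<subseteq> {..<n}"
  shows "subspace_dim n (coord_space n Q I) = card I"
proof -
  obtain js where "set js = I" "distinct js"
    using finite_distinct_list[of I] finite_subset[OF I] by auto
  then show ?thesis
    using subspace_dim_basis[OF is_subspace_coord_space[OF P(2)] is_basis_coord_space[OF P, of js]]
      I
    by (auto simp: distinct_card)
qed

section \<open>Block projections and the block lattice\<close>

definition block_proj :: "nat list \<Rightarrow> nat \<Rightarrow> 'a :: zero vec \<Rightarrow> 'a vec" where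
  "block_proj ns \<alpha> x = vec (dim_vec x) (\<lambda>i. if offset ns \<alpha> \<le> i \<and>
    i < offset ns (Suc \<alpha>) then x $ i else 0)"

lemma offset_Suc: "\<alpha> < length ns \<Longrightarrow> offset ns (Suc \<alpha>) = offset ns \<alpha> + ns ! \<alpha>"
  by (simp add: offset_def take_Suc_conv_app_nth)

lemma offset_0 [simp]: "offset ns 0 = 0" by (simp add: offset_def)

lemma offset_length [simp]: "offset ns (length ns) = sum_list ns" by (simp add: offset_def)

lemma offset_mono: "\<alpha> \<le> \<beta> \<Longrightarrow> offset ns \<alpha> \<le> offset ns \<beta>"
proof -
  assume "\<alpha> \<le> \<beta>"
  then have "take \<beta> ns = take \<alpha> ns @ take (\<beta> - \<alpha>) (drop \<alpha> ns)"
    by (metis add_diff_inverse_nat not_less take_add)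
  then show ?thesis by (simp add: offset_def)
qed

lemma offset_le: "offset ns \<alpha> \<le> sum_list ns"
  by (metis offset_mono offset_length le_cases offset_def take_all)

text \<open>The specification of the block index arrays that the program computes. The number of an
  empty block is never a value below \<open>sum_list ns\<close>, as its interval contains no
  index.\<close>

definition is_block_fun :: "nat list \<Rightarrow> (nat \<Rightarrow> nat) \<Rightarrow> bool" where
  "is_block_fun ns rb \<longleftrightarrow>
     (\<forall>i<sum_list ns. rb i < length ns \<and> offset ns (rb i) \<le> i \<and> i < offset ns (Suc (rb i)))"

lemma block_fun_unique:
  assumes "is_block_fun ns rb" "i < sum_list ns" "offset ns \<alpha> \<le> i" "i < offset ns (Suc \<alpha>)"
  shows "rb i = \<alpha>"
proof (rule ccontr)
  assume "rb i \<noteq> \<alpha>"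
  then consider "Suc (rb i) \<le> \<alpha>" | "Suc \<alpha> \<le> rb i" by linarith
  then show False
    using assms offset_mono[of "Suc (rb i)" \<alpha> ns] offset_mono[of "Suc \<alpha>" "rb i" ns]
    by cases (auto simp: is_block_fun_def dest: spec[of _ i])
qed

lemma block_fun_iff:
  assumes "is_block_fun ns rb" "i < sum_list ns"
  shows "offset ns \<alpha> \<le> i \<and> i < offset ns (Suc \<alpha>) \<longleftrightarrow> rb i = \<alpha>"
  using block_fun_unique[OF assms] assms by (auto simp: is_block_fun_def)

lemma finsum_block_proj:
  assumes rb: "is_block_fun ns rb" and v: "v \<in> carrier_vec (sum_list ns)"
  shows "finsum_vec TYPE('a :: field) (sum_list ns) (\<lambda>\<alpha>. block_proj ns \<alpha> v) {..<length ns} = v"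
proof -
  let ?n = "sum_list ns" and ?k = "length ns"
  interpret vec_space "TYPE('a)" ?n .
  let ?f = "finsum V (\<lambda>\<alpha>. block_proj ns \<alpha> v) {..<?k}"
  have pc: "(\<lambda>\<alpha>. block_proj ns \<alpha> v) \<in> {..<?k} \<rightarrow> carrier_vec ?n"
    using v by (auto simp: block_proj_def)
  have "?f \<in> carrier V" using finsum_closed[of "\<lambda>\<alpha>. block_proj ns \<alpha> v" "{..<?k}"] pc by simp
  then have fc: "?f \<in> carrier_vec ?n" by simp
  have "?f = v"
  proof
    show "dim_vec ?f = dim_vec v" using fc v by simp
    fix i assume "i < dim_vec v"
    then have i: "i < ?n" using v by simp
    have "rb i < ?k" using rb i by (auto simp: is_block_fun_def)
    have "?f $ i = (\<Sum>\<alpha><?k. block_proj ns \<alpha> v $ i)"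
      using index_finsum_vec[of "{..<?k}" i ?n "\<lambda>\<alpha>. block_proj ns \<alpha> v"] i pc by simp
    also have "\<dots> = (\<Sum>\<alpha><?k. if \<alpha> = rb i then v $ i else 0)"
      using v i block_fun_iff[OF rb i] by (intro sum.cong) (auto simp: block_proj_def)
    also have "\<dots> = v $ i" using \<open>rb i < ?k\<close> by simp
    finally show "?f $ i = v $ i" .
  qed
  then show ?thesis by simp
qed

text \<open>Together with \<open>block_latticeI\<close> this replaces direct sums by a handier
  criterion: the lattice consists of the subspaces closed under all block projections.\<close>

lemma block_latticeD:
  assumes rb: "is_block_fun ns rb" and X: "X \<in> block_lattice ns"
  shows "is_subspace (sum_list ns) (X :: 'a :: field vec set)"
    and "\<And>x \<alpha>. x \<in> X \<Longrightarrow> \<alpha> < length ns \<Longrightarrow> block_proj ns \<alpha> x \<in> X"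
proof -
  let ?n = "sum_list ns" and ?k = "length ns"
  interpret vec_space "TYPE('a)" ?n .
  obtain Xs where Xs: "\<And>\<alpha>. \<alpha> < ?k \<Longrightarrow> is_subspace ?n (Xs \<alpha>)" "\<And>\<alpha>. \<alpha> < ?k \<Longrightarrow> Xs \<alpha> \<subseteq> block_space ns \<alpha>"
    and XX: "X = {finsum_vec TYPE('a) ?n x {..<?k} | x. \<forall>\<alpha><?k. x \<alpha> \<in> Xs \<alpha>}"
    using X unfolding block_lattice_def by blast
  note sD = is_subspaceD[OF Xs(1)]
  \<comment> \<open>The block projections of a sum of block vectors give back the summands, so
    membership can be tested block by block.\<close>
  have X_iff: "v \<in> X \<longleftrightarrow> v \<in> carrier_vec ?n \<and> (\<forall>\<alpha><?k. block_proj ns \<alpha> v \<in> Xs \<alpha>)" for v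
  proof
    assume "v \<in> X"
    then obtain x where x: "v = finsum V x {..<?k}" "\<And>\<alpha>. \<alpha> < ?k \<Longrightarrow> x \<alpha> \<in> Xs \<alpha>"
      by (auto simp: XX)
    have xc: "x \<in> {..<?k} \<rightarrow> carrier_vec ?n" using x(2) sD(1) by auto
    have vc: "v \<in> carrier_vec ?n" unfolding x(1) using finsum_closed[of x "{..<?k}"] xc by simp
    have vi: "v $ i = (\<Sum>\<alpha><?k. x \<alpha> $ i)" if "i < ?n" for i
      unfolding x(1) using index_finsum_vec[of "{..<?k}" i ?n x] that xc by simp
    have xz: "x \<alpha> $ i = 0" if "\<alpha> < ?k" "i < ?n" "rb i \<noteq> \<alpha>" for \<alpha> i
      using Xs(2)[OF that(1)] x(2)[OF that(1)] that block_fun_iff[OF rb that(2), of \<alpha>]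
      unfolding block_space_def by blast
    have "block_proj ns \<alpha> v = x \<alpha>" if a: "\<alpha> < ?k" for \<alpha>
    proof
      show "dim_vec (block_proj ns \<alpha> v) = dim_vec (x \<alpha>)"
        using vc funcset_mem[OF xc, of \<alpha>] a by (simp add: block_proj_def)
      fix i assume "i < dim_vec (x \<alpha>)"
      then have i: "i < ?n" using funcset_mem[OF xc, of \<alpha>] a by simp
      have "rb i < ?k" using rb i by (auto simp: is_block_fun_def)
      then have "v $ i = x (rb i) $ i"
        unfolding vi[OF i] using xz i by (subst sum.remove[of _ "rb i"]) (auto intro!: sum.neutral)
      then show "block_proj ns \<alpha> v $ i = x \<alpha> $ i"
        using vc i a xz[OF a i] block_fun_iff[OF rb i, of \<alpha>] by (auto simp: block_proj_def)
    qed
    with x(2) vc show "v \<in> carrier_vec ?n \<and> (\<forall>\<alpha><?k. block_proj ns \<alpha> v \<in> Xs \<alpha>)" by auto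
  next
    assume v: "v \<in> carrier_vec ?n \<and> (\<forall>\<alpha><?k. block_proj ns \<alpha> v \<in> Xs \<alpha>)"
    then have "v = finsum V (\<lambda>\<alpha>. block_proj ns \<alpha> v) {..<?k}"
      using finsum_block_proj[OF rb, of v] v by simp
    then show "v \<in> X" using v by (auto simp: XX)
  qed
  have p0: "block_proj ns \<alpha> (0\<^sub>v ?n) = 0\<^sub>v ?n" for \<alpha> by (auto simp: block_proj_def)
  have pa: "block_proj ns \<alpha> (x + y) = block_proj ns \<alpha> x + block_proj ns \<alpha> y"
    if "x \<in> carrier_vec ?n" "y \<in> carrier_vec ?n" for \<alpha> and x y :: "'a vec"
    using that by (auto simp: block_proj_def)
  have ps: "block_proj ns \<alpha> (c \<cdot>\<^sub>v x) = c \<cdot>\<^sub>v block_proj ns \<alpha> x" for \<alpha> c and x :: "'a vec"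
    by (auto simp: block_proj_def)
  show "is_subspace ?n X"
    by (rule is_subspaceI) (auto simp: X_iff p0 pa ps sD(2-4))
  fix x \<alpha> assume x: "x \<in> X" "\<alpha> < ?k"
  have "block_proj ns \<beta> (block_proj ns \<alpha> x) = (if \<beta> = \<alpha> then block_proj ns \<alpha> x else 0\<^sub>v ?n)" for \<beta>
    using x(1)[unfolded X_iff] block_fun_iff[OF rb] by (auto simp: block_proj_def)
  with x show "block_proj ns \<alpha> x \<in> X" by (auto simp: X_iff sD(2)) (auto simp: block_proj_def)
qed

text \<open>The components are the intersections with the block spaces. Projections decompose a
  vector of \<open>X\<close>, and closure under finite sums gives the converse.\<close>

lemma block_latticeI:
  assumes rb: "is_block_fun ns rb" and X: "is_subspace (sum_list ns) (X :: 'a :: field vec set)"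
    and p: "\<And>x \<alpha>. x \<in> X \<Longrightarrow> \<alpha> < length ns \<Longrightarrow> block_proj ns \<alpha> x \<in> X"
  shows "X \<in> block_lattice ns"
proof -
  let ?n = "sum_list ns" and ?k = "length ns"
  interpret vec_space "TYPE('a)" ?n .
  note XD = is_subspaceD[OF X]
  define Xs where "Xs \<alpha> = X \<inter> block_space ns \<alpha>" for \<alpha>
  have pb: "block_proj ns \<alpha> v \<in> block_space ns \<alpha>" if "v \<in> carrier_vec ?n" for \<alpha> and v :: "'a vec"
    using that by (auto simp: block_proj_def block_space_def)
  have s: "is_subspace ?n (Xs \<alpha>)" for \<alpha>
    by (rule is_subspaceI) (use XD in \<open>auto simp: Xs_def block_space_def\<close>)
  have fs: "finsum V x S \<in> X" if "finite S" "\<forall>\<alpha>\<in>S. x \<alpha> \<in> X" for x and S :: "nat set"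
    using that
  proof (induction S)
    case empty
    then show ?case using XD(2) by simp
  next
    case (insert a S)
    then have "finsum V x (insert a S) = x a + finsum V x S"
      using XD(1) by (subst finsum_insert) (auto simp: module_vec_simps)
    then show ?case using insert XD(3) by auto
  qed
  have "X = {finsum_vec TYPE('a) ?n x {..<?k} | x. \<forall>\<alpha><?k. x \<alpha> \<in> Xs \<alpha>}"
  proof (intro equalityI subsetI)
    fix v assume v: "v \<in> X"
    then have vc: "v \<in> carrier_vec ?n" using XD(1) by auto
    have "v = finsum V (\<lambda>\<alpha>. block_proj ns \<alpha> v) {..<?k}"
      using finsum_block_proj[OF rb vc] by simp
    then show "v \<in> {finsum_vec TYPE('a) ?n x {..<?k} | x. \<forall>\<alpha><?k. x \<alpha> \<in> Xs \<alpha>}"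
      using p[OF v] pb[OF vc] by (auto simp: Xs_def)
  qed (auto simp: Xs_def fs)
  moreover have "\<forall>\<alpha><?k. is_subspace ?n (Xs \<alpha>) \<and> Xs \<alpha> \<subseteq> block_space ns \<alpha>"
    using s by (auto simp: Xs_def)
  ultimately show ?thesis unfolding block_lattice_def by blast
qed

section \<open>The lattice of maximum stable pairs\<close>

text \<open>Two distinct columns are dependent. A nontrivial relation \<open>v\<close> holds in both
  rows of the minor \<open>?D\<close>, and elimination as in Cramer's rule yields
  \<open>?D * v $ 0 = 0\<close> and \<open>?D * v $ 1 = 0\<close>. Equal columns are treated apart,
  since a set of columns does not see repetitions.\<close>

lemma rank_le_1_minor:
  fixes A :: "'a :: field mat"
  assumes A: "A \<in> carrier_mat n m" and r: "vec_space.rank n A \<le> 1"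
    and h: "i < n" "i' < n" "j < m" "j' < m"
  shows "A $$ (i, j) * A $$ (i', j') = A $$ (i, j') * A $$ (i', j)"
proof (cases "col A j = col A j'")
  case True
  then have "A $$ (k, j) = A $$ (k, j')" if "k < n" for k
    using that A h by (metis carrier_matD index_col)
  then show ?thesis using h by (simp add: mult.commute)
next
  case False
  interpret vec_space "TYPE('a)" n .
  let ?R = "mat_of_cols n [col A j, col A j']"
  have R: "?R \<in> carrier_mat n 2" by (simp add: carrier_matI)
  have cR: "cols ?R = [col A j, col A j']" using A by (intro cols_mat_of_cols) auto
  have "lin_dep {col A j, col A j'}"
  proof (rule ccontr)
    assume "lin_indpt {col A j, col A j'}"
    moreover have "{col A j, col A j'} \<subseteq> set (cols A)" using A h by (auto simp: cols_def)
    ultimately have "card {col A j, col A j'} \<le> rank A" using rank_ge_card_indpt[OF A] by blast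
    then show False using False r by simp
  qed
  then obtain v where v: "v \<in> carrier_vec 2" "v \<noteq> 0\<^sub>v 2" "?R *\<^sub>v v = 0\<^sub>v n"
    using lin_depE[OF R] cR False by auto
  have e: "A $$ (k, j) * v $ 0 + A $$ (k, j') * v $ 1 = 0" if "k < n" for k
  proof -
    have "(?R *\<^sub>v v) $ k = 0" using v(3) that by simp
    then show ?thesis using that v(1) A h
      by (simp add: scalar_prod_def mat_of_cols_index numeral_2_eq_2)
  qed
  have v01: "v $ 0 \<noteq> 0 \<or> v $ 1 \<noteq> 0"
  proof (rule ccontr)
    assume "\<not> ?thesis"
    then have "v = 0\<^sub>v 2" using v(1) by (intro eq_vecI) (auto simp: less_2_cases_iff)
    then show False using v(2) by simp
  qed
  let ?D = "A $$ (i, j) * A $$ (i', j') - A $$ (i, j') * A $$ (i', j)"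
  have "?D * v $ 0 = (A $$ (i, j) * v $ 0 + A $$ (i, j') * v $ 1) * A $$ (i', j') -
      (A $$ (i', j) * v $ 0 + A $$ (i', j') * v $ 1) * A $$ (i, j')" by (simp add: algebra_simps)
  moreover have "?D * v $ 1 = (A $$ (i', j) * v $ 0 + A $$ (i', j') * v $ 1) * A $$ (i, j) -
      (A $$ (i, j) * v $ 0 + A $$ (i, j') * v $ 1) * A $$ (i', j)" by (simp add: algebra_simps)
  ultimately have "?D * v $ 0 = 0" "?D * v $ 1 = 0" using e h by simp_all
  then have "?D = 0" using v01 by auto
  then show ?thesis by simp
qed

section \<open>Block-diagonal changes of basis\<close>

definition tmat :: "nat \<Rightarrow> nat \<Rightarrow> (nat \<Rightarrow> nat \<Rightarrow> 'a) \<Rightarrow> 'a mat" where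
  "tmat n m B = mat n n (\<lambda>(i, r). B r (m + i))"

lemma tmat_carrier [simp]: "tmat n m B \<in> carrier_mat n n" by (simp add: tmat_def)

text \<open>\<open>tmat\<close> undoes the transposition in which \<open>B\<close> stores the row
  transformation; with \<open>swap_args B\<close> and exchanged dimensions it gives the column
  transformation. The trivial kernel in \<open>rows_ok\<close> makes its determinant
  nonzero.\<close>

lemma tmat_inverse:
  fixes B :: "nat \<Rightarrow> nat \<Rightarrow> 'a :: field"
  assumes "rows_ok n m rb B"
  obtains P' where "P' \<in> carrier_mat n n" "P' * tmat n m B = 1\<^sub>m n" "tmat n m B * P' = 1\<^sub>m n"
proof -
  let ?P = "tmat n m B"
  have "det (transpose_mat ?P) \<noteq> 0"
  proof
    assume "det (transpose_mat ?P) = 0"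
    then obtain v where v: "v \<in> carrier_vec n" "v \<noteq> 0\<^sub>v n" "transpose_mat ?P *\<^sub>v v = 0\<^sub>v n"
      using det_0_iff_vec_prod_zero_field[of "transpose_mat ?P" n] by auto
    have "(\<Sum>i<n. B x (m + i) * v $ i) = 0" if "x < n" for x
    proof -
      have "(transpose_mat ?P *\<^sub>v v) $ x = 0" using v(3) that by simp
      then show ?thesis using that v(1) by (simp add: scalar_prod_def tmat_def atLeast0LessThan)
    qed
    then have "v $ i = 0" if "i < n" for i using assms that unfolding rows_ok_def by blast
    then have "v = 0\<^sub>v n" using v(1) by (intro eq_vecI) auto
    then show False using v(2) by simp
  qed
  then have "det ?P \<noteq> 0" using det_transpose[of ?P n] by simp
  from det_non_zero_imp_unit[OF tmat_carrier this, of "()"] that show thesis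
    by (auto simp: Units_def ring_mat_def)
qed

lemma block_proj_carrier [simp]: "x \<in> carrier_vec n \<Longrightarrow> block_proj ns \<alpha> x \<in> carrier_vec n"
  by (simp add: block_proj_def)

lemma index_block_proj:
  assumes "is_block_fun ns rb" "x \<in> carrier_vec (sum_list ns)" "i < sum_list ns"
  shows "block_proj ns \<alpha> x $ i = (if rb i = \<alpha> then x $ i else 0)"
  using block_fun_iff[OF assms(1,3), of \<alpha>] assms by (simp add: block_proj_def)

text \<open>Interpreted twice, for rows with \<open>B\<close> and for columns with
  \<open>swap_args B\<close>. The inverse \<open>Pi\<close> belongs to the reasoning only; the
  program never forms it.\<close>

locale block_transform =
  fixes ns :: "nat list" and m :: nat and rb :: "nat \<Rightarrow> nat" and B :: "nat \<Rightarrow> nat \<Rightarrow> 'a :: field"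
    and Pi :: "'a mat"
  assumes rb: "is_block_fun ns rb" and ok: "rows_ok (sum_list ns) m rb B"
    and Pi: "Pi \<in> carrier_mat (sum_list ns) (sum_list ns)"
      "Pi * tmat (sum_list ns) m B = 1\<^sub>m (sum_list ns)" "tmat (sum_list ns) m B * Pi =
        1\<^sub>m (sum_list ns)"
begin

abbreviation "n \<equiv> sum_list ns"
abbreviation "P \<equiv> tmat n m B"

lemma block_zero: "i < n \<Longrightarrow> r < n \<Longrightarrow> rb i \<noteq> rb r \<Longrightarrow> P $$ (i, r) = 0"
proof -
  assume h: "i < n" "r < n" "rb i \<noteq> rb r"
  then have "B r (m + i) = 0" using ok unfolding rows_ok_def by metis
  then show ?thesis using h by (simp add: tmat_def)
qed

lemma Pi_P [simp]: "x \<in> carrier_vec n \<Longrightarrow> Pi *\<^sub>v (P *\<^sub>v x) = x"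
  using assoc_mult_mat_vec[OF Pi(1) tmat_carrier[of n m B], of x] Pi by simp

lemma P_Pi [simp]: "x \<in> carrier_vec n \<Longrightarrow> P *\<^sub>v (Pi *\<^sub>v x) = x"
  using assoc_mult_mat_vec[OF tmat_carrier[of n m B] Pi(1), of x] Pi by simp

lemma Pi_carrier [simp]: "Pi *\<^sub>v x \<in> carrier_vec n" using Pi(1) by (intro carrier_vecI) simp

lemma P_carrier [simp]: "P *\<^sub>v x \<in> carrier_vec n" by (intro carrier_vecI) (simp add: tmat_def)

lemma P_block_proj:
  assumes x: "x \<in> carrier_vec n"
  shows "P *\<^sub>v block_proj ns \<alpha> x = block_proj ns \<alpha> (P *\<^sub>v x)"
proof
  fix i assume "i < dim_vec (block_proj ns \<alpha> (P *\<^sub>v x))"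
  then have i: "i < n" by (simp add: block_proj_def tmat_def)
  have Px: "P *\<^sub>v x \<in> carrier_vec n" by simp
  have "(P *\<^sub>v block_proj ns \<alpha> x) $ i = (\<Sum>r<n. P $$ (i, r) * (if rb r = \<alpha> then x $ r else 0))"
  proof -
    have "(P *\<^sub>v block_proj ns \<alpha> x) $ i = (\<Sum>r<n. P $$ (i, r) * block_proj ns \<alpha> x $ r)"
      using i x by (simp add: scalar_prod_def atLeast0LessThan tmat_def block_proj_def)
    then show ?thesis by (simp add: index_block_proj[OF rb x])
  qed
  also have "\<dots> = (if rb i = \<alpha> then \<Sum>r<n. P $$ (i, r) * x $ r else 0)"
    using block_zero[OF i] by (auto intro!: sum.cong sum.neutral)
  also have "\<dots> = block_proj ns \<alpha> (P *\<^sub>v x) $ i"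
    using i x by (simp add: index_block_proj[OF rb Px]) (simp add: scalar_prod_def atLeast0LessThan
      tmat_def)
  finally show "(P *\<^sub>v block_proj ns \<alpha> x) $ i = block_proj ns \<alpha> (P *\<^sub>v x) $ i" .
qed (simp add: block_proj_def)

text \<open>Block-diagonality of \<open>Pi\<close> is inherited from \<open>P\<close> by
  cancelling.\<close>

lemma Pi_block_proj:
  assumes "x \<in> carrier_vec n"
  shows "Pi *\<^sub>v block_proj ns \<alpha> x = block_proj ns \<alpha> (Pi *\<^sub>v x)"
  using P_block_proj[of "Pi *\<^sub>v x" \<alpha>] Pi_P[of "block_proj ns \<alpha> (Pi *\<^sub>v x)"] assms by simp

lemma coord_space_in_lattice: "coord_space n Pi I \<in> block_lattice ns"
proof (rule block_latticeI[OF rb is_subspace_coord_space[OF Pi(1)]])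
  fix x \<alpha> assume x: "x \<in> coord_space n Pi I"
  then have "x \<in> carrier_vec n" by (simp add: coord_space_def)
  then show "block_proj ns \<alpha> x \<in> coord_space n Pi I"
    using x by (auto simp: coord_space_def Pi_block_proj index_block_proj[OF rb] simp del:
      index_mult_mat_vec)
qed

lemma Pi_col: "r < n \<Longrightarrow> Pi *\<^sub>v col P r = unit_vec n r"
  using Pi(2) col_mult2[OF Pi(1) tmat_carrier, of r m B] by simp

lemma col_in_coord_space: "r < n \<Longrightarrow> col P r \<in> coord_space n Pi I \<longleftrightarrow> r \<in> I"
  by (auto simp: coord_space_def Pi_col col_carrier_vec[OF _ tmat_carrier] simp del:
    index_mult_mat_vec)

lemma coord_space_subset_iff: "I \<subseteq> {..<n} \<Longrightarrow> coord_space n Pi I \<subseteq> coord_space n Pi J \<longleftrightarrow> I \<subseteq> J"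
proof
  assume "I \<subseteq> {..<n}" "coord_space n Pi I \<subseteq> coord_space n Pi J"
  then show "I \<subseteq> J" using col_in_coord_space by blast
qed (auto simp: coord_space_def)

lemma dim_coord_space: "I \<subseteq> {..<n} \<Longrightarrow> subspace_dim n (coord_space n Pi I) = card I"
  by (rule subspace_dim_coord_space[OF tmat_carrier Pi])

lemma col_in_block_space: "r < n \<Longrightarrow> col P r \<in> block_space ns (rb r)"
  using block_zero block_fun_iff[OF rb] by (auto simp: block_space_def tmat_def)

text \<open>Each index set is a prefix of \<open>ks\<close> whose length is the dimension of its
  space, so one list of columns serves all members of a chain.\<close>

lemma adapted_basis_cols:
  assumes ks: "distinct ks" "set ks = {..<n}"
    and Is: "\<And>I. I \<in> set Is \<Longrightarrow> I = set (take (card I) ks)"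
  shows "adapted_basis ns (map (coord_space n Pi) Is) (map (col P) ks)"
  unfolding adapted_basis_def
proof (intro conjI ballI)
  have "coord_space n Pi {..<n} = carrier_vec n" by (auto simp: coord_space_def)
  then show "is_basis n (carrier_vec n) (map (col P) ks)"
    using is_basis_coord_space[OF tmat_carrier Pi ks(1)] ks(2) by simp
next
  fix e assume "e \<in> set (map (col P) ks)"
  then obtain r where "r < n" "e = col P r" using ks(2) by auto
  then show "\<exists>\<alpha><length ns. e \<in> block_space ns \<alpha>"
    using col_in_block_space rb unfolding is_block_fun_def by blast
next
  fix X assume "X \<in> set (map (coord_space n Pi) Is)"
  then obtain I where I: "I = set (take (card I) ks)" "X = coord_space n Pi I" using Is by auto
  then have sub: "I \<subseteq> {..<n}" using ks(2) by (metis set_take_subset)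
  show "is_basis n X (take (subspace_dim n X) (map (col P) ks))"
    unfolding I(2) dim_coord_space[OF sub] take_map
    using is_basis_coord_space[OF tmat_carrier Pi, of "take (card I) ks"] ks I(1) sub
    by (simp add: distinct_take)
qed

lemma block_diag_times_perm_cols:
  assumes ks: "distinct ks" "set ks = {..<n}"
  shows "block_diag_times_perm ns (mat_of_cols n (map (col P) ks))"
    and "invertible_mat (mat_of_cols n (map (col P) ks))"
proof -
  have len: "length ks = n" using ks by (metis card_lessThan distinct_card)
  have ksn: "ks ! j < n" if "j < n" for j using ks len that by (metis lessThan_iff nth_mem)
  define Bs where "Bs = map (\<lambda>\<alpha>. block ns ns P \<alpha> \<alpha>) [0..<length ns]"
  define \<pi> where "\<pi> j = (if j < n then ks ! j else j)" for j
  define R :: "'a mat" where "R = mat n n (\<lambda>(i, j). if i = \<pi> j then 1 else 0)"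
  have bl: "offset ns \<alpha> + i < n" "rb (offset ns \<alpha> + i) = \<alpha>" if "\<alpha> < length ns" "i < ns ! \<alpha>" for \<alpha> i
  proof -
    have "offset ns \<alpha> + i < offset ns (Suc \<alpha>)" using that by (simp add: offset_Suc)
    then show "offset ns \<alpha> + i < n" using offset_le[of ns "Suc \<alpha>"] by simp
    then show "rb (offset ns \<alpha> + i) = \<alpha>"
      using block_fun_unique[OF rb, of "offset ns \<alpha> + i" \<alpha>] \<open>_ < offset ns (Suc \<alpha>)\<close> by simp
  qed
  have perm: "\<pi> permutes {..<n}"
  proof (rule bij_imp_permutes)
    have "bij_betw ((!) ks) {..<n} {..<n}"
      by (rule bij_betw_nth[OF ks(1)]) (simp_all only: len ks(2))
    moreover have "bij_betw \<pi> {..<n} {..<n} \<longleftrightarrow> bij_betw ((!) ks) {..<n} {..<n}"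
      by (rule bij_betw_cong) (simp add: \<pi>_def)
    ultimately show "bij_betw \<pi> {..<n} {..<n}" by blast
  qed (simp add: \<pi>_def)
  \<comment> \<open>Each step of the induction adds one diagonal block to the leading square of
    \<open>P\<close>; outside the diagonal blocks \<open>P\<close> vanishes.\<close>
  have diag: "diag_block_mat (map (\<lambda>\<alpha>. block ns ns P \<alpha> \<alpha>) [0..<k]) =
      mat (offset ns k) (offset ns k) (\<lambda>(i, j). P $$ (i, j))" if "k \<le> length ns" for k
    using that
  proof (induction k)
    case (Suc k)
    let ?o = "offset ns k"
    have o: "offset ns (Suc k) = ?o + ns ! k" using Suc by (simp add: offset_Suc)
    have z: "P $$ (i, ?o + j) = 0" "P $$ (?o + j, i) = 0" if "i < ?o" "j < ns ! k" for i j
    proof -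
      have "i < n" using that(1) offset_le[of ns k] by simp
      moreover have "rb i \<noteq> k" using block_fun_iff[OF rb \<open>i < n\<close>, of k] that(1) by auto
      ultimately show "P $$ (i, ?o + j) = 0" "P $$ (?o + j, i) = 0"
        using block_zero bl[of k j] Suc.prems that(2) by auto
    qed
    have "diag_block_mat (map (\<lambda>\<alpha>. block ns ns P \<alpha> \<alpha>) [0..<Suc k]) =
        four_block_mat (mat ?o ?o (\<lambda>(i, j). P $$ (i, j))) (0\<^sub>m ?o (ns ! k)) (0\<^sub>m (ns ! k) ?o) (block
          ns ns P k k)"
      using Suc by (simp add: diag_block_mat_last block_def)
    also have "\<dots> = mat (offset ns (Suc k)) (offset ns (Suc k)) (\<lambda>(i, j). P $$ (i, j))"
    proof (rule eq_matI)
      fix i j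
      assume "i < dim_row (mat (offset ns (Suc k)) (offset ns (Suc k)) (\<lambda>(i, j). P $$ (i, j)))"
        "j < dim_col (mat (offset ns (Suc k)) (offset ns (Suc k)) (\<lambda>(i, j). P $$ (i, j)))"
      then have ij: "i < ?o + ns ! k" "j < ?o + ns ! k" by (simp_all add: o)
      then show "four_block_mat (mat ?o ?o (\<lambda>(i, j). P $$ (i, j))) (0\<^sub>m ?o (ns ! k)) (0\<^sub>m (ns ! k)
        ?o)
          (block ns ns P k k) $$ (i, j) =
        mat (offset ns (Suc k)) (offset ns (Suc k)) (\<lambda>(i, j). P $$ (i, j)) $$ (i, j)"
        using z(1)[of i "j - ?o"] z(2)[of j "i - ?o"] by (auto simp: block_def o)
    qed (simp_all add: o block_def)
    finally show ?case .
  qed auto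
  have dP: "diag_block_mat Bs = P" using diag[of "length ns"] by (auto simp: Bs_def tmat_def)
  have E: "mat_of_cols n (map (col P) ks) = P * R"
  proof (rule eq_matI)
    fix i j assume "i < dim_row (P * R)" "j < dim_col (P * R)"
    then have ij: "i < n" "j < n" by (simp_all add: R_def tmat_def)
    have "(P * R) $$ (i, j) = (\<Sum>k<n. P $$ (i, k) * (if k = ks ! j then 1 else 0))"
      using ij by (simp add: scalar_prod_def atLeast0LessThan R_def tmat_def \<pi>_def)
    also have "\<dots> = (\<Sum>k<n. if k = ks ! j then P $$ (i, k) else 0)" by (intro sum.cong) auto
    also have "\<dots> = P $$ (i, ks ! j)" using ksn[OF ij(2)] by simp
    finally show "mat_of_cols n (map (col P) ks) $$ (i, j) = (P * R) $$ (i, j)"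
      using ij len ksn[OF ij(2)] by (simp add: mat_of_cols_index tmat_def)
  qed (simp_all add: R_def tmat_def len)
  have Bsi: "Bs ! \<alpha> \<in> carrier_mat (ns ! \<alpha>) (ns ! \<alpha>)" "invertible_mat (Bs ! \<alpha>)" if a: "\<alpha> < length ns"
      for \<alpha>
  proof -
    have Ba: "Bs ! \<alpha> = block ns ns P \<alpha> \<alpha>" using a by (simp add: Bs_def)
    show c: "Bs ! \<alpha> \<in> carrier_mat (ns ! \<alpha>) (ns ! \<alpha>)" by (simp add: Ba block_def)
    let ?C = "block ns ns Pi \<alpha> \<alpha>"
    have cC: "?C \<in> carrier_mat (ns ! \<alpha>) (ns ! \<alpha>)" by (simp add: block_def)
    \<comment> \<open>In \<open>P * Pi\<close> the sum over all indices reduces to one block,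
      because row \<open>?o + i\<close> of \<open>P\<close> is zero elsewhere. So the diagonal
      blocks of \<open>Pi\<close> invert those of \<open>P\<close>.\<close>
    have "Bs ! \<alpha> * ?C = 1\<^sub>m (ns ! \<alpha>)"
    proof (rule eq_matI)
      fix i j assume "i < dim_row (1\<^sub>m (ns ! \<alpha>) :: 'a mat)" "j < dim_col (1\<^sub>m (ns ! \<alpha>) :: 'a mat)"
      then have ij: "i < ns ! \<alpha>" "j < ns ! \<alpha>" by simp_all
      let ?o = "offset ns \<alpha>"
      have "(Bs ! \<alpha> * ?C) $$ (i, j) = (\<Sum>k<ns ! \<alpha>. P $$ (?o + i, ?o + k) * Pi $$ (?o + k, ?o + j))"
        using ij by (simp add: Ba block_def scalar_prod_def atLeast0LessThan)
      also have "\<dots> = (\<Sum>k\<in>(+) ?o ` {..<ns ! \<alpha>}. P $$ (?o + i, k) * Pi $$ (k, ?o + j))"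
        by (subst sum.reindex) (auto simp: inj_on_def)
      also have "\<dots> = (\<Sum>k<n. P $$ (?o + i, k) * Pi $$ (k, ?o + j))"
      proof (rule sum.mono_neutral_left)
        show "\<forall>k\<in>{..<n} - (+) ?o ` {..<ns ! \<alpha>}. P $$ (?o + i, k) * Pi $$ (k, ?o + j) = 0"
        proof
          fix k assume k: "k \<in> {..<n} - (+) ?o ` {..<ns ! \<alpha>}"
          have "rb k \<noteq> \<alpha>"
          proof
            assume "rb k = \<alpha>"
            then have "?o \<le> k" "k < ?o + ns ! \<alpha>" using k block_fun_iff[OF rb, of k \<alpha>] a
              by (auto simp: offset_Suc)
            then have "k = ?o + (k - ?o)" "k - ?o \<in> {..<ns ! \<alpha>}" by auto
            then show False using k by blast
          qed
          then show "P $$ (?o + i, k) * Pi $$ (k, ?o + j) = 0"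
            using block_zero[of "?o + i" k] bl[OF a ij(1)] k by simp
        qed
      qed (use bl(1)[OF a] in auto)
      also have "\<dots> = (P * Pi) $$ (?o + i, ?o + j)"
        using bl(1)[OF a ij(1)] bl(1)[OF a ij(2)] Pi(1) by (simp add: scalar_prod_def
          atLeast0LessThan tmat_def)
      finally show "(Bs ! \<alpha> * ?C) $$ (i, j) = 1\<^sub>m (ns ! \<alpha>) $$ (i, j)"
        using bl(1)[OF a ij(1)] bl(1)[OF a ij(2)] ij Pi(3) by simp
    qed (use c cC in auto)
    moreover from mat_mult_left_right_inverse[OF c cC this] have "?C * Bs ! \<alpha> = 1\<^sub>m (ns ! \<alpha>)" .
    ultimately show "invertible_mat (Bs ! \<alpha>)"
      using c cC unfolding invertible_mat_def inverts_mat_def by (auto intro!: exI[of _ ?C])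
  qed
  show "block_diag_times_perm ns (mat_of_cols n (map (col P) ks))"
    unfolding block_diag_times_perm_def
    by (rule exI[of _ Bs], rule exI[of _ \<pi>]) (use Bsi perm E dP in \<open>auto simp: R_def Bs_def\<close>)
  have Rc: "R \<in> carrier_mat n n" by (simp add: R_def)
  \<comment> \<open>The transposed permutation matrix, introduced to see that \<open>det R\<close>
    is nonzero.\<close>
  define R' :: "'a mat" where "R' = mat n n (\<lambda>(i, j). if \<pi> i = j then 1 else 0)"
  have R'c: "R' \<in> carrier_mat n n" by (simp add: R'_def)
  have RR: "R' * R = 1\<^sub>m n"
  proof (rule eq_matI)
    fix i j assume "i < dim_row (1\<^sub>m n :: 'a mat)" "j < dim_col (1\<^sub>m n :: 'a mat)"
    then have ij: "i < n" "j < n" by simp_all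
    have "\<pi> i < n" using permutes_in_image[OF perm, of i] ij by simp
    moreover have "\<pi> i = \<pi> j \<longleftrightarrow> i = j" using permutes_inj[OF perm] by (simp add: inj_eq)
    moreover have "(R' * R) $$ (i, j) = (\<Sum>k<n. (if \<pi> i = k then 1 else 0) * (if k =
      \<pi> j then 1 else 0))"
      using ij by (simp add: scalar_prod_def R_def R'_def atLeast0LessThan)
    moreover have "\<dots> = (\<Sum>k<n. if k = \<pi> i then (if \<pi> i = \<pi> j then 1 else 0) else 0 :: 'a)"
      by (intro sum.cong) auto
    ultimately show "(R' * R) $$ (i, j) = 1\<^sub>m n $$ (i, j)"
      using ij by simp
  qed (auto simp: R_def R'_def)
  then have "det R' * det R = 1" using det_mult[OF R'c Rc] by simp
  moreover have "det Pi * det P = 1" using det_mult[OF Pi(1) tmat_carrier, of m B] Pi(2) by simp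
  ultimately have "det (P * R) \<noteq> 0" using det_mult[OF tmat_carrier[of n m B] Rc] by auto
  moreover have PR: "P * R \<in> carrier_mat n n" by (rule mult_carrier_mat[OF tmat_carrier Rc])
  ultimately have "P * R \<in> Units (ring_mat TYPE('a) n ())" by (intro det_non_zero_imp_unit)
  then obtain C where "C \<in> carrier_mat n n" "C * (P * R) = 1\<^sub>m n" "(P * R) * C = 1\<^sub>m n"
    by (auto simp: Units_def ring_mat_def)
  then show "invertible_mat (mat_of_cols n (map (col P) ks))"
    unfolding E invertible_mat_def inverts_mat_def
    using PR by (intro conjI exI[of _ C]) (simp_all only: square_mat.simps carrier_matD)
qed

end


lemma sum_sum_delta:
  fixes K :: "'a :: comm_monoid_add"
  assumes "r < (n :: nat)" "c < (m :: nat)"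
  shows "(\<Sum>r'<n. \<Sum>c'<m. if r' = r then (if c' = c then K else 0) else 0) = K"
proof -
  have "(\<Sum>c'<m. if r' = r then (if c' = c then K else 0) else 0) = (if r' = r then K else 0)" for r'
    using assms(2) by (cases "r' = r") simp_all
  then show ?thesis using assms(1) by simp
qed

section \<open>Stable pairs in the coordinates of the normal form\<close>

locale dm_form =
  U: block_transform ns "sum_list ms" rb B Pi +
  V: block_transform ms "sum_list ns" cb "swap_args B" Qi
  for ns ms :: "nat list" and rb cb :: "nat \<Rightarrow> nat" and B :: "nat \<Rightarrow> nat \<Rightarrow> 'a :: field"
    and Pi Qi :: "'a mat" +
  fixes A :: "'a mat" and mr mc :: "nat \<Rightarrow> nat"
  assumes A: "A \<in> carrier_mat (sum_list ns) (sum_list ms)"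
    and nf: "normalized (sum_list ns) (sum_list ms) rb cb (\<lambda>i j. A $$ (i, j)) B mr mc"
begin

abbreviation "n \<equiv> sum_list ns"
abbreviation "m \<equiv> sum_list ms"
abbreviation "P \<equiv> tmat n m B"
abbreviation "Q \<equiv> tmat m n (swap_args B)"

definition A' :: "'a mat" where "A' = mat n m (\<lambda>(r, c). B r c)"

lemma A'_eq: "transpose_mat P * A * Q = A'"
proof (rule eq_matI)
  fix r c assume "r < dim_row A'" "c < dim_col A'"
  then have h: "r < n" "c < m" by (simp_all add: A'_def)
  have "(transpose_mat P * A * Q) $$ (r, c) = (\<Sum>j<m. (\<Sum>i<n. B r (m + i) * A $$ (i, j)) * B (n +
      j) c)"
    using h A by (simp add: scalar_prod_def atLeast0LessThan tmat_def)
  also have "\<dots> = (\<Sum>i<n. \<Sum>j<m. B r (m + i) * A $$ (i, j) * B (n + j) c)"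
    by (simp add: sum_distrib_right) (rule sum.swap)
  also have "\<dots> = B r c"
    using nf h unfolding normalized_def equivalent_def transformed_def by simp
  finally show "(transpose_mat P * A * Q) $$ (r, c) = A' $$ (r, c)" using h by (simp add: A'_def)
qed (use A in \<open>auto simp: A'_def tmat_def\<close>)

lemma bilinear_transform:
  assumes "x \<in> carrier_vec n" "y \<in> carrier_vec m"
  shows "(P *\<^sub>v x) \<bullet> (A *\<^sub>v (Q *\<^sub>v y)) = x \<bullet> (A' *\<^sub>v y)"
proof -
  have AQy: "A *\<^sub>v (Q *\<^sub>v y) \<in> carrier_vec n" using A by (intro carrier_vecI) simp
  have "(P *\<^sub>v x) \<bullet> (A *\<^sub>v (Q *\<^sub>v y)) = x \<bullet> (transpose_mat P *\<^sub>v (A *\<^sub>v (Q *\<^sub>v y)))"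
    using transpose_vec_mult_scalar[of "transpose_mat P" n n "A *\<^sub>v (Q *\<^sub>v y)" x] AQy assms(1)
    by (simp add: transpose_carrier_mat)
  also have "transpose_mat P *\<^sub>v (A *\<^sub>v (Q *\<^sub>v y)) = (transpose_mat P * A) *\<^sub>v (Q *\<^sub>v y)"
    by (rule assoc_mult_mat_vec[symmetric, of _ n n _ m]) (use A in \<open>auto simp:
      transpose_carrier_mat\<close>)
  also have "\<dots> = (transpose_mat P * A * Q) *\<^sub>v y"
    by (rule assoc_mult_mat_vec[symmetric, of _ n m _ m])
      (use A assms(2) mult_carrier_mat[OF transpose_carrier_mat[THEN iffD2, OF tmat_carrier] A] in
        auto)
  finally show ?thesis unfolding A'_eq .
qed

text \<open>In the coordinates given by \<open>Pi\<close> and \<open>Qi\<close> the form has the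
  matrix \<open>B\<close>, which reduces stability to statements on single entries.\<close>

lemma bilinear_sum:
  assumes "x \<in> carrier_vec n" "y \<in> carrier_vec m"
  shows "x \<bullet> (A *\<^sub>v y) = (\<Sum>r<n. \<Sum>c<m. (Pi *\<^sub>v x) $ r * B r c * (Qi *\<^sub>v y) $ c)"
proof -
  have "x \<bullet> (A *\<^sub>v y) = (Pi *\<^sub>v x) \<bullet> (A' *\<^sub>v (Qi *\<^sub>v y))"
    using bilinear_transform[of "Pi *\<^sub>v x" "Qi *\<^sub>v y"] assms by simp
  moreover have "(A' *\<^sub>v (Qi *\<^sub>v y)) $ r = (\<Sum>c<m. B r c * (Qi *\<^sub>v y) $ c)" if "r < n" for r
  proof -
    have "(A' *\<^sub>v (Qi *\<^sub>v y)) $ r = row A' r \<bullet> (Qi *\<^sub>v y)"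
      using that by (intro index_mult_mat_vec) (simp add: A'_def)
    also have "\<dots> = (\<Sum>c<dim_vec (Qi *\<^sub>v y). row A' r $ c * (Qi *\<^sub>v y) $ c)"
      unfolding scalar_prod_def atLeast0LessThan ..
    also have "dim_vec (Qi *\<^sub>v y) = m" using V.Pi_carrier by (rule carrier_vecD)
    also have "(\<Sum>c<m. row A' r $ c * (Qi *\<^sub>v y) $ c) = (\<Sum>c<m. B r c * (Qi *\<^sub>v y) $ c)"
      using that by (intro sum.cong refl) (simp add: A'_def)
    finally show ?thesis .
  qed
  moreover have "dim_vec (A' *\<^sub>v (Qi *\<^sub>v y)) = n" by (simp add: A'_def)
  ultimately show ?thesis
    unfolding scalar_prod_def atLeast0LessThan
    by (auto simp: sum_distrib_left mult.assoc simp del: index_mult_mat_vec intro!: sum.cong)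
qed

sublocale matched n m B mr mc
  by unfold_locales (use nf in \<open>simp add: normalized_def\<close>)

abbreviation "unmatched_to \<equiv> unmatched m mc"

definition stable_pair_of :: "nat set \<Rightarrow> 'a vec set \<times> 'a vec set" where
  "stable_pair_of L = (coord_space n Pi L, coord_space m Qi (unmatched_to L))"

lemma unmatched_to_subset: "unmatched_to L \<subseteq> {..<m}" by (auto simp: unmatched_def)

text \<open>The matching restricts to a bijection between the matched rows of \<open>L\<close> and
  the columns whose partner lies in \<open>L\<close>.\<close>

lemma card_unmatched_to:
  assumes "L \<subseteq> {..<n}"
  shows "card (unmatched_to L) + card {r \<in> L. mr r \<noteq> 0} = m"
proof -
  have "bij_betw (\<lambda>r. mr r - 1) {r \<in> L. mr r \<noteq> 0} ({..<m} - unmatched_to L)"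
  proof (rule bij_betwI[where g = "\<lambda>c. mc c - 1"])
    show "(\<lambda>r. mr r - 1) \<in> {r \<in> L. mr r \<noteq> 0} \<rightarrow> {..<m} - unmatched_to L"
      using assms partner_of_row by (auto simp: unmatched_def)
    show "(\<lambda>c. mc c - 1) \<in> {..<m} - unmatched_to L \<rightarrow> {r \<in> L. mr r \<noteq> 0}"
      using partner_of_col by (auto simp: unmatched_def)
    show "mc (mr r - 1) - 1 = r" if "r \<in> {r \<in> L. mr r \<noteq> 0}" for r
      using partner_of_row[of r] that assms by auto
    show "mr (mc c - 1) - 1 = c" if "c \<in> {..<m} - unmatched_to L" for c
      using partner_of_col[of c] that by (auto simp: unmatched_def)
  qed
  then have "card {r \<in> L. mr r \<noteq> 0} = card ({..<m} - unmatched_to L)" by (rule bij_betw_same_card)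
  also have "\<dots> = m - card (unmatched_to L)"
    using card_Diff_subset[OF finite_subset[OF unmatched_to_subset] unmatched_to_subset] by simp
  finally show ?thesis using card_mono[OF _ unmatched_to_subset[of L]] by simp
qed

text \<open>Putting a matched row into \<open>L\<close> removes exactly its partner from the
  unmatched columns. So the total does not depend on \<open>L\<close>, and all closed sets turn out
  to be optimal at once.\<close>

lemma card_rows_unmatched:
  assumes "L \<subseteq> {..<n}" "free_rows n mr \<subseteq> L"
  shows "card L + card (unmatched_to L) = m + card (free_rows n mr)"
proof -
  have f: "finite L" using assms(1) by (rule finite_subset) simp
  have "L = {r \<in> L. mr r \<noteq> 0} \<union> free_rows n mr" using assms by (auto simp: free_rows_def)
  then have "card L = card {r \<in> L. mr r \<noteq> 0} + card (free_rows n mr)"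
  proof -
    have "card ({r \<in> L. mr r \<noteq> 0} \<union> free_rows n mr) = card {r \<in> L. mr r \<noteq> 0} +
        card (free_rows n mr)"
      by (rule card_Un_disjoint) (use f in \<open>auto simp: free_rows_def\<close>)
    then show ?thesis using \<open>L = _\<close> by simp
  qed
  then show ?thesis using card_unmatched_to[OF assms(1)] by simp
qed

lemma stable_pair_of_dim:
  assumes "L \<subseteq> {..<n}" "free_rows n mr \<subseteq> L"
  shows "pair_dim ns ms (stable_pair_of L) = m + card (free_rows n mr)"
  using assms U.dim_coord_space[of L] V.dim_coord_space[OF unmatched_to_subset[of L]]
    card_rows_unmatched[OF assms]
  by (simp add: pair_dim_def stable_pair_of_def)

lemma stable_pair_of_stable:
  assumes "rows_closed L"
  shows "stable_pair ns ms A (stable_pair_of L)"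
  unfolding stable_pair_def stable_pair_of_def split
proof (intro conjI ballI U.coord_space_in_lattice V.coord_space_in_lattice)
  fix x y assume x: "x \<in> coord_space n Pi L" and y: "y \<in> coord_space m Qi (unmatched_to L)"
  have "(Pi *\<^sub>v x) $ r * B r c * (Qi *\<^sub>v y) $ c = 0" if "r < n" "c < m" for r c
    using x y that assms unfolding coord_space_def closed_set_def
      by (cases "r \<in> L"; cases "c \<in> unmatched_to L") auto
  then have "(\<Sum>r<n. \<Sum>c<m. (Pi *\<^sub>v x) $ r * B r c * (Qi *\<^sub>v y) $ c) = 0"
    by (intro sum.neutral ballI) simp
  then show "x \<bullet> (A *\<^sub>v y) = 0" using x y by (subst bilinear_sum) (auto simp: coord_space_def)
qed

text \<open>\<open>L\<close> collects the coordinates that \<open>X\<close> uses, enlarged by the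
  free rows. Isolation shows that \<open>Y\<close> uses no column matched into \<open>L\<close>, so
  \<open>card_rows_unmatched\<close> bounds the total dimension. If the bound is attained, both
  inclusions into coordinate spaces are equalities.\<close>

lemma stable_pair_bound:
  assumes st: "stable_pair ns ms A (X, Y)"
  shows "pair_dim ns ms (X, Y) \<le> m + card (free_rows n mr)"
    and "pair_dim ns ms (X, Y) = m + card (free_rows n mr) \<Longrightarrow> \<exists>L. rows_closed L \<and> (X, Y) =
      stable_pair_of L"
proof -
  have X: "X \<in> block_lattice ns" and Y: "Y \<in> block_lattice ms"
    and s: "\<And>x y. x \<in> X \<Longrightarrow> y \<in> Y \<Longrightarrow> x \<bullet> (A *\<^sub>v y) = 0"
    using st by (auto simp: stable_pair_def)
  note XD = block_latticeD[OF U.rb X] and YD = block_latticeD[OF V.rb Y]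
  have Xc: "x \<in> carrier_vec n" if "x \<in> X" for x using is_subspaceD(1)[OF XD(1)] that by auto
  have Yc: "y \<in> carrier_vec m" if "y \<in> Y" for y using is_subspaceD(1)[OF YD(1)] that by auto
  define L where "L = {r. r < n \<and> (mr r = 0 \<or> (\<exists>x\<in>X. (Pi *\<^sub>v x) $ r \<noteq> 0))}"
  have L: "L \<subseteq> {..<n}" "free_rows n mr \<subseteq> L" by (auto simp: L_def free_rows_def)
  have XL: "X \<subseteq> coord_space n Pi L" using Xc by (auto simp: coord_space_def L_def)
  have YL: "Y \<subseteq> coord_space m Qi (unmatched_to L)"
    unfolding coord_space_def
  proof (intro subsetI CollectI conjI allI impI)
    fix y c assume y: "y \<in> Y" and c: "c < m" "c \<notin> unmatched_to L"
    define r where "r = mc c - 1"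
    have "mc c \<noteq> 0" "r \<in> L" using c by (auto simp: unmatched_def r_def)
    then have r: "r < n" "mr r = Suc c" using partner_of_col[OF c(1)] by (auto simp: r_def)
    then obtain x where x: "x \<in> X" "(Pi *\<^sub>v x) $ r \<noteq> 0" using \<open>r \<in> L\<close> by (auto simp: L_def)
    have iso: "isolated n m rb cb B r c" using nf r by (auto simp: normalized_def)
    have rb_lt: "rb r < length ns" "cb c < length ms"
      using U.rb V.rb r(1) c(1) by (auto simp: is_block_fun_def)
    \<comment> \<open>The projections stay in \<open>X\<close> and \<open>Y\<close>. They keep only
      the coordinates of the block of the isolated entry, so a single product of the double sum
      survives.\<close>
    let ?x = "block_proj ns (rb r) x" and ?y = "block_proj ms (cb c) y"
    have "0 = ?x \<bullet> (A *\<^sub>v ?y)" using s XD(2)[OF x(1)] YD(2)[OF y] rb_lt by simp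
    also have "\<dots> = (\<Sum>r'<n. \<Sum>c'<m. (Pi *\<^sub>v ?x) $ r' * B r' c' * (Qi *\<^sub>v ?y) $ c')"
      by (rule bilinear_sum) (use Xc[OF x(1)] Yc[OF y] in simp_all)
    also have "\<dots> = (\<Sum>r'<n. \<Sum>c'<m. if r' = r then (if c' =
      c then (Pi *\<^sub>v x) $ r * B r c * (Qi *\<^sub>v y) $ c else 0) else 0)"
    proof (intro sum.cong refl)
      fix r' c' assume h: "r' \<in> {..<n}" "c' \<in> {..<m}"
      have e: "(Pi *\<^sub>v ?x) $ r' = (if rb r' = rb r then (Pi *\<^sub>v x) $ r' else 0)"
        "(Qi *\<^sub>v ?y) $ c' = (if cb c' = cb c then (Qi *\<^sub>v y) $ c' else 0)"
        unfolding U.Pi_block_proj[OF Xc[OF x(1)]] V.Pi_block_proj[OF Yc[OF y]]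
        using h index_block_proj[OF U.rb U.Pi_carrier] index_block_proj[OF V.rb V.Pi_carrier]
          by auto
      show "(Pi *\<^sub>v ?x) $ r' * B r' c' * (Qi *\<^sub>v ?y) $ c' =
          (if r' = r then (if c' = c then (Pi *\<^sub>v x) $ r * B r c * (Qi *\<^sub>v y) $ c else 0) else 0)"
        unfolding e using iso h unfolding isolated_def by auto
    qed
    also have "\<dots> = (Pi *\<^sub>v x) $ r * B r c * (Qi *\<^sub>v y) $ c" by (rule sum_sum_delta[OF r(1) c(1)])
    finally show "(Qi *\<^sub>v y) $ c = 0" using x(2) iso by (simp add: isolated_def)
  qed (use Yc in auto)
  note sp = is_subspace_coord_space[OF U.Pi(1), of L] is_subspace_coord_space[OF V.Pi(1), of
    "unmatched_to L"]
  note d = U.dim_coord_space[OF L(1)] V.dim_coord_space[OF unmatched_to_subset[of L]]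
  note mono = subspace_dim_mono[OF XD(1) sp(1) XL] subspace_dim_mono[OF YD(1) sp(2) YL]
  show "pair_dim ns ms (X, Y) \<le> m + card (free_rows n mr)"
    using mono(1,3) d card_rows_unmatched[OF L] by (simp add: pair_dim_def)
  assume "pair_dim ns ms (X, Y) = m + card (free_rows n mr)"
  then have "subspace_dim n X = card L" "subspace_dim m Y = card (unmatched_to L)"
    using mono(1,3) d card_rows_unmatched[OF L] by (simp_all add: pair_dim_def)
  then have XY: "X = coord_space n Pi L" "Y = coord_space m Qi (unmatched_to L)"
    using mono(2,4) d by simp_all
  \<comment> \<open>\<open>X\<close> and \<open>Y\<close> now contain the basis vectors of their
    coordinates, and stability on these reads off the entries of \<open>B\<close>.\<close>
  have "B r c = 0" if r: "r \<in> L" and c: "c \<in> unmatched_to L" for r c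
  proof -
    have rn: "r < n" and cm: "c < m" using r c L(1) unmatched_to_subset by auto
    have "col P r \<in> X" "col Q c \<in> Y" using r c rn cm XY U.col_in_coord_space V.col_in_coord_space
        by auto
    then have "0 = (\<Sum>r'<n. \<Sum>c'<m. (Pi *\<^sub>v col P r) $ r' * B r' c' * (Qi *\<^sub>v col Q c) $ c')"
      using s Xc Yc by (subst bilinear_sum[symmetric]) auto
    also have "\<dots> = (\<Sum>r'<n. \<Sum>c'<m. if r' = r then (if c' = c then B r c else 0) else 0)"
      unfolding U.Pi_col[OF rn] V.Pi_col[OF cm] by (intro sum.cong refl) (auto simp: unit_vec_def)
    also have "\<dots> = B r c" by (rule sum_sum_delta[OF rn cm])
    finally show ?thesis by simp
  qed
  then have "rows_closed L" using L by (simp add: closed_set_def)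
  then show "\<exists>L. rows_closed L \<and> (X, Y) = stable_pair_of L" using XY
    by (auto simp: stable_pair_of_def)
qed

text \<open>The closed set \<open>L0\<close> witnesses that the upper bound is attained, so the
  maximum is this bound and \<open>stable_pair_bound\<close> describes all pairs that attain
  it.\<close>

lemma S_max_eq:
  assumes "rows_closed L0"
  shows "S_max ns ms A = stable_pair_of ` {L. rows_closed L}"
proof (intro equalityI subsetI)
  have st: "stable_pair ns ms A (stable_pair_of L)" "pair_dim ns ms (stable_pair_of L) = m +
      card (free_rows n mr)"
    if "rows_closed L" for L
    using that stable_pair_of_stable stable_pair_of_dim by (auto simp: closed_set_def)
  {
    fix p assume "p \<in> S_max ns ms A"
    then have p: "stable_pair ns ms A p" "pair_dim ns ms (stable_pair_of L0) \<le> pair_dim ns ms p"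
      using st(1)[OF assms] unfolding S_max_def by blast+
    then have "pair_dim ns ms p = m + card (free_rows n mr)"
      using stable_pair_bound(1)[of "fst p" "snd p"] st(2)[OF assms] by simp
    then show "p \<in> stable_pair_of ` {L. rows_closed L}"
      using stable_pair_bound(2)[of "fst p" "snd p"] p(1) by auto
  next
    fix p assume "p \<in> stable_pair_of ` {L. rows_closed L}"
    then obtain L where L: "rows_closed L" "p = stable_pair_of L" by auto
    have "pair_dim ns ms q \<le> pair_dim ns ms p" if "stable_pair ns ms A q" for q
      using stable_pair_bound(1)[of "fst q" "snd q"] that st(2)[OF L(1)] L(2) by simp
    then show "p \<in> S_max ns ms A" using st(1)[OF L(1)] L(2) by (simp add: S_max_def)
  }
qed

lemma pair_le_iff:
  assumes "rows_closed L"
  shows "pair_le (stable_pair_of L) (stable_pair_of L') \<longleftrightarrow> L \<subseteq> L'"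
  using U.coord_space_subset_iff[of L L'] assms by (simp add: pair_le_def stable_pair_of_def
    closed_set_def)

lemma stable_pair_of_inj: "rows_closed L \<Longrightarrow> rows_closed L' \<Longrightarrow> stable_pair_of L = stable_pair_of L' \<Longrightarrow>
  L = L'"
  using pair_le_iff[of L L'] pair_le_iff[of L' L] by (auto simp: pair_le_def)

text \<open>Maximality is transported along \<open>stable_pair_of\<close>, an order embedding of the
  closed sets onto \<open>S_max ns ms A\<close>.\<close>

lemma maximal_chain_of_rows:
  assumes ne: "Ls \<noteq> []" and cl: "\<And>L. L \<in> set Ls \<Longrightarrow> rows_closed L" and sorted: "sorted_wrt (\<subset>) Ls"
    and max: "\<And>L. rows_closed L \<Longrightarrow> (\<And>L'. L' \<in> set Ls \<Longrightarrow> L \<subseteq> L' \<or> L' \<subseteq> L) \<Longrightarrow> L \<in> set Ls"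
  shows "maximal_chain ns ms A (map stable_pair_of Ls)"
  unfolding maximal_chain_def
proof
  have "sorted_wrt (\<lambda>L L'. pair_less (stable_pair_of L) (stable_pair_of L')) Ls"
  proof (rule sorted_wrt_mono_rel[OF _ sorted])
    fix L L' assume L: "L \<in> set Ls" "L' \<in> set Ls" "L \<subset> L'"
    have "stable_pair_of L \<noteq> stable_pair_of L'" using stable_pair_of_inj[OF cl[OF L(1)] cl[OF L(2)]]
        L(3) by blast
    then show "pair_less (stable_pair_of L) (stable_pair_of L')"
      using pair_le_iff[OF cl[OF L(1)]] L(3) by (simp add: pair_less_def)
  qed
  then show "sorted_wrt pair_less (map stable_pair_of Ls)" by (simp add: sorted_wrt_map)
  have Sm: "S_max ns ms A = stable_pair_of ` {L. rows_closed L}"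
    using S_max_eq[OF cl[of "hd Ls"]] ne by simp
  have tot: "L \<subseteq> L' \<or> L' \<subseteq> L" if "L \<in> set Ls" "L' \<in> set Ls" for L L'
    using that sorted by (induction Ls) auto
  have ch: "pred_on.chain (S_max ns ms A) pair_le (set (map stable_pair_of Ls))"
    unfolding pred_on.chain_def
  proof (intro conjI ballI)
    show "set (map stable_pair_of Ls) \<subseteq> S_max ns ms A" using cl Sm by auto
  next
    fix x y assume "x \<in> set (map stable_pair_of Ls)" "y \<in> set (map stable_pair_of Ls)"
    then obtain L L' where L: "L \<in> set Ls" "L' \<in> set Ls" "x = stable_pair_of L"
      "y = stable_pair_of L'"
      by auto
    then have "pair_le x y \<or> pair_le y x"
      using tot[OF L(1,2)] pair_le_iff[OF cl[OF L(1)]] pair_le_iff[OF cl[OF L(2)]] by simp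
    then show "pair_le\<^sup>=\<^sup>= x y \<or> pair_le\<^sup>=\<^sup>= y x" by auto
  qed
  have "\<not> (\<exists>S. pred_on.chain (S_max ns ms A) pair_le S \<and> set (map stable_pair_of Ls) \<subset> S)"
  proof
    assume "\<exists>S. pred_on.chain (S_max ns ms A) pair_le S \<and> set (map stable_pair_of Ls) \<subset> S"
    then obtain S where S0: "pred_on.chain (S_max ns ms A) pair_le S"
      "set (map stable_pair_of Ls) \<subset> S"
      by (elim exE conjE)
    obtain p where "p \<in> S" "p \<notin> set (map stable_pair_of Ls)"
      using psubset_imp_ex_mem[OF S0(2)] by (elim exE DiffE)
    note S = S0(1) psubset_imp_subset[OF S0(2)] this
    have "S \<subseteq> stable_pair_of ` {L. rows_closed L}" using S(1) Sm unfolding pred_on.chain_def by simp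
    then obtain L where L: "rows_closed L" "p = stable_pair_of L" using S(3) by auto
    have "L \<subseteq> L' \<or> L' \<subseteq> L" if L': "L' \<in> set Ls" for L'
    proof -
      have "stable_pair_of L' \<in> S" using S(2) L' by auto
      then have "pair_le p (stable_pair_of L') \<or> pair_le (stable_pair_of L') p"
        using S(1,3) unfolding pred_on.chain_def by (auto simp: pair_le_def)
      then show ?thesis using pair_le_iff L cl[OF L'] by simp
    qed
    then have "L \<in> set Ls" using max L(1) by blast
    then show False using S(4) L(2) by auto
  qed
  then show "pred_on.maxchain (S_max ns ms A) pair_le (set (map stable_pair_of Ls))"
    using ch by (simp add: pred_on.maxchain_def)
qed

text \<open>The equations for \<open>E\<close>, \<open>F\<close> and \<open>D\<close> have the shape
  of the output arrays. \<open>D\<close> only permutes rows and columns of the top left corner of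
  \<open>B\<close>, so the program obtains it without multiplying matrices.\<close>

lemma DM_decomposition_of_rows:
  assumes ne: "Ls \<noteq> []" and cl: "\<And>L. L \<in> set Ls \<Longrightarrow> rows_closed L" and sorted: "sorted_wrt (\<subset>) Ls"
    and max: "\<And>L. rows_closed L \<Longrightarrow> (\<And>L'. L' \<in> set Ls \<Longrightarrow> L \<subseteq> L' \<or> L' \<subseteq> L) \<Longrightarrow> L \<in> set Ls"
    and ks: "distinct ks" "set ks = {..<n}" "\<And>L. L \<in> set Ls \<Longrightarrow> L = set (take (card L) ks)"
    and ls: "distinct ls" "set ls = {..<m}"
      "\<And>L. L \<in> set Ls \<Longrightarrow> unmatched_to L = set (take (card (unmatched_to L)) ls)"
    and E: "E = mat n n (\<lambda>(i, t). B (rev ks ! t) (m + i))"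
    and F: "F = mat m m (\<lambda>(j, t). B (n + j) (ls ! t))"
    and D: "D = mat n m (\<lambda>(s, t). B (rev ks ! s) (ls ! t))"
  shows "invertible_mat E \<and> block_diag_times_perm ns E \<and> invertible_mat F \<and>
    block_diag_times_perm ms F \<and>
    DM_decomposition ns ms A (map stable_pair_of Ls) E F D"
proof -
  have len: "length ks = n" "length ls = m" using ks ls by (metis card_lessThan distinct_card)+
  have kl: "rev ks ! t < n" if "t < n" for t
    using that len ks(2) by (metis length_rev lessThan_iff nth_mem set_rev)
  have ll: "ls ! t < m" if "t < m" for t
    using that len ls(2) by (metis lessThan_iff nth_mem)
  have E': "E = mat_of_cols n (rev (map (col P) ks))"
    unfolding E rev_map by (rule eq_matI) (use len kl in \<open>auto simp: mat_of_cols_index tmat_def\<close>)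
  have F': "F = mat_of_cols m (map (col Q) ls)"
    unfolding F by (rule eq_matI) (use len ll in \<open>auto simp: mat_of_cols_index tmat_def\<close>)
  have "D = transpose_mat E * A * F"
  proof (rule eq_matI)
    fix s t assume "s < dim_row (transpose_mat E * A * F)" "t < dim_col (transpose_mat E * A * F)"
    then have h: "s < n" "t < m" by (simp_all add: E F)
    have "(transpose_mat E * A * F) $$ (s, t) =
        (\<Sum>j<m. (\<Sum>i<n. B (rev ks ! s) (m + i) * A $$ (i, j)) * B (n + j) (ls ! t))"
      using h A by (simp add: scalar_prod_def atLeast0LessThan E F)
    also have "\<dots> = (transpose_mat P * A * Q) $$ (rev ks ! s, ls ! t)"
      using kl[OF h(1)] ll[OF h(2)] A by (simp add: scalar_prod_def atLeast0LessThan tmat_def)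
    also have "\<dots> = B (rev ks ! s) (ls ! t)" using kl[OF h(1)] ll[OF h(2)]
      by (simp add: A'_eq) (simp add: A'_def)
    finally show "D $$ (s, t) = (transpose_mat E * A * F) $$ (s, t)" using h by (simp add: D)
  qed (use A in \<open>simp_all add: D E F\<close>)
  moreover have "adapted_basis ns (map fst (map stable_pair_of Ls)) (map (col P) ks)"
    using U.adapted_basis_cols[OF ks(1,2), of Ls] ks(3) by (simp add: stable_pair_of_def comp_def)
  moreover have "adapted_basis ms (map snd (map stable_pair_of Ls)) (map (col Q) ls)"
    using V.adapted_basis_cols[OF ls(1,2), of "map unmatched_to Ls"] ls(3)
      by (auto simp: stable_pair_of_def comp_def)
  ultimately have "DM_decomposition ns ms A (map stable_pair_of Ls) E F D"
    using maximal_chain_of_rows[OF ne cl sorted max] E' F' unfolding DM_decomposition_def by blast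
  then show ?thesis
    using U.block_diag_times_perm_cols[of "rev ks"] V.block_diag_times_perm_cols[of ls] ks(1,2)
      ls(1,2)
    by (simp add: E' F' rev_map)
qed

end

section \<open>The program and its correctness\<close>

text \<open>
  The array \<open>A\<close> is overwritten by the array \<open>B\<close> above.  \<open>mr\<close> and \<open>mc\<close> hold the partners of the rows
  and columns, row \<open>a < n\<close> of \<open>d\<close> the distances from the row \<open>a\<close>, and row \<open>n\<close> of \<open>d\<close> the distances from
  the set of free rows.  \<open>cnt\<close> holds the number of rows reachable from a row, and \<open>bad\<close> marks the rows
  from which a free column can be reached.  \<open>ord\<close> and \<open>co\<close> are the orders in which the rows and columns
  enter \<open>E\<close> and \<open>F\<close>; \<open>q\<close> counts the rows (columns) placed so far, and \<open>w\<close> the matched ones among them.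
\<close>

abbreviation vec_cell :: "string \<Rightarrow> nexp \<Rightarrow> nexp" where
  "vec_cell x a \<equiv> NArr x a (NConst 0)"

abbreviation NOr :: "bexp \<Rightarrow> bexp \<Rightarrow> bexp" where
  "NOr a b \<equiv> BNot (BAnd (BNot a) (BNot b))"

abbreviation NSuc :: "nexp \<Rightarrow> nexp" where
  "NSuc e \<equiv> NPlus e (NConst 1)"

abbreviation "nN \<equiv> NVar ''n''"
abbreviation "mN \<equiv> NVar ''m''"

section \<open>Programs for the normal form\<close>

definition block_prog :: "string \<Rightarrow> string \<Rightarrow> string \<Rightarrow> prog" where
  "block_prog out cnt len =
     PSetN ''p'' (NConst 0) ;;
     PFor ''a'' (NVar cnt) (PFor ''b'' (vec_cell len (NVar ''a''))
       (PSetNArr out (NVar ''p'') (NConst 0) (NVar ''a'') ;; PSetN ''p'' (NSuc (NVar ''p''))))"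

definition init_rows :: prog where
  "init_rows = PFor ''r'' nN (PSetFArr ''A'' (NVar ''r'') (NPlus mN (NVar ''r'')) FOne)"

definition init_cols :: prog where
  "init_cols = PFor ''c'' mN (PSetFArr ''A'' (NPlus nN (NVar ''c'')) (NVar ''c'') FOne)"

definition init_prog :: prog where
  "init_prog = init_rows ;; init_cols"

definition bfs_init :: prog where
  "bfs_init = PFor ''r'' nN
     (PIf (NOr (NEq (NVar ''r'') (NVar ''s'')) (BAnd (NEq (NVar ''s'') nN) (NEq (vec_cell ''mr''
       (NVar ''r'')) (NConst 0))))
       (PSetNArr ''d'' (NVar ''s'') (NVar ''r'') (NConst 1))
       (PSetNArr ''d'' (NVar ''s'') (NVar ''r'') (NConst 0)))"

text \<open>Round \<open>k\<close> writes \<open>k + 2\<close>, that is the distance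
  \<open>k + 1\<close> shifted by 1. The comparison with \<open>k + 2\<close> admits only rows at
  distance at most \<open>k\<close>, so rows reached in the same round do not propagate.\<close>

definition bfs_scan :: prog where
  "bfs_scan = PFor ''z'' nN
     (PIf (BAnd (BNot (NEq (NArr ''d'' (NVar ''s'') (NVar ''z'')) (NConst 0)))
          (BAnd (NLess (NArr ''d'' (NVar ''s'') (NVar ''z'')) (NPlus (NVar ''k'') (NConst 2)))
            (BNot (FEq (FArr ''A'' (NVar ''z'') (NMinus (vec_cell ''mr'' (NVar ''r'')) (NConst 1)))
              FZero))))
       (PSetNArr ''d'' (NVar ''s'') (NVar ''r'') (NPlus (NVar ''k'') (NConst 2))) PSkip)"

definition bfs_round :: prog where
  "bfs_round = PFor ''r'' nN
     (PIf (BAnd (NEq (NArr ''d'' (NVar ''s'') (NVar ''r'')) (NConst 0)) (BNot (NEq (vec_cell ''mr''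
       (NVar ''r'')) (NConst 0))))
       bfs_scan PSkip)"

definition bfs_prog :: prog where
  "bfs_prog = bfs_init ;; PFor ''k'' nN bfs_round"

definition find_cols :: prog where
  "find_cols = PFor ''c'' mN
     (PIf (BAnd (NEq (NVar ''found'') (NConst 0)) (BAnd (NEq (NArr ''d'' (NVar ''s'') (NVar ''r''))
       (NSuc (NVar ''k'')))
         (BAnd (NEq (vec_cell ''mc'' (NVar ''c'')) (NConst 0)) (BNot (FEq (FArr ''A'' (NVar ''r'')
           (NVar ''c'')) FZero)))))
       (PSetN ''found'' (NConst 1) ;; PSetN ''pr'' (NVar ''r'') ;;
         PSetN ''pc'' (NVar ''c'')) PSkip)"

definition find_rows :: prog where
  "find_rows = PFor ''r'' nN find_cols"

text \<open>Distances run from 0 to \<open>n\<close>, hence \<open>n + 1\<close> passes. Scanning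
  them upwards and keeping the first hit gives a free column at minimal distance.\<close>

definition find_prog :: prog where
  "find_prog = PSetN ''found'' (NConst 0) ;; PFor ''k'' (NSuc nN) find_rows"

definition elim_row_prog :: prog where
  "elim_row_prog = PFor ''y'' (NPlus mN nN)
     (PSetFArr ''A'' (NVar ''x'') (NVar ''y'') (FMinus (FArr ''A'' (NVar ''x'') (NVar ''y''))
        (FTimes (FVar ''f'') (FArr ''A'' (NVar ''pr'') (NVar ''y'')))))"

text \<open>The multiplier is saved in \<open>f\<close> because the inner loop overwrites the entry
  in column \<open>pc\<close> from which it is formed.\<close>

definition elim_rows_prog :: prog where
  "elim_rows_prog = PFor ''x'' nN
     (PIf (BAnd (BNot (NEq (NVar ''x'') (NVar ''pr''))) (NEq (vec_cell ''rb'' (NVar ''x''))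
       (vec_cell ''rb'' (NVar ''pr''))))
       (PSetF ''f'' (FDiv (FArr ''A'' (NVar ''x'') (NVar ''pc'')) (FArr ''A'' (NVar ''pr'') (NVar
         ''pc''))) ;; elim_row_prog)
       PSkip)"

definition elim_col_prog :: prog where
  "elim_col_prog = PFor ''y'' (NPlus nN mN)
     (PSetFArr ''A'' (NVar ''y'') (NVar ''x'') (FMinus (FArr ''A'' (NVar ''y'') (NVar ''x''))
        (FTimes (FVar ''f'') (FArr ''A'' (NVar ''y'') (NVar ''pc'')))))"

definition elim_cols_prog :: prog where
  "elim_cols_prog = PFor ''x'' mN
     (PIf (BAnd (BNot (NEq (NVar ''x'') (NVar ''pc''))) (NEq (vec_cell ''cb'' (NVar ''x''))
       (vec_cell ''cb'' (NVar ''pc''))))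
       (PSetF ''f'' (FDiv (FArr ''A'' (NVar ''pr'') (NVar ''x'')) (FArr ''A'' (NVar ''pr'') (NVar
         ''pc''))) ;; elim_col_prog)
       PSkip)"

text \<open>The old partner has to be released while \<open>mr\<close> still names it.\<close>

definition rematch_prog :: prog where
  "rematch_prog =
     PIf (NEq (vec_cell ''mr'' (NVar ''pr'')) (NConst 0)) PSkip
       (PSetNArr ''mc'' (NMinus (vec_cell ''mr'' (NVar ''pr'')) (NConst 1)) (NConst 0) (NConst 0))
         ;;
     PSetNArr ''mr'' (NVar ''pr'') (NConst 0) (NSuc (NVar ''pc'')) ;;
     PSetNArr ''mc'' (NVar ''pc'') (NConst 0) (NSuc (NVar ''pr''))"

definition step_prog :: prog where
  "step_prog = PSetN ''s'' nN ;; bfs_prog ;; find_prog ;;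
     PIf (NEq (NVar ''found'') (NConst 0)) PSkip (rematch_prog ;; elim_rows_prog ;; elim_cols_prog)"

text \<open>A pass of the outer loop removes a free row unless no free column can be reached. The
  inner loop allows for all distances from \<open>n\<close> down to 0.\<close>

definition match_prog :: prog where
  "match_prog = PFor ''a'' (NSuc nN) (PFor ''b'' (NSuc nN) step_prog)"

lemmas loop_defs = block_prog_def init_rows_def init_cols_def init_prog_def bfs_init_def
  bfs_scan_def bfs_round_def bfs_prog_def
  find_cols_def find_rows_def find_prog_def elim_row_prog_def elim_rows_prog_def elim_col_prog_def
  elim_cols_prog_def rematch_prog_def step_prog_def match_prog_def

section \<open>Correctness of the preparation\<close>

lemma block_prog_correct:
  fixes s :: "'a :: field store"
  assumes cnt: "nvar s cnt = length ks" and len: "\<And>\<alpha>. \<alpha> < length ks \<Longrightarrow> narr s len \<alpha> 0 = ks ! \<alpha>"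
    and ne: "out \<noteq> len" "cnt \<noteq> ''p''" "cnt \<noteq> ''a''" "cnt \<noteq> ''b''"
  shows "is_block_fun ks (\<lambda>r. narr (sem (block_prog out cnt len) s) out r 0)"
proof -
  define good where "good rb r \<longleftrightarrow> rb r < length ks \<and> offset ks (rb r) \<le> r \<and>
    r < offset ks (Suc (rb r))"
    for rb :: "nat \<Rightarrow> nat" and r
  let ?rb = "\<lambda>t r. narr t out r 0"
  let ?b = "PSetNArr out (NVar ''p'') (NConst 0) (NVar ''a'') ;; PSetN ''p'' (NSuc (NVar ''p''))"
  let ?s = "setn ''p'' 0 s"
  have "is_block_fun ks (?rb (sem (PFor ''a'' (NVar cnt) (PFor ''b'' (vec_cell len (NVar ''a''))
      ?b)) ?s))"
  proof (rule sem_for_rule[where I = "\<lambda>i t. nvar t ''p'' = offset ks i \<and>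
    (\<forall>r<offset ks i. good (?rb t) r)"])
    fix i and t :: "'a store" assume i: "i < nval (NVar cnt) ?s"
      and I: "nvar t ''p'' = offset ks i \<and> (\<forall>r<offset ks i. good (?rb t) r)"
      and fr: "framed (PFor ''a'' (NVar cnt) (PFor ''b'' (vec_cell len (NVar ''a'')) ?b)) ?s t"
    note fr = framed_simps[OF fr]
    have i': "i < length ks" using i ne cnt by simp
    have N: "nval (vec_cell len (NVar ''a'')) (setn ''a'' i t) = ks ! i" using fr ne len[OF i']
        by simp
    show "nvar (sem (PFor ''b'' (vec_cell len (NVar ''a'')) ?b) (setn ''a'' i t)) ''p'' =
        offset ks (Suc i) \<and>
        (\<forall>r<offset ks (Suc i). good (?rb (sem (PFor ''b'' (vec_cell len (NVar ''a'')) ?b) (setn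
          ''a'' i t))) r)"
    proof (rule sem_for_rule[where I = "\<lambda>j u. nvar u ''p'' = offset ks i + j \<and> (\<forall>r<offset ks i +
      j. good (?rb u) r)"])
      fix j u assume j: "j < nval (vec_cell len (NVar ''a'')) (setn ''a'' i t)"
        and J: "nvar u ''p'' = offset ks i + j \<and> (\<forall>r<offset ks i + j. good (?rb u) r)"
        and fr2: "framed (PFor ''b'' (vec_cell len (NVar ''a'')) ?b) (setn ''a'' i t) u"
      note fr2 = framed_simps[OF fr2]
      show "nvar (sem ?b (setn ''b'' j u)) ''p'' = offset ks i + Suc j \<and>
          (\<forall>r<offset ks i + Suc j. good (?rb (sem ?b (setn ''b'' j u))) r)"
      proof (intro conjI allI impI)
        have new: "?rb (sem ?b (setn ''b'' j u)) r = (if r = offset ks i + j then i else ?rb u r)"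
            for r
          using J fr2 by simp
        show "nvar (sem ?b (setn ''b'' j u)) ''p'' = offset ks i + Suc j" using J by simp
        fix r assume r: "r < offset ks i + Suc j"
        show "good (?rb (sem ?b (setn ''b'' j u))) r"
        proof (cases "r = offset ks i + j")
          case True
          then show ?thesis using i' j unfolding good_def new N by (simp add: offset_Suc)
        next
          case False
          then have "good (?rb u) r" using J r by simp
          then show ?thesis using False unfolding good_def new by simp
        qed
      qed
    qed (use I in \<open>simp_all add: N offset_Suc[OF i'] del: nval.simps\<close>)
  next
    fix t :: "'a store" assume "nvar t ''p'' = offset ks (nval (NVar cnt) ?s) \<and>
      (\<forall>r<offset ks (nval (NVar cnt) ?s). good (?rb t) r)"
    then show "is_block_fun ks (?rb (setn ''a'' (nval (NVar cnt) ?s) t))"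
      using ne cnt by (simp add: is_block_fun_def good_def)
  qed simp
  then show ?thesis by (simp add: block_prog_def del: sem.simps(8))
qed

lemma init_prog_correct:
  assumes "nvar s ''n'' = n" "nvar s ''m'' = m"
  shows "farr (sem init_prog s) ''A'' x y =
    (if x < n \<and> y = m + x \<or> y < m \<and> x = n + y then 1 else farr s ''A'' x y)"
proof -
  have 1: "farr (sem init_rows s) ''A'' x y = (if x < n \<and> y = m + x then 1 else farr s ''A'' x y)"
      for x y
    unfolding init_rows_def
  proof (rule sem_for_rule[where I = "\<lambda>i t. farr t ''A'' x y = (if x < i \<and> y = m +
    x then 1 else farr s ''A'' x y)"], goal_cases)
    case (2 i t)
    then show ?case using framed_simps(1)[OF 2(3)] assms by auto
  qed (use assms in auto)
  let ?s = "sem init_rows s"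
  have nm: "nvar ?s ''n'' = n" "nvar ?s ''m'' = m" using assms
      by (simp_all add: sem_frame_n init_rows_def del: sem.simps)
  have "farr (sem init_cols ?s) ''A'' x y = (if y < m \<and> x = n + y then 1 else farr ?s ''A'' x y)"
    unfolding init_cols_def
  proof (rule sem_for_rule[where I = "\<lambda>i t. farr t ''A'' x y = (if y < i \<and> x = n +
    y then 1 else farr ?s ''A'' x y)"], goal_cases)
    case (2 i t)
    then show ?case using framed_simps(1)[OF 2(3)] nm by auto
  qed (use nm in auto)
  then show ?thesis using 1 by (simp add: init_prog_def)
qed

text \<open>Both transformations start as identity matrices, in the two off-diagonal corners of the
  array.\<close>

lemma equivalent_initial:
  fixes B :: "nat \<Rightarrow> nat \<Rightarrow> 'a :: field"
  assumes B: "\<And>x y. B x y = (if x < n \<and> y = m + x \<or> y < m \<and> x = n + y then 1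
      else if x < n \<and> y < m then A x y else 0)"
    and A: "minors n m rb cb A"
  shows "equivalent n m rb cb A B"
proof -
  have Bd: "B x y = A x y" if "x < n" "y < m" for x y using that by (simp add: B)
  have BP: "B x (m + i) = (if i = x then 1 else 0)" if "x < n" "i < n" for x i using that
      by (auto simp: B)
  have BQ: "B (n + j) y = (if j = y then 1 else 0)" if "y < m" "j < m" for j y using that
      by (auto simp: B)
  have "minors n m rb cb B" using A by (simp add: minors_def Bd)
  moreover have "transformed n m A B"
    unfolding transformed_def
  proof (intro allI impI)
    fix x y assume h: "x < n" "y < m"
    have "(\<Sum>i<n. \<Sum>j<m. B x (m + i) * A i j * B (n + j) y) =
        (\<Sum>i<n. \<Sum>j<m. if i = x then (if j = y then A x y else 0) else 0)"
      by (intro sum.cong refl) (auto simp: BP[OF h(1)] BQ[OF h(2)])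
    also have "\<dots> = (\<Sum>i<n. if i = x then A x y else 0)"
      using h(2) by (intro sum.cong refl) auto
    also have "\<dots> = B x y" using h by (simp add: Bd)
    finally show "B x y = (\<Sum>i<n. \<Sum>j<m. B x (m + i) * A i j * B (n + j) y)" by simp
  qed
  moreover have "rows_ok n m rb B"
  proof -
    have "(\<Sum>i<n. B x (m + i) * v i) = v x" if "x < n" for x v
    proof -
      have "(\<Sum>i<n. B x (m + i) * v i) = (\<Sum>i<n. if i = x then v i else 0)"
        by (intro sum.cong refl) (auto simp: BP[OF that])
      then show ?thesis using that by simp
    qed
    then show ?thesis unfolding rows_ok_def by (simp add: BP split: if_splits)
  qed
  moreover have "rows_ok m n cb (swap_args B)"
  proof -
    have "(\<Sum>i<m. B (n + i) x * v i) = v x" if "x < m" for x v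
    proof -
      have "(\<Sum>i<m. B (n + i) x * v i) = (\<Sum>i<m. if i = x then v i else 0)"
        by (intro sum.cong refl) (auto simp: BQ[OF that])
      then show ?thesis using that by simp
    qed
    then show ?thesis unfolding rows_ok_def by (simp add: BQ split: if_splits)
  qed
  ultimately show ?thesis by (simp add: equivalent_def)
qed

text \<open>Distances are stored shifted by 1, so that 0 marks an unreachable row.\<close>

definition dist_upto :: "(nat \<Rightarrow> nat set) \<Rightarrow> nat \<Rightarrow> nat \<Rightarrow> nat" where
  "dist_upto L K r = (if r \<in> L K then Suc (LEAST j. r \<in> L j) else 0)"

lemma dist_upto_le: "dist_upto L K r \<le> Suc K"
  by (auto simp: dist_upto_def intro: Least_le)

lemma dist_upto_eq_0 [simp]: "dist_upto L K r = 0 \<longleftrightarrow> r \<notin> L K" "0 < dist_upto L K r \<longleftrightarrow> r \<in> L K"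
  by (simp_all add: dist_upto_def)

lemma dist_upto_Suc:
  assumes "\<And>k. L k \<subseteq> L (Suc k)"
  shows "dist_upto L (Suc K) r = (if r \<in> L K then dist_upto L K r else if r \<in> L (Suc K) then K +
    2 else 0)"
proof -
  have mono: "j \<le> k \<Longrightarrow> L j \<subseteq> L k" for j k by (rule lift_Suc_mono_le[of L]) (use assms in auto)
  have "(LEAST j. r \<in> L j) = Suc K" if "r \<notin> L K" "r \<in> L (Suc K)"
    using that mono by (intro Least_equality) (auto simp: not_less_eq_eq[symmetric] dest!:
      subsetD[OF mono[of _ K], rotated])
  then show ?thesis using assms[of K] by (auto simp: dist_upto_def)
qed

section \<open>Breadth-first search\<close>

lemma bfs_scan_correct:
  assumes "nvar s ''n'' = n" "nvar s ''s'' = a" "nvar s ''r'' = r" "narr s ''d'' a r = 0"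
  defines "hit z \<equiv> narr s ''d'' a z \<noteq> 0 \<and> narr s ''d'' a z < nvar s ''k'' + 2 \<and>
    farr s ''A'' z (narr s ''mr'' r 0 - 1) \<noteq> 0"
  shows "narr (sem bfs_scan s) ''d'' x y =
    (if x = a \<and> y = r \<and> (\<exists>z<n. hit z) then nvar s ''k'' + 2 else narr s ''d'' x y)"
proof -
  have "\<forall>x y. narr (sem bfs_scan s) ''d'' x y =
    (if x = a \<and> y = r \<and> (\<exists>z<n. hit z) then nvar s ''k'' + 2 else narr s ''d'' x y)"
    unfolding bfs_scan_def
  proof (rule sem_for_rule[where I = "\<lambda>i t. \<forall>x y. narr t ''d'' x y =
      (if x = a \<and> y = r \<and> (\<exists>z<i. hit z) then nvar s ''k'' + 2 else narr s ''d'' x y)"], goal_cases)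
    case (2 i t)
    note fr = framed_simps[OF 2(3)]
    have e: "nvar t ''s'' = a" "nvar t ''r'' = r" "nvar t ''k'' = nvar s ''k''"
        "farr t ''A'' = farr s ''A''" "narr t ''mr'' = narr s ''mr''"
      using fr assms by simp_all
    \<comment> \<open>The scan may already have written cell \<open>r\<close>. Its old value 0 and
      its new value \<open>k + 2\<close> both fail the test, so earlier passes do not influence the
      outcome.\<close>
    have "narr t ''d'' a i \<noteq> 0 \<and> narr t ''d'' a i < nvar s ''k'' + 2 \<longleftrightarrow>
        narr s ''d'' a i \<noteq> 0 \<and> narr s ''d'' a i < nvar s ''k'' + 2"
      using 2(2)[rule_format, of a i] assms(4) by (cases "i = r") simp_all
    then have g: "hit i \<longleftrightarrow> narr t ''d'' a i \<noteq> 0 \<and> narr t ''d'' a i < nvar s ''k'' + 2 \<and>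
        farr s ''A'' i (narr s ''mr'' r 0 - 1) \<noteq> 0" unfolding hit_def by blast
    have ex: "(\<exists>z<Suc i. hit z) \<longleftrightarrow> hit i \<or> (\<exists>z<i. hit z)" by (auto simp: less_Suc_eq)
    show ?case
    proof (cases "hit i")
      case True
      show ?thesis using True[unfolded g] True 2(2) by (simp add: e ex)
    next
      case False
      have "sem (PIf (BAnd (BNot (NEq (NArr ''d'' (NVar ''s'') (NVar ''z'')) (NConst 0)))
          (BAnd (NLess (NArr ''d'' (NVar ''s'') (NVar ''z'')) (NPlus (NVar ''k'') (NConst 2)))
            (BNot (FEq (FArr ''A'' (NVar ''z'') (NMinus (vec_cell ''mr'' (NVar ''r'')) (NConst 1)))
              FZero))))
       (PSetNArr ''d'' (NVar ''s'') (NVar ''r'') (NPlus (NVar ''k'') (NConst 2))) PSkip) (setn ''z''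
         i t) = setn ''z'' i t"
        using False[unfolded g] by (auto simp: e)
      then show ?thesis using 2(2) False by (simp only: ex set_simps) simp
    qed
  qed (use assms in auto)
  then show ?thesis by blast
qed

lemma bfs_round_correct:
  fixes s :: "'a :: field store"
  assumes "nvar s ''n'' = n" "nvar s ''s'' = a" "nvar s ''k'' = K"
    and d: "\<And>r. r < n \<Longrightarrow> narr s ''d'' a r = dist_upto L K r"
    and L: "\<And>k. L k \<subseteq> {..<n}" "\<And>k. L (Suc k) = L k \<union> {r. r < n \<and> narr s ''mr'' r 0 \<noteq> 0 \<and>
      (\<exists>z\<in>L k. farr s ''A'' z (narr s ''mr'' r 0 - 1) \<noteq> 0)}"
  shows "narr (sem bfs_round s) ''d'' x y =
    (if x = a \<and> y < n then dist_upto L (Suc K) y else narr s ''d'' x y)"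
proof -
  have "\<forall>x y. narr (sem bfs_round s) ''d'' x y =
    (if x = a \<and> y < n then dist_upto L (Suc K) y else narr s ''d'' x y)"
    unfolding bfs_round_def
  proof (rule sem_for_rule[where I = "\<lambda>i t. \<forall>x y. narr t ''d'' x y =
      (if x = a \<and> y < i \<and> y < n then dist_upto L (Suc K) y else narr s ''d'' x y)"], goal_cases)
    case (2 i t)
    note fr = framed_simps[OF 2(3)]
    have e: "nvar t ''n'' = n" "nvar t ''s'' = a" "nvar t ''k'' = K" "farr t ''A'' = farr s ''A''"
        "narr t ''mr'' = narr s ''mr''"
      using fr assms by (simp_all add: bfs_scan_def)
    have i: "i < n" using 2(1) assms by simp
    have di: "narr t ''d'' a i = dist_upto L K i" using 2(2) i d by simp
    have S: "dist_upto L (Suc K) r = (if r \<in> L K then dist_upto L K r else if r \<in> L (Suc K) then K +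
        2 else 0)" for r
      by (rule dist_upto_Suc) (simp add: L(2))
    \<comment> \<open>Cells below \<open>i\<close> already belong to the next round, but their new
      entries are \<open>K + 2\<close>. The test still singles out level \<open>K\<close>, so
      updating in place does no harm.\<close>
    have vis: "narr t ''d'' a z \<noteq> 0 \<and> narr t ''d'' a z < K + 2 \<longleftrightarrow> z \<in> L K" if "z < n" for z
      using 2(2)[rule_format, of a z] that d[OF that] dist_upto_le[of L K z]
        by (auto simp: S less_Suc_eq_le split: if_splits)
    show ?case
    proof (cases "i \<in> L K \<or> narr s ''mr'' i 0 = 0")
      case True
      then have "dist_upto L (Suc K) i = dist_upto L K i" by (auto simp: S L(2))
      then show ?thesis using True 2(2) d i di by (auto simp: e less_Suc_eq)
    next
      case False
      have sc: "narr (sem bfs_scan (setn ''r'' i t)) ''d'' x y =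
          (if x = a \<and> y = i \<and> (\<exists>z<n. narr t ''d'' a z \<noteq> 0 \<and> narr t ''d'' a z < K + 2 \<and>
            farr s ''A'' z (narr s ''mr'' i 0 - 1) \<noteq> 0)
           then K + 2 else narr t ''d'' x y)" for x y
      proof -
        have p: "nvar (setn ''r'' i t) ''n'' = n" "nvar (setn ''r'' i t) ''s'' = a"
            "nvar (setn ''r'' i t) ''r'' = i"
          "narr (setn ''r'' i t) ''d'' a i = 0" and k: "nvar (setn ''r'' i t) ''k'' = K"
          using e di False by simp_all
        show ?thesis using bfs_scan_correct[OF p, of x y] unfolding k set_simps(2,4) e .
      qed
      have "(\<exists>z<n. narr t ''d'' a z \<noteq> 0 \<and> narr t ''d'' a z < K + 2 \<and>
          farr s ''A'' z (narr s ''mr'' i 0 - 1) \<noteq> 0) \<longleftrightarrow>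
          (\<exists>z\<in>L K. farr s ''A'' z (narr s ''mr'' i 0 - 1) \<noteq> 0)"
        using vis L(1)[of K] by blast
      also have "\<dots> \<longleftrightarrow> i \<in> L (Suc K)" using False i by (auto simp: L(2))
      finally have "dist_upto L (Suc K) i = (if \<exists>z<n. narr t ''d'' a z \<noteq> 0 \<and> narr t ''d'' a z < K +
        2 \<and> farr s ''A'' z (narr s ''mr'' i 0 - 1) \<noteq> 0
          then K + 2 else 0)"
        using False by (simp add: S)
      then show ?thesis using 2(2) False di i by (auto simp: e sc less_Suc_eq)
    qed
  qed (use assms in auto)
  then show ?thesis by blast
qed

text \<open>One index covers both kinds of search: from a single row \<open>a < n\<close>, or from
  all free rows when \<open>a = n\<close>.\<close>

definition sources :: "nat \<Rightarrow> (nat \<Rightarrow> nat) \<Rightarrow> nat \<Rightarrow> nat set" where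
  "sources n mr a = {r. r < n \<and> (r = a \<or> a = n \<and> mr r = 0)}"

lemma sources_subset: "sources n mr a \<subseteq> {..<n}" by (auto simp: sources_def)

lemma sources_simps [simp]: "sources n mr n = free_rows n mr" "a < n \<Longrightarrow> sources n mr a = {a}"
  by (auto simp: sources_def free_rows_def)

abbreviation vec_of :: "'a store \<Rightarrow> string \<Rightarrow> nat \<Rightarrow> nat" where
  "vec_of s x \<equiv> (\<lambda>r. narr s x r 0)"

lemma bfs_prog_correct:
  fixes s :: "'a :: field store"
  assumes n: "nvar s ''n'' = n" and a: "nvar s ''s'' = a"
  defines "L \<equiv> level n (farr s ''A'') (vec_of s ''mr'') (sources n (vec_of s ''mr'') a)"
  shows "narr (sem bfs_prog s) ''d'' x y = (if x = a \<and> y < n then dist_upto L n y else narr s ''d''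
    x y)"
proof -
  have init: "\<forall>x y. narr (sem bfs_init s) ''d'' x y = (if x = a \<and>
      y < n then dist_upto L 0 y else narr s ''d'' x y)"
    unfolding bfs_init_def
  proof (rule sem_for_rule[where I = "\<lambda>i t. \<forall>x y. narr t ''d'' x y =
      (if x = a \<and> y < i \<and> y < n then dist_upto L 0 y else narr s ''d'' x y)"], goal_cases)
    case (2 i t)
    note fr = framed_simps[OF 2(3)]
    have e: "nvar t ''n'' = n" "nvar t ''s'' = a" "narr t ''mr'' = narr s ''mr''"
      using fr assms by simp_all
    have i: "i < n" using 2(1) n by simp
    have "dist_upto L 0 i = (if i = a \<or> a = n \<and> narr s ''mr'' i 0 = 0 then 1 else 0)"
      using i by (auto simp: dist_upto_def L_def sources_def intro!: Least_equality)
    then show ?case using 2(2) i by (auto simp: e less_Suc_eq)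
  qed (use n in auto)
  let ?s = "sem bfs_init s"
  have e: "nvar ?s ''n'' = n" "nvar ?s ''s'' = a" "narr ?s ''mr'' = narr s ''mr''"
      "farr ?s ''A'' = farr s ''A''"
    using assms by (simp_all add: frame bfs_init_def del: sem.simps)
  have "\<forall>x y. narr (sem (PFor ''k'' nN bfs_round) ?s) ''d'' x y = (if x = a \<and>
      y < n then dist_upto L n y else narr s ''d'' x y)"
  proof (rule sem_for_rule[where I = "\<lambda>i t. \<forall>x y. narr t ''d'' x y =
      (if x = a \<and> y < n then dist_upto L i y else narr s ''d'' x y)"], goal_cases)
    case (2 i t)
    note fr = framed_simps[OF 2(3)]
    have e': "nvar t ''n'' = n" "nvar t ''s'' = a" "narr t ''mr'' = narr s ''mr''"
        "farr t ''A'' = farr s ''A''"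
      using fr e by (simp_all add: bfs_round_def bfs_scan_def)
    show ?case
      using bfs_round_correct[of "setn ''k'' i t" n a i L] 2(2) e'
        level_subset[OF sources_subset, of n "farr s ''A''" "vec_of s ''mr''"]
      by (simp add: L_def)
  qed (use init e in auto)
  then show ?thesis by (simp add: bfs_prog_def del: sem.simps(8))
qed

section \<open>Finding a closest free column\<close>

abbreviation hits :: "'a :: field store \<Rightarrow> nat \<Rightarrow> nat \<Rightarrow> bool" where
  "hits s r c \<equiv> narr s ''mc'' c 0 = 0 \<and> farr s ''A'' r c \<noteq> 0"

lemma find_cols_correct:
  fixes s :: "'a :: field store"
  assumes m: "nvar s ''m'' = m"
  defines "s' \<equiv> sem find_cols s"
  shows "nvar s ''found'' = 1 \<Longrightarrow> nvar s' ''found'' = 1 \<and> nvar s' ''pr'' = nvar s ''pr'' \<and>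
    nvar s' ''pc'' = nvar s ''pc''"
    and "nvar s ''found'' = 0 \<Longrightarrow>
      nvar s' ''found'' = 0 \<and> (narr s ''d'' (nvar s ''s'') (nvar s ''r'') = Suc (nvar s ''k'') \<longrightarrow>
        \<not> (\<exists>c<m. hits s (nvar s ''r'') c)) \<or>
      nvar s' ''found'' = 1 \<and> nvar s' ''pr'' = nvar s ''r'' \<and> nvar s' ''pc'' < m \<and>
        hits s (nvar s ''r'') (nvar s' ''pc'') \<and> narr s ''d'' (nvar s ''s'') (nvar s ''r'') =
          Suc (nvar s ''k'')"
proof -
  let ?r = "nvar s ''r''" and ?at = "narr s ''d'' (nvar s ''s'') (nvar s ''r'') =
    Suc (nvar s ''k'')"
  show "nvar s' ''found'' = 1 \<and> nvar s' ''pr'' = nvar s ''pr'' \<and> nvar s' ''pc'' = nvar s ''pc''"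
    if "nvar s ''found'' = 1"
    unfolding s'_def find_cols_def
  proof (rule sem_for_rule[where I = "\<lambda>i t. nvar t ''found'' = 1 \<and> nvar t ''pr'' = nvar s ''pr'' \<and>
    nvar t ''pc'' = nvar s ''pc''"], goal_cases)
    case (2 i t)
    then show ?case by simp
  qed (use that in auto)
  show "nvar s' ''found'' = 0 \<and> (?at \<longrightarrow> \<not> (\<exists>c<m. hits s ?r c)) \<or>
      nvar s' ''found'' = 1 \<and> nvar s' ''pr'' = ?r \<and> nvar s' ''pc'' < m \<and>
        hits s ?r (nvar s' ''pc'') \<and> ?at"
    if f0: "nvar s ''found'' = 0"
    unfolding s'_def find_cols_def
  proof (rule sem_for_rule[where I = "\<lambda>i t. nvar t ''found'' = 0 \<and> (?at \<longrightarrow> (\<forall>c<i. \<not> hits s ?r c)) \<or>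
      nvar t ''found'' = 1 \<and> nvar t ''pr'' = ?r \<and> nvar t ''pc'' < m \<and> hits s ?r (nvar t ''pc'') \<and>
        ?at"], goal_cases)
    case (2 i t)
    note fr = framed_simps[OF 2(3)]
    have e: "nvar t ''s'' = nvar s ''s''" "nvar t ''r'' = ?r" "nvar t ''k'' = nvar s ''k''"
        "narr t ''d'' = narr s ''d''"
      "farr t ''A'' = farr s ''A''" "narr t ''mc'' = narr s ''mc''"
      using fr by simp_all
    have i: "i < m" using 2(1) m by simp
    show ?case
    proof (cases "nvar t ''found'' = 0 \<and> ?at \<and> hits s ?r i")
      case True
      then show ?thesis using i by (simp add: e)
    next
      case False
      have g: "bval (BAnd (NEq (NVar ''found'') (NConst 0)) (BAnd (NEq (NArr ''d'' (NVar ''s'')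
          (NVar ''r'')) (NSuc (NVar ''k'')))
         (BAnd (NEq (vec_cell ''mc'' (NVar ''c'')) (NConst 0)) (BNot (FEq (FArr ''A'' (NVar ''r'')
           (NVar ''c'')) FZero)))))
         (setn ''c'' i t) \<longleftrightarrow> False"
        using False by (auto simp: e)
      have nt: "nvar (setn ''c'' i t) ''found'' = nvar t ''found''"
          "nvar (setn ''c'' i t) ''pr'' = nvar t ''pr''"
        "nvar (setn ''c'' i t) ''pc'' = nvar t ''pc''" by simp_all
      have "(\<forall>c<Suc i. \<not> hits s ?r c) \<longleftrightarrow> (\<forall>c<i. \<not> hits s ?r c) \<and> \<not> hits s ?r i"
          by (auto simp: less_Suc_eq)
      then show ?thesis
        using 2(2) False unfolding sem.simps g if_False nt by blast
    qed
  qed (use f0 m in auto)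
qed

lemma find_prog_correct:
  fixes s :: "'a :: field store" and n a :: nat
  assumes n: "nvar s ''n'' = n" and m: "nvar s ''m'' = m" and a: "nvar s ''s'' = a"
    and L: "\<And>k. L k \<subseteq> L (Suc k)" "\<And>k. L k \<subseteq> {..<n}"
    and d: "\<And>r. r < n \<Longrightarrow> narr s ''d'' a r = dist_upto L n r"
  defines "s' \<equiv> sem find_prog s" and "B \<equiv> farr s ''A''" and "mc \<equiv> vec_of s ''mc''"
  shows "nvar s' ''found'' = 0 \<and> \<not> exposes m B mc (L n) \<or>
    nvar s' ''found'' = 1 \<and> nvar s' ''pr'' < n \<and> nvar s' ''pc'' < m \<and>
      hits s (nvar s' ''pr'') (nvar s' ''pc'') \<and>
      (\<exists>k. nvar s' ''pr'' \<in> L k \<and> (\<forall>j<k. \<not> exposes m B mc (L j)))"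
proof -
  define found where "found t \<longleftrightarrow> nvar t ''found'' = 1 \<and> nvar t ''pr'' < n \<and> nvar t ''pc'' < m \<and>
    hits s (nvar t ''pr'') (nvar t ''pc'') \<and> (\<exists>k. nvar t ''pr'' \<in> L k \<and>
      (\<forall>j<k. \<not> exposes m B mc (L j)))" for t :: "'a store"
  let ?s = "setn ''found'' 0 s"
  have dist: "r \<in> L k" if "narr s ''d'' a r = Suc k" "r < n" for r k
  proof -
    have "r \<in> L n" "k = (LEAST j. r \<in> L j)" using that d[OF that(2)]
        by (auto simp: dist_upto_def split: if_splits)
    then show ?thesis by (metis LeastI)
  qed
  have distL: "narr s ''d'' a r = Suc k" if r: "r \<in> L k" "k \<le> n" "\<And>j. j < k \<Longrightarrow> r \<notin> L j" for r k
  proof -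
    have "(LEAST j. r \<in> L j) = k" using r(1,3) by (intro Least_equality) (auto simp:
        not_less[symmetric])
    moreover have "r \<in> L n" using lift_Suc_mono_le[of L k n] L(1) r(1,2) by blast
    moreover have "r < n" using r(1) L(2) by blast
    ultimately show ?thesis using d by (simp add: dist_upto_def)
  qed
  have "nvar (sem (PFor ''k'' (NSuc nN) find_rows) ?s) ''found'' = 0 \<and> \<not> exposes m B mc (L n) \<or>
      found (sem (PFor ''k'' (NSuc nN) find_rows) ?s)"
  proof (rule sem_for_rule[where I = "\<lambda>k t. nvar t ''found'' = 0 \<and> (\<forall>j<k. \<not> exposes m B mc (L j)) \<or>
    found t"], goal_cases)
    case (2 k t)
    note fr = framed_simps[OF 2(3)]
    have e: "nvar t ''n'' = n" "nvar t ''m'' = m" "nvar t ''s'' = a" "narr t ''d'' = narr s ''d''"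
      "farr t ''A'' = farr s ''A''" "narr t ''mc'' = narr s ''mc''"
      using fr n m a by (simp_all add: find_rows_def find_cols_def)
    have k: "k \<le> n" using 2(1) n by simp
    show ?case unfolding find_rows_def
    proof (rule sem_for_rule[where I = "\<lambda>i u. nvar u ''found'' = 0 \<and>
      (\<forall>j<k. \<not> exposes m B mc (L j)) \<and>
        (\<forall>r<i. narr s ''d'' a r = Suc k \<longrightarrow> \<not> (\<exists>c<m. hits s r c)) \<or> found u"], goal_cases)
      case 1
      then show ?case using 2(2) by (auto simp: found_def)
    next
      case (2 i u)
      note fr2 = framed_simps[OF 2(3)]
      have e2: "nvar u ''m'' = m" "nvar u ''s'' = a" "narr u ''d'' = narr s ''d''"
          "nvar u ''k'' = k"
        "farr u ''A'' = farr s ''A''" "narr u ''mc'' = narr s ''mc''"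
        using fr2 e by (simp_all add: find_cols_def)
      have i: "i < n" using 2(1) e by simp
      let ?u = "setn ''r'' i u"
      have um: "nvar ?u ''m'' = m" using e2 by simp
      note c1 = find_cols_correct(1)[OF um] and c2 = find_cols_correct(2)[OF um]
      show ?case
      proof (cases "found u")
        case True
        then show ?thesis using c1 by (simp add: found_def)
      next
        case False
        then have I: "nvar u ''found'' = 0" "\<forall>j<k. \<not> exposes m B mc (L j)"
            "\<forall>r<i. narr s ''d'' a r = Suc k \<longrightarrow> \<not> (\<exists>c<m. hits s r c)" using 2(2) by auto
        have "nvar ?u ''found'' = 0" using I(1) by simp
        from c2[OF this] have "nvar (sem find_cols ?u) ''found'' = 0 \<and> (narr s ''d'' a i = Suc k \<longrightarrow>
          \<not> (\<exists>c<m. hits s i c)) \<or>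
            nvar (sem find_cols ?u) ''found'' = 1 \<and> nvar (sem find_cols ?u) ''pr'' = i \<and>
              nvar (sem find_cols ?u) ''pc'' < m \<and>
            hits s i (nvar (sem find_cols ?u) ''pc'') \<and> narr s ''d'' a i = Suc k"
          by (simp add: e2)
        then show ?thesis
        proof
          assume "nvar (sem find_cols ?u) ''found'' = 0 \<and> (narr s ''d'' a i = Suc k \<longrightarrow>
              \<not> (\<exists>c<m. hits s i c))"
          then show ?thesis using I by (auto simp: less_Suc_eq)
        next
          assume h: "nvar (sem find_cols ?u) ''found'' = 1 \<and> nvar (sem find_cols ?u) ''pr'' = i \<and>
              nvar (sem find_cols ?u) ''pc'' < m \<and>
            hits s i (nvar (sem find_cols ?u) ''pc'') \<and> narr s ''d'' a i = Suc k"
          then have "i \<in> L k" using dist i by blast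
          then have "found (sem find_cols ?u)" using h i I(2) unfolding found_def by auto
          then show ?thesis ..
        qed
      qed
    next
      case (3 u)
      show ?case
      proof (cases "found u")
        case True
        then show ?thesis by (simp add: found_def)
      next
        case False
        then have I: "nvar u ''found'' = 0" "\<forall>j<k. \<not> exposes m B mc (L j)"
            "\<forall>r<n. narr s ''d'' a r = Suc k \<longrightarrow> \<not> (\<exists>c<m. hits s r c)" using 3(1) e by auto
        \<comment> \<open>A row of level \<open>k\<close> with a hit cannot occur lower, where
          nothing is exposed. Its stored distance is then exactly \<open>k + 1\<close>, and the pass
          for \<open>k\<close> would have found it.\<close>
        have "\<not> exposes m B mc (L k)"
        proof
          assume "exposes m B mc (L k)"
          then obtain r c where rc: "r \<in> L k" "c < m" "hits s r c"
            by (auto simp: exposes_def mc_def B_def)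
          then have "r \<notin> L j" if "j < k" for j using I(2) that unfolding exposes_def mc_def B_def
            by blast
          then have "narr s ''d'' a r = Suc k" using distL rc(1) k by blast
          moreover have "r < n" using L(2) rc(1) by blast
          ultimately show False using I(3) rc(2,3) by blast
        qed
        then show ?thesis using I(1,2) by (auto simp: less_Suc_eq)
      qed
    qed
  next
    case (3 t)
    then show ?case by (auto simp: n found_def)
  qed simp
  then show ?thesis by (simp add: s'_def find_prog_def found_def del: sem.simps(8))
qed

section \<open>Elimination in place\<close>

lemma elim_row_prog_correct:
  fixes s :: "'a :: field store"
  assumes n: "nvar s ''n'' = n" and m: "nvar s ''m'' = m" and ne: "nvar s ''x'' \<noteq> nvar s ''pr''"
  shows "farr (sem elim_row_prog s) ''A'' x y =
    (if x = nvar s ''x'' \<and> y < m + n then farr s ''A'' x y - fvar s ''f'' * farr s ''A'' (nvar s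
      ''pr'') y else farr s ''A'' x y)"
proof -
  have "\<forall>x y. farr (sem elim_row_prog s) ''A'' x y =
    (if x = nvar s ''x'' \<and> y < m + n then farr s ''A'' x y - fvar s ''f'' * farr s ''A'' (nvar s
      ''pr'') y else farr s ''A'' x y)"
    unfolding elim_row_prog_def
  proof (rule sem_for_rule[where I = "\<lambda>i t. fvar t ''f'' = fvar s ''f'' \<and> (\<forall>x y. farr t ''A'' x y =
      (if x = nvar s ''x'' \<and> y < i then farr s ''A'' x y - fvar s ''f'' * farr s ''A'' (nvar s
        ''pr'') y else farr s ''A'' x y))"], goal_cases)
    case (2 i t)
    note fr = framed_simps[OF 2(3)]
    have e: "nvar t ''x'' = nvar s ''x''" "nvar t ''pr'' = nvar s ''pr''" using fr by simp_all
    show ?case using 2(2) ne by (simp add: e less_Suc_eq)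
  qed (use n m in auto)
  then show ?thesis by blast
qed

lemma elim_col_prog_correct:
  fixes s :: "'a :: field store"
  assumes n: "nvar s ''n'' = n" and m: "nvar s ''m'' = m" and ne: "nvar s ''x'' \<noteq> nvar s ''pc''"
  shows "farr (sem elim_col_prog s) ''A'' y x =
    (if x = nvar s ''x'' \<and> y < n + m then farr s ''A'' y x - fvar s ''f'' * farr s ''A'' y (nvar s
      ''pc'') else farr s ''A'' y x)"
proof -
  have "\<forall>x y. farr (sem elim_col_prog s) ''A'' y x =
    (if x = nvar s ''x'' \<and> y < n + m then farr s ''A'' y x - fvar s ''f'' * farr s ''A'' y (nvar s
      ''pc'') else farr s ''A'' y x)"
    unfolding elim_col_prog_def
  proof (rule sem_for_rule[where I = "\<lambda>i t. fvar t ''f'' = fvar s ''f'' \<and> (\<forall>x y. farr t ''A'' y x =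
      (if x = nvar s ''x'' \<and> y < i then farr s ''A'' y x - fvar s ''f'' * farr s ''A'' y (nvar s
        ''pc'') else farr s ''A'' y x))"], goal_cases)
    case (2 i t)
    note fr = framed_simps[OF 2(3)]
    have e: "nvar t ''x'' = nvar s ''x''" "nvar t ''pc'' = nvar s ''pc''" using fr by simp_all
    show ?case using 2(2) ne by (simp add: e less_Suc_eq)
  qed (use n m in auto)
  then show ?thesis by blast
qed

lemma elim_rows_prog_correct:
  fixes s :: "'a :: field store"
  assumes n: "nvar s ''n'' = n" and m: "nvar s ''m'' = m"
  shows "farr (sem elim_rows_prog s) ''A'' =
    elim_rows n m (vec_of s ''rb'') (nvar s ''pr'') (nvar s ''pc'') (farr s ''A'')"
proof -
  let ?B = "farr s ''A''" and ?r = "nvar s ''pr''" and ?c = "nvar s ''pc''" and ?rb =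
    "vec_of s ''rb''"
  let ?T = "elim_rows n m ?rb ?r ?c ?B"
  have T: "?T x y = (if x < n \<and> y < m + n \<and> x \<noteq> ?r \<and> ?rb x =
      ?rb ?r then ?B x y - ?B x ?c / ?B ?r ?c * ?B ?r y else ?B x y)" for x y
    by (simp add: elim_rows_def rowop_def elim_coeff_def)
  have "\<forall>x y. farr (sem elim_rows_prog s) ''A'' x y = ?T x y"
    unfolding elim_rows_prog_def
  proof (rule sem_for_rule[where I = "\<lambda>i t. \<forall>x y. farr t ''A'' x y =
    (if x < i then ?T x y else ?B x y)"], goal_cases)
    case (2 i t)
    note fr = framed_simps[OF 2(3)]
    have e: "nvar t ''n'' = n" "nvar t ''m'' = m" "nvar t ''pr'' = ?r" "nvar t ''pc'' = ?c"
        "narr t ''rb'' = narr s ''rb''"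
      using fr n m by (simp_all add: elim_row_prog_def)
    have i: "i < n" using 2(1) n by simp
    \<comment> \<open>The pivot row itself is never modified, so passes after it still read its
      original entries.\<close>
    have rt: "farr t ''A'' ?r y = ?B ?r y" for y using 2(2) by (simp add: T)
    have it: "farr t ''A'' i y = ?B i y" for y using 2(2) by simp
    show ?case
    proof (cases "i \<noteq> ?r \<and> ?rb i = ?rb ?r")
      case True
      let ?t = "setf ''f'' (?B i ?c / ?B ?r ?c) (setn ''x'' i t)"
      have p: "nvar ?t ''n'' = n" "nvar ?t ''m'' = m" "nvar ?t ''x'' \<noteq> nvar ?t ''pr''" using e True
          by simp_all
      show ?thesis
      proof (intro allI)
        fix x y
        have "farr (sem elim_row_prog ?t) ''A'' x y = (if x < Suc i then ?T x y else ?B x y)"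
          unfolding elim_row_prog_correct[OF p] using 2(2)[rule_format, of x y] True i rt it
          by (auto simp: e T less_Suc_eq)
        then show "farr (sem (PIf (BAnd (BNot (NEq (NVar ''x'') (NVar ''pr''))) (NEq (vec_cell
          ''rb'' (NVar ''x'')) (vec_cell ''rb'' (NVar ''pr''))))
           (PSetF ''f'' (FDiv (FArr ''A'' (NVar ''x'') (NVar ''pc'')) (FArr ''A'' (NVar ''pr'')
             (NVar ''pc''))) ;; elim_row_prog)
           PSkip) (setn ''x'' i t)) ''A'' x y = (if x < Suc i then ?T x y else ?B x y)"
          using True by (simp add: e rt it)
      qed
    next
      case False
      have Ti: "?T i y = ?B i y" for y using False by (auto simp: T)
      have g: "bval (BAnd (BNot (NEq (NVar ''x'') (NVar ''pr''))) (NEq (vec_cell ''rb'' (NVar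
          ''x'')) (vec_cell ''rb'' (NVar ''pr'')))) (setn ''x'' i t) = False"
        using False by (auto simp: e)
      show ?thesis unfolding sem.simps g if_False using 2(2) Ti by (auto simp: less_Suc_eq)
    qed
  next
    case (3 t)
    have "?T x y = ?B x y" if "\<not> x < n" for x y using that by (simp add: T)
    then show ?case using 3(1) n by simp
  qed simp
  then show ?thesis by blast
qed

lemma elim_cols_prog_correct:
  fixes s :: "'a :: field store"
  assumes n: "nvar s ''n'' = n" and m: "nvar s ''m'' = m"
  shows "farr (sem elim_cols_prog s) ''A'' =
    swap_args (elim_rows m n (vec_of s ''cb'') (nvar s ''pc'') (nvar s ''pr'') (swap_args (farr s
      ''A'')))"
proof -
  let ?B = "farr s ''A''" and ?r = "nvar s ''pr''" and ?c = "nvar s ''pc''" and ?cb =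
    "vec_of s ''cb''"
  let ?T = "swap_args (elim_rows m n ?cb ?c ?r (swap_args ?B))"
  have T: "?T y x = (if x < m \<and> y < n + m \<and> x \<noteq> ?c \<and> ?cb x =
      ?cb ?c then ?B y x - ?B ?r x / ?B ?r ?c * ?B y ?c else ?B y x)" for x y
    by (simp add: elim_rows_def rowop_def elim_coeff_def)
  have "\<forall>x y. farr (sem elim_cols_prog s) ''A'' y x = ?T y x"
    unfolding elim_cols_prog_def
  proof (rule sem_for_rule[where I = "\<lambda>i t. \<forall>x y. farr t ''A'' y x =
    (if x < i then ?T y x else ?B y x)"], goal_cases)
    case (2 i t)
    note fr = framed_simps[OF 2(3)]
    have e: "nvar t ''n'' = n" "nvar t ''m'' = m" "nvar t ''pr'' = ?r" "nvar t ''pc'' = ?c"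
        "narr t ''cb'' = narr s ''cb''"
      using fr n m by (simp_all add: elim_col_prog_def)
    have i: "i < m" using 2(1) m by simp
    have rt: "farr t ''A'' y ?c = ?B y ?c" for y using 2(2) by (simp add: T del: swap_args_simps)
    have it: "farr t ''A'' y i = ?B y i" for y using 2(2) by simp
    show ?case
    proof (cases "i \<noteq> ?c \<and> ?cb i = ?cb ?c")
      case True
      let ?t = "setf ''f'' (?B ?r i / ?B ?r ?c) (setn ''x'' i t)"
      have p: "nvar ?t ''n'' = n" "nvar ?t ''m'' = m" "nvar ?t ''x'' \<noteq> nvar ?t ''pc''" using e True
          by simp_all
      show ?thesis
      proof (intro allI)
        fix x y
        have "farr (sem elim_col_prog ?t) ''A'' y x = (if x < Suc i then ?T y x else ?B y x)"
          unfolding elim_col_prog_correct[OF p] using 2(2)[rule_format, of y x] True i rt it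
          by (auto simp: e T less_Suc_eq simp del: swap_args_simps)
        then show "farr (sem (PIf (BAnd (BNot (NEq (NVar ''x'') (NVar ''pc''))) (NEq (vec_cell
          ''cb'' (NVar ''x'')) (vec_cell ''cb'' (NVar ''pc''))))
           (PSetF ''f'' (FDiv (FArr ''A'' (NVar ''pr'') (NVar ''x'')) (FArr ''A'' (NVar ''pr'')
             (NVar ''pc''))) ;; elim_col_prog)
           PSkip) (setn ''x'' i t)) ''A'' y x = (if x < Suc i then ?T y x else ?B y x)"
          using True by (simp add: e rt it del: swap_args_simps)
      qed
    next
      case False
      have Ti: "?T y i = ?B y i" for y using False by (auto simp: T simp del: swap_args_simps)
      have g: "bval (BAnd (BNot (NEq (NVar ''x'') (NVar ''pc''))) (NEq (vec_cell ''cb'' (NVar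
          ''x'')) (vec_cell ''cb'' (NVar ''pc'')))) (setn ''x'' i t) = False"
        using False by (auto simp: e)
      show ?thesis unfolding sem.simps g if_False using 2(2) Ti
          by (auto simp: less_Suc_eq simp del: swap_args_simps)
    qed
  next
    case (3 t)
    have "?T y x = ?B y x" if "\<not> x < m" for x y using that by (simp add: T del: swap_args_simps)
    then show ?case using 3(1) m by (simp del: swap_args_simps)
  qed simp
  then show ?thesis by blast
qed

section \<open>The matching loop\<close>

definition good_state where
  "good_state n m rb cb A s \<longleftrightarrow> nvar s ''n'' = n \<and> nvar s ''m'' = m \<and> vec_of s ''rb'' = rb \<and>
    vec_of s ''cb'' = cb \<and>
     normalized n m rb cb A (farr s ''A'') (vec_of s ''mr'') (vec_of s ''mc'')"

definition exposed_at :: "nat \<Rightarrow> nat \<Rightarrow> 'a :: field store \<Rightarrow> nat \<Rightarrow> bool" where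
  "exposed_at n m s k \<longleftrightarrow> exposes m (farr s ''A'') (vec_of s ''mc'')
     (level n (farr s ''A'') (vec_of s ''mr'') (free_rows n (vec_of s ''mr'')) k)"

lemma rematch_prog_correct:
  fixes s :: "'a :: field store"
  defines "s' \<equiv> sem rematch_prog s"
  shows "vec_of s' ''mr'' = (vec_of s ''mr'')(nvar s ''pr'' := Suc (nvar s ''pc''))"
    and "vec_of s' ''mc'' = rematch_col (nvar s ''pr'') (nvar s ''pc'') (vec_of s ''mr'') (vec_of s
      ''mc'')"
  by (auto simp: s'_def rematch_prog_def rematch_col_def fun_eq_iff)

text \<open>The third part holds for every exposing level \<open>k\<close>: the pivot is made at
  some level \<open>dd \<le> k\<close>, and levels grow with their index. The caller can therefore
  count down from \<open>n\<close> without knowing the distance.\<close>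

lemma step_prog_correct:
  fixes s :: "'a :: field store"
  assumes gs: "good_state n m rb cb A s"
  defines "s' \<equiv> sem step_prog s"
  shows "good_state n m rb cb A s'"
    and "\<not> exposed_at n m s n \<Longrightarrow> \<not> exposed_at n m s' n \<and> free_rows n (vec_of s' ''mr'') =
      free_rows n (vec_of s ''mr'')"
    and "exposed_at n m s k \<Longrightarrow> card (free_rows n (vec_of s' ''mr'')) < card (free_rows n (vec_of s
      ''mr'')) \<or>
      free_rows n (vec_of s' ''mr'') = free_rows n (vec_of s ''mr'') \<and> k > 0 \<and>
        exposed_at n m s' (k - 1)"
proof -
  define s1 where "s1 = sem bfs_prog (setn ''s'' n s)"
  define s2 where "s2 = sem find_prog s1"
  define B where "B = farr s ''A''"
  define mr where "mr = vec_of s ''mr''"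
  define mc where "mc = vec_of s ''mc''"
  define L where "L = level n B mr (free_rows n mr)"
  have s0: "nvar s ''n'' = n" "nvar s ''m'' = m" "vec_of s ''rb'' = rb" "vec_of s ''cb'' = cb"
    and nf: "normalized n m rb cb A B mr mc"
    using gs by (auto simp: good_state_def B_def mr_def mc_def)
  have s': "s' = (if nvar s2 ''found'' = 0 then s2 else sem elim_cols_prog (sem elim_rows_prog (sem
      rematch_prog s2)))"
    using s0 by (simp add: s'_def step_prog_def s1_def s2_def)
  have f1: "nvar s1 ''n'' = n" "nvar s1 ''m'' = m" "nvar s1 ''s'' = n"
    "narr s1 ''rb'' = narr s ''rb''" "narr s1 ''cb'' = narr s ''cb''"
      "narr s1 ''mr'' = narr s ''mr''"
    "narr s1 ''mc'' = narr s ''mc''" "farr s1 ''A'' = B"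
    using s0 by (simp_all add: s1_def frame loop_defs B_def del: sem.simps)
  have f2: "nvar s2 ''n'' = n" "nvar s2 ''m'' = m"
    "narr s2 ''rb'' = narr s ''rb''" "narr s2 ''cb'' = narr s ''cb''"
      "narr s2 ''mr'' = narr s ''mr''"
    "narr s2 ''mc'' = narr s ''mc''" "farr s2 ''A'' = B"
    using f1 by (simp_all add: s2_def frame loop_defs del: sem.simps)
  have d: "narr s1 ''d'' n r = dist_upto L n r" if "r < n" for r
  proof -
    have p: "nvar (setn ''s'' n s) ''n'' = n" "nvar (setn ''s'' n s) ''s'' = n" using s0 by simp_all
    show ?thesis using bfs_prog_correct[OF p, of n r] that
      by (simp add: s1_def L_def B_def mr_def)
  qed
  have Ln: "L k \<subseteq> {..<n}" for k unfolding L_def by (rule level_subset) (auto simp: free_rows_def)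
  have Ls: "L k \<subseteq> L (Suc k)" for k by (auto simp: L_def)
  have fp: "nvar s2 ''found'' = 0 \<and> \<not> exposes m B mc (L n) \<or>
    nvar s2 ''found'' = 1 \<and> nvar s2 ''pr'' < n \<and> nvar s2 ''pc'' < m \<and>
      (mc (nvar s2 ''pc'') = 0 \<and> B (nvar s2 ''pr'') (nvar s2 ''pc'') \<noteq> 0) \<and>
      (\<exists>k. nvar s2 ''pr'' \<in> L k \<and> (\<forall>j<k. \<not> exposes m B mc (L j)))"
    using find_prog_correct[OF f1(1-3) Ls Ln d] f1
    by (simp add: s2_def[symmetric] mc_def L_def)
  have ex: "exposed_at n m s k \<longleftrightarrow> exposes m B mc (L k)" for k
    by (simp add: exposed_at_def B_def mr_def mc_def L_def)
  have mono: "L j \<subseteq> L k" if "j \<le> k" for j k unfolding L_def by (rule level_mono[OF that])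
  have "L k \<subseteq> L n" for k unfolding L_def by (rule level_stable) (auto simp: free_rows_def)
  then have exn: "exposes m B mc (L n)" if "exposes m B mc (L k)" for k
    using that unfolding exposes_def by blast
  have main: "good_state n m rb cb A s' \<and>
     (\<not> exposes m B mc (L n) \<longrightarrow> \<not> exposed_at n m s' n \<and> free_rows n (vec_of s' ''mr'') =
       free_rows n mr) \<and>
     (\<forall>k. exposes m B mc (L k) \<longrightarrow> card (free_rows n (vec_of s' ''mr'')) < card (free_rows n mr) \<or>
        free_rows n (vec_of s' ''mr'') = free_rows n mr \<and> k > 0 \<and> exposed_at n m s' (k - 1))"
    using fp
  proof
    assume f0: "nvar s2 ''found'' = 0 \<and> \<not> exposes m B mc (L n)"
    then have e: "s' = s2" by (simp add: s')
    have "good_state n m rb cb A s2"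
      using f2 s0 nf by (simp add: good_state_def B_def mr_def mc_def)
    moreover have "exposed_at n m s2 n \<longleftrightarrow> exposes m B mc (L n)" "vec_of s2 ''mr'' = mr"
      using f2 by (simp_all add: exposed_at_def mr_def mc_def L_def)
    ultimately show ?thesis using f0 exn unfolding e by auto
  next
    assume h: "nvar s2 ''found'' = 1 \<and> nvar s2 ''pr'' < n \<and> nvar s2 ''pc'' < m \<and>
      (mc (nvar s2 ''pc'') = 0 \<and> B (nvar s2 ''pr'') (nvar s2 ''pc'') \<noteq> 0) \<and>
      (\<exists>k. nvar s2 ''pr'' \<in> L k \<and> (\<forall>j<k. \<not> exposes m B mc (L j)))"
    define r where "r = nvar s2 ''pr''"
    define c where "c = nvar s2 ''pc''"
    have rc: "r < n" "c < m" "mc c = 0" "B r c \<noteq> 0" using h by (auto simp: r_def c_def)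
    obtain dd where dd: "r \<in> L dd" "\<And>j. j < dd \<Longrightarrow> \<not> exposes m B mc (L j)" using h
      by (auto simp: r_def)
    define s3 where "s3 = sem rematch_prog s2"
    define s4 where "s4 = sem elim_rows_prog s3"
    have s5: "s' = sem elim_cols_prog s4" using h by (simp add: s' s3_def s4_def)
    have f3: "nvar s3 ''n'' = n" "nvar s3 ''m'' = m" "nvar s3 ''pr'' = r" "nvar s3 ''pc'' = c"
      "narr s3 ''rb'' = narr s ''rb''" "narr s3 ''cb'' = narr s ''cb''" "farr s3 ''A'' = B"
      using f2 by (simp_all add: s3_def r_def c_def frame loop_defs del: sem.simps)
    have m3: "vec_of s3 ''mr'' = mr(r := Suc c)" "vec_of s3 ''mc'' = rematch_col r c mr mc"
      using rematch_prog_correct[of s2] f2 by (simp_all add: s3_def r_def c_def mr_def mc_def)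
    have f4: "nvar s4 ''n'' = n" "nvar s4 ''m'' = m" "nvar s4 ''pr'' = r" "nvar s4 ''pc'' = c"
      "narr s4 ''rb'' = narr s ''rb''" "narr s4 ''cb'' = narr s ''cb''"
        "narr s4 ''mr'' = narr s3 ''mr''" "narr s4 ''mc'' = narr s3 ''mc''"
      using f3 by (simp_all add: s4_def frame loop_defs del: sem.simps)
    have A4: "farr s4 ''A'' = elim_rows n m rb r c B"
      using elim_rows_prog_correct[OF f3(1,2)] f3 s0 by (simp add: s4_def)
    have f5: "nvar s' ''n'' = n" "nvar s' ''m'' = m"
      "narr s' ''rb'' = narr s ''rb''" "narr s' ''cb'' = narr s ''cb''"
        "narr s' ''mr'' = narr s3 ''mr''" "narr s' ''mc'' = narr s3 ''mc''"
      using f4 by (simp_all add: s5 frame loop_defs del: sem.simps)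
    have A5: "farr s' ''A'' = pivot n m rb cb r c B"
      using elim_cols_prog_correct[OF f4(1,2)] f4 s0 A4 by (simp add: s5 pivot_def)
    have g: "good_state n m rb cb A s'"
      using normalized_pivot[OF nf rc] f5 s0 A5 m3 by (simp add: good_state_def)
    have ex': "exposed_at n m s' k \<longleftrightarrow> exposes m (pivot n m rb cb r c B) (rematch_col r c mr mc)
        (level n (pivot n m rb cb r c B) (mr(r := Suc c)) (free_rows n (mr(r := Suc c))) k)" for k
      using f5 m3 by (simp add: exposed_at_def A5)
    have mr5: "vec_of s' ''mr'' = mr(r := Suc c)" using f5 m3 by simp
    have mt: "matching n m mr mc" using nf by (simp add: normalized_def)
    have pp: "card (free_rows n (mr(r := Suc c))) < card (free_rows n mr) \<or>
        free_rows n (mr(r := Suc c)) = free_rows n mr \<and> dd > 0 \<and> exposed_at n m s' (dd - 1)"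
      unfolding ex' using pivot_progress[OF mt dd(1)[unfolded L_def] rc(2,3,4)] dd(2)
        unfolding L_def by blast
    have "exposes m B mc (L dd)" using dd(1) rc by (auto simp: exposes_def)
    then have exnn: "exposes m B mc (L n)" by (rule exn)
    have "card (free_rows n (vec_of s' ''mr'')) < card (free_rows n mr) \<or>
        free_rows n (vec_of s' ''mr'') = free_rows n mr \<and> k > 0 \<and> exposed_at n m s' (k - 1)"
      if "exposes m B mc (L k)" for k
      using pp
    proof
      assume *: "free_rows n (mr(r := Suc c)) = free_rows n mr \<and> dd > 0 \<and>
          exposed_at n m s' (dd - 1)"
      have "dd \<le> k" using dd(2) that by (meson not_less)
      then have "dd - 1 \<le> k - 1" by simp
      from level_mono[OF this] * have "exposed_at n m s' (k - 1)"
        unfolding ex' exposes_def by blast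
      then show ?thesis using * \<open>dd \<le> k\<close> mr5 by simp
    qed (simp add: mr5)
    then show ?thesis using g exnn by blast
  qed
  then show "good_state n m rb cb A s'" by blast
  show "\<not> exposed_at n m s n \<Longrightarrow> \<not> exposed_at n m s' n \<and> free_rows n (vec_of s' ''mr'') =
      free_rows n (vec_of s ''mr'')"
    using main ex unfolding mr_def by blast
  show "exposed_at n m s k \<Longrightarrow> card (free_rows n (vec_of s' ''mr'')) < card (free_rows n (vec_of s
      ''mr'')) \<or>
      free_rows n (vec_of s' ''mr'') = free_rows n (vec_of s ''mr'') \<and> k > 0 \<and>
        exposed_at n m s' (k - 1)"
    using main ex unfolding mr_def by blast
qed

lemma match_prog_correct:
  fixes s :: "'a :: field store"
  assumes gs: "good_state n m rb cb A s"
  shows "good_state n m rb cb A (sem match_prog s) \<and> \<not> exposed_at n m (sem match_prog s) n"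
proof -
  let ?F = "\<lambda>t :: 'a store. card (free_rows n (vec_of t ''mr''))"
  have n: "nvar s ''n'' = n" using gs by (simp add: good_state_def)
  have fin: "?F t \<le> n" for t
  proof -
    have "free_rows n (vec_of t ''mr'') \<subseteq> {..<n}" by (auto simp: free_rows_def)
    from card_mono[OF _ this] show ?thesis by simp
  qed
  have gset: "good_state n m rb cb A (setn x v t) \<longleftrightarrow> good_state n m rb cb A t"
      "exposed_at n m (setn x v t) k \<longleftrightarrow> exposed_at n m t k"
    if "x \<noteq> ''n''" "x \<noteq> ''m''" for x v k and t :: "'a store"
    using that by (auto simp: good_state_def exposed_at_def)
  show ?thesis unfolding match_prog_def
  proof (rule sem_for_rule[where I = "\<lambda>a t. good_state n m rb cb A t \<and> (\<not> exposed_at n m t n \<or>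
    ?F t \<le> n - a)"], goal_cases)
    case 1
    then show ?case using gs fin[of s] by simp
  next
    case (2 a t)
    let ?t = "setn ''a'' a t"
    have nt: "nvar ?t ''n'' = n" using 2(2) by (simp add: good_state_def)
    show ?case
    \<comment> \<open>In the third alternative, \<open>b\<close> steps without gain have brought an
      exposed column down to level \<open>n - b\<close>. Its conjunct \<open>b \<le> n\<close> rules
      this alternative out after all \<open>n + 1\<close> passes.\<close>
    proof (rule sem_for_rule[where I = "\<lambda>b u. good_state n m rb cb A u \<and> (\<not> exposed_at n m u n \<or>
      ?F u \<le> n - Suc a \<or>
        b \<le> n \<and> ?F u \<le> n - a \<and> exposed_at n m u (n - b))"], goal_cases)
      case 1
      then show ?case using 2(2) by (auto simp: gset)
    next
      case (2 b u)
      let ?u = "setn ''b'' b u"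
      have gu: "good_state n m rb cb A ?u" using 2(2) by (simp add: gset)
      have b: "b \<le> n" using 2(1) nt by simp
      note st = step_prog_correct[OF gu]
      have same: "exposed_at n m ?u k \<longleftrightarrow> exposed_at n m u k" "?F ?u = ?F u" for k
          by (simp_all add: gset)
      show ?case
      proof (cases "exposed_at n m u n")
        case False
        then show ?thesis using st(1,2) same by simp
      next
        case True
        then have "?F u \<le> n - Suc a \<or> ?F u \<le> n - a \<and> exposed_at n m u (n - b)" using 2(2) by blast
        then show ?thesis
        proof
          assume "?F u \<le> n - Suc a"
          moreover have "?F (sem step_prog ?u) \<le> ?F u" using st(3)[of n] True same by auto
          ultimately show ?thesis using st(1) by simp
        next
          assume h: "?F u \<le> n - a \<and> exposed_at n m u (n - b)"
          then have "?F (sem step_prog ?u) < ?F u \<or>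
              free_rows n (vec_of (sem step_prog ?u) ''mr'') = free_rows n (vec_of u ''mr'') \<and>
                n - b > 0 \<and>
              exposed_at n m (sem step_prog ?u) (n - b - 1)"
            using st(3)[of "n - b"] same by simp
          then show ?thesis
          proof
            assume "?F (sem step_prog ?u) < ?F u"
            then have "?F (sem step_prog ?u) \<le> n - Suc a" using h by linarith
            then show ?thesis using st(1) by blast
          next
            assume k: "free_rows n (vec_of (sem step_prog ?u) ''mr'') =
                free_rows n (vec_of u ''mr'') \<and> n - b > 0 \<and>
              exposed_at n m (sem step_prog ?u) (n - b - 1)"
            then show ?thesis using h st(1) by simp
          qed
        qed
      qed
    next
      case (3 u)
      then show ?case using nt by (simp add: gset)
    qed
  next
    case (3 t)
    \<comment> \<open>At the end an exposed column would mean that no free row is left, but then all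
      levels are empty and expose nothing.\<close>
    have "\<not> exposed_at n m t n"
    proof
      assume e: "exposed_at n m t n"
      then have "?F t = 0" using 3(1) n by simp
      moreover have "finite (free_rows n (vec_of t ''mr''))" by (simp add: free_rows_def)
      ultimately have "free_rows n (vec_of t ''mr'') = {}" by simp
      moreover have "level n (farr t ''A'') (vec_of t ''mr'') {} k = {}" for k by (induction k) auto
      ultimately show False using e by (simp add: exposed_at_def exposes_def)
    qed
    then show ?case using 3(1) by (simp add: gset)
  qed
qed

section \<open>Programs for the chain and the output\<close>

definition reach_all_prog :: prog where
  "reach_all_prog = PFor ''s'' (NSuc nN) bfs_prog"

definition count_hits :: prog where
  "count_hits = PFor ''c'' mN (PIf (BAnd (NEq (vec_cell ''mc'' (NVar ''c'')) (NConst 0)) (BNot (FEq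
    (FArr ''A'' (NVar ''z'') (NVar ''c'')) FZero)))
     (PSetNArr ''bad'' (NVar ''r'') (NConst 0) (NConst 1)) PSkip)"

definition count_row :: prog where
  "count_row = PFor ''z'' nN (PIf (NEq (NArr ''d'' (NVar ''r'') (NVar ''z'')) (NConst 0)) PSkip
     (PSetNArr ''cnt'' (NVar ''r'') (NConst 0) (NSuc (vec_cell ''cnt'' (NVar ''r''))) ;;
       count_hits))"

definition count_prog :: prog where
  "count_prog = PFor ''r'' nN (PSetNArr ''cnt'' (NVar ''r'') (NConst 0) (NConst 0) ;;
     PSetNArr ''bad'' (NVar ''r'') (NConst 0) (NConst 0) ;; count_row)"

definition place_prog :: "bexp \<Rightarrow> prog" where
  "place_prog b = PFor ''z'' nN (PIf (BAnd b (NEq (vec_cell ''placed'' (NVar ''z'')) (NConst 0)))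
     (PSetNArr ''ord'' (NVar ''q'') (NConst 0) (NVar ''z'') ;; PSetN ''q'' (NSuc (NVar ''q'')) ;;
      PSetNArr ''placed'' (NVar ''z'') (NConst 0) (NConst 1) ;;
      PIf (NEq (vec_cell ''mr'' (NVar ''z'')) (NConst 0)) PSkip (PSetN ''w'' (NSuc (NVar ''w''))))
     PSkip)"

definition reach_guard :: bexp where
  "reach_guard = BNot (NEq (NArr ''d'' (NVar ''x'') (NVar ''z'')) (NConst 0))"

definition true_guard :: bexp where
  "true_guard = NEq (NConst 0) (NConst 0)"

text \<open>By \<open>card_unmatched_to\<close> the second dimension is \<open>m\<close> minus the
  number \<open>w\<close> of matched rows placed so far; no set of columns has to be formed.\<close>

definition record_prog :: prog where
  "record_prog = PSetNArr ''i'' (NVar ''h'') (NConst 0) (NVar ''q'') ;;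
     PSetNArr ''j'' (NVar ''h'') (NConst 0) (NMinus mN (NVar ''w''))"

definition clear_prog :: prog where
  "clear_prog = PFor ''z'' nN (PSetNArr ''placed'' (NVar ''z'') (NConst 0) (NConst 0))"

text \<open>Comparing with \<open>k\<close> realizes the order by cardinality. \<open>bad\<close>
  excludes the rows that lie in no closed set, and \<open>placed\<close> those that would add no new
  member.\<close>

definition chain_guard :: bexp where
  "chain_guard = BAnd (NEq (vec_cell ''cnt'' (NVar ''x'')) (NVar ''k''))
     (BAnd (NEq (vec_cell ''bad'' (NVar ''x'')) (NConst 0)) (NEq (vec_cell ''placed'' (NVar ''x''))
       (NConst 0)))"

definition chain_step :: prog where
  "chain_step = place_prog reach_guard ;; PSetN ''h'' (NSuc (NVar ''h'')) ;; record_prog"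

definition chain_round :: prog where
  "chain_round = PFor ''x'' nN (PIf chain_guard chain_step PSkip)"

definition chain_prog :: prog where
  "chain_prog = PFor ''k'' (NSuc nN) chain_round"

text \<open>With \<open>x\<close> set to \<open>n\<close> the guard reads the distances from the
  free rows, so the first member recorded is the least closed set.\<close>

definition order_start :: prog where
  "order_start = PSetN ''q'' (NConst 0) ;; PSetN ''w'' (NConst 0) ;; PSetN ''h'' (NConst 0) ;;
    clear_prog ;;
     PSetN ''x'' nN ;; place_prog reach_guard ;; record_prog"

definition free_cols_prog :: prog where
  "free_cols_prog = PFor ''c'' mN (PIf (NEq (vec_cell ''mc'' (NVar ''c'')) (NConst 0))
     (PSetNArr ''co'' (NVar ''q'') (NConst 0) (NVar ''c'') ;;
       PSetN ''q'' (NSuc (NVar ''q''))) PSkip)"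

abbreviation rev_ord :: "nexp \<Rightarrow> nexp" where
  "rev_ord e \<equiv> vec_cell ''ord'' (NMinus (NMinus nN (NConst 1)) e)"

definition matched_cols_prog :: prog where
  "matched_cols_prog = PFor ''t'' nN (PIf (NEq (vec_cell ''mr'' (rev_ord (NVar ''t''))) (NConst 0))
    PSkip
     (PSetNArr ''co'' (NVar ''q'') (NConst 0) (NMinus (vec_cell ''mr'' (rev_ord (NVar ''t'')))
       (NConst 1)) ;;
      PSetN ''q'' (NSuc (NVar ''q''))))"

text \<open>The bounds come in the order rows, columns, although the columns form the outer
  loop.\<close>

definition fill_prog :: "string \<Rightarrow> nexp \<Rightarrow> nexp \<Rightarrow> fexp \<Rightarrow> prog" where
  "fill_prog X e2 e1 e = PFor ''t'' e1 (PFor ''z'' e2 (PSetFArr X (NVar ''z'') (NVar ''t'') e))"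

definition output_prog :: prog where
  "output_prog =
     fill_prog ''E'' nN nN (FArr ''A'' (rev_ord (NVar ''t'')) (NPlus mN (NVar ''z''))) ;;
     fill_prog ''F'' mN mN (FArr ''A'' (NPlus nN (NVar ''z'')) (vec_cell ''co'' (NVar ''t''))) ;;
     fill_prog ''D'' nN mN (FArr ''A'' (rev_ord (NVar ''z'')) (vec_cell ''co'' (NVar ''t'')))"

definition prepare_prog :: prog where
  "prepare_prog = block_prog ''rb'' ''mu'' ''ns'' ;; block_prog ''cb'' ''nu'' ''ms'' ;; init_prog"

text \<open>After the chain, \<open>true_guard\<close> lets all remaining rows in, so that the order
  is completed to one of all rows.\<close>

definition dm_prog :: prog where
  "dm_prog = prepare_prog ;; match_prog ;; reach_all_prog ;; count_prog ;;
     order_start ;; chain_prog ;; place_prog true_guard ;;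
     PSetN ''q'' (NConst 0) ;; free_cols_prog ;; matched_cols_prog ;; output_prog"

lemmas order_defs = reach_all_prog_def count_hits_def count_row_def count_prog_def place_prog_def
  reach_guard_def
  true_guard_def record_prog_def clear_prog_def chain_guard_def chain_step_def chain_round_def
    chain_prog_def
  order_start_def free_cols_prog_def matched_cols_prog_def fill_prog_def output_prog_def
    prepare_prog_def

lemma wf_dm_prog: "wf_prog dm_prog"
  by (simp add: dm_prog_def order_defs loop_defs dim_vars_def dim_arrs_def)

section \<open>Reachability tables and their evaluation\<close>

lemma reach_all_prog_correct:
  fixes s :: "'a :: field store"
  assumes n: "nvar s ''n'' = n" and a: "a \<le> n" and r: "r < n"
  defines "B \<equiv> farr s ''A''" and "mr \<equiv> vec_of s ''mr''"
  shows "narr (sem reach_all_prog s) ''d'' a r \<noteq> 0 \<longleftrightarrow> r \<in> level n B mr (sources n mr a) n"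
proof -
  have "\<forall>a r. a \<le> n \<longrightarrow> r < n \<longrightarrow> (narr (sem reach_all_prog s) ''d'' a r \<noteq> 0 \<longleftrightarrow>
      r \<in> level n B mr (sources n mr a) n)"
    unfolding reach_all_prog_def
  proof (rule sem_for_rule[where I = "\<lambda>i t. \<forall>a r. a < i \<longrightarrow> r < n \<longrightarrow>
      (narr t ''d'' a r \<noteq> 0 \<longleftrightarrow> r \<in> level n B mr (sources n mr a) n)"], goal_cases)
    case (2 i t)
    note fr = framed_simps[OF 2(3)]
    let ?t = "setn ''s'' i t"
    have e: "nvar ?t ''n'' = n" "nvar ?t ''s'' = i" "farr ?t ''A'' = B" "vec_of ?t ''mr'' = mr"
      using fr n by (simp_all add: B_def mr_def loop_defs)
    have ns: "narr ?t ''d'' = narr t ''d''" by simp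
    show ?case
    proof (intro allI impI)
      fix a r assume h: "a < Suc i" "r < n"
      show "narr (sem bfs_prog ?t) ''d'' a r \<noteq> 0 \<longleftrightarrow> r \<in> level n B mr (sources n mr a) n"
        unfolding bfs_prog_correct[OF e(1,2)] e(3,4) ns using h 2(2) by (cases "a = i") auto
    qed
  qed (use n in auto)
  then show ?thesis using a r by blast
qed

lemma count_hits_correct:
  fixes s :: "'a :: field store"
  assumes "nvar s ''m'' = m"
  shows "narr (sem count_hits s) ''bad'' a b = (if a = nvar s ''r'' \<and> b = 0 \<and>
    (\<exists>c<m. hits s (nvar s ''z'') c) then 1 else narr s ''bad'' a b)"
  unfolding count_hits_def
proof (rule sem_for_rule[where I = "\<lambda>i t. narr t ''bad'' a b =
    (if a = nvar s ''r'' \<and> b = 0 \<and> (\<exists>c<i. hits s (nvar s ''z'') c) then 1 else narr s ''bad'' a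
      b)"], goal_cases)
  case (2 i t)
  note fr = framed_simps[OF 2(3)]
  have e: "nvar t ''r'' = nvar s ''r''" "nvar t ''z'' = nvar s ''z''" "farr t ''A'' = farr s ''A''"
      "narr t ''mc'' = narr s ''mc''"
    using fr by simp_all
  show ?case
  proof (cases "hits s (nvar s ''z'') i")
    case True
    then show ?thesis using 2(2) by (auto simp: e)
  next
    case False
    have g: "bval (BAnd (NEq (vec_cell ''mc'' (NVar ''c'')) (NConst 0)) (BNot (FEq (FArr ''A'' (NVar
        ''z'') (NVar ''c'')) FZero))) (setn ''c'' i t) = False"
      using False by (auto simp: e)
    have "(\<exists>c<Suc i. hits s (nvar s ''z'') c) \<longleftrightarrow> (\<exists>c<i. hits s (nvar s ''z'') c)"
      using False less_Suc_eq by blast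
    then show ?thesis unfolding sem.simps g if_False using 2(2) by simp
  qed
qed (use assms in auto)

lemma count_row_correct:
  fixes s :: "'a :: field store"
  assumes "nvar s ''n'' = n" "nvar s ''m'' = m" "narr s ''cnt'' (nvar s ''r'') 0 = 0"
    "narr s ''bad'' (nvar s ''r'') 0 = 0"
  defines "R \<equiv> {z. z < n \<and> narr s ''d'' (nvar s ''r'') z \<noteq> 0}" and "s' \<equiv> sem count_row s"
  shows "narr s' ''cnt'' (nvar s ''r'') 0 = card R \<and> (narr s' ''bad'' (nvar s ''r'') 0 \<noteq> 0 \<longleftrightarrow>
    exposes m (farr s ''A'') (vec_of s ''mc'') R) \<and>
    (\<forall>a b. a \<noteq> nvar s ''r'' \<longrightarrow> narr s' ''cnt'' a b = narr s ''cnt'' a b \<and> narr s' ''bad'' a b =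
      narr s ''bad'' a b)"
proof -
  let ?r = "nvar s ''r''"
  define P where "P i t \<longleftrightarrow> narr t ''cnt'' ?r 0 = card {z. z < i \<and> z \<in> R} \<and>
      (narr t ''bad'' ?r 0 \<noteq> 0 \<longleftrightarrow> exposes m (farr s ''A'') (vec_of s ''mc'') {z. z < i \<and> z \<in> R}) \<and>
      (\<forall>a b. a \<noteq> ?r \<longrightarrow> narr t ''cnt'' a b = narr s ''cnt'' a b \<and> narr t ''bad'' a b =
        narr s ''bad'' a b)" for i and t :: "'a store"
  have P: "P n s'"
    unfolding s'_def count_row_def
  proof (rule sem_for_rule[where I = P], goal_cases)
    case 1
    then show ?case using assms(3,4) by (simp add: P_def exposes_def)
  next
    case (2 i t)
    note fr = framed_simps[OF 2(3)]
    have e: "nvar t ''m'' = m" "nvar t ''r'' = ?r" "farr t ''A'' = farr s ''A''"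
        "narr t ''mc'' = narr s ''mc''" "narr t ''d'' = narr s ''d''"
      using fr assms(1,2) by (simp_all add: count_hits_def)
    have i: "i < n" using 2(1) assms by simp
    show ?case
    proof (cases "i \<in> R")
      case False
      then have "{z. z < Suc i \<and> z \<in> R} = {z. z < i \<and> z \<in> R}" by (auto simp: less_Suc_eq)
      then show ?thesis using False i 2(2) by (simp add: P_def e R_def)
    next
      case True
      have S: "{z. z < Suc i \<and> z \<in> R} = insert i {z. z < i \<and> z \<in> R}" using True
          by (auto simp: less_Suc_eq)
      let ?t = "setna ''cnt'' ?r 0 (narr t ''cnt'' ?r 0 + 1) (setn ''z'' i t)"
      have m: "nvar ?t ''m'' = m" using e by simp
      have cn: "narr (sem count_hits ?t) ''cnt'' = narr ?t ''cnt''"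
          by (simp add: sem_frame_na count_hits_def del: sem.simps)
      have bd: "narr (sem count_hits ?t) ''bad'' a b = (if a = ?r \<and> b = 0 \<and>
          (\<exists>c<m. hits s i c) then 1 else narr t ''bad'' a b)" for a b
      proof -
        have z: "nvar ?t ''z'' = i" "nvar ?t ''r'' = ?r" "narr ?t ''mc'' = narr s ''mc''"
            "farr ?t ''A'' = farr s ''A''"
          "narr ?t ''bad'' = narr t ''bad''" using e by simp_all
        show ?thesis using count_hits_correct[OF m, of a b] unfolding z .
      qed
      have ex: "exposes m (farr s ''A'') (vec_of s ''mc'') (insert i X) \<longleftrightarrow> (\<exists>c<m. hits s i c) \<or>
          exposes m (farr s ''A'') (vec_of s ''mc'') X" for X
        by (auto simp: exposes_def)
      have "P (Suc i) (sem count_hits ?t)"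
        using 2(2) unfolding P_def S ex cn bd by auto
      then show ?thesis using True by (simp add: e R_def)
    qed
  next
    case (3 t)
    then show ?case using assms(1) by (simp add: P_def)
  qed
  have e: "{z. z < n \<and> z \<in> R} = R" by (auto simp: R_def)
  show ?thesis using P unfolding P_def e .
qed

lemma count_prog_correct:
  fixes s :: "'a :: field store"
  assumes n: "nvar s ''n'' = n" "nvar s ''m'' = m" and r: "r < n"
  defines "R \<equiv> {z. z < n \<and> narr s ''d'' r z \<noteq> 0}" and "s' \<equiv> sem count_prog s"
  shows "narr s' ''cnt'' r 0 = card R \<and> (narr s' ''bad'' r 0 \<noteq> 0 \<longleftrightarrow>
    exposes m (farr s ''A'') (vec_of s ''mc'') R)"
  unfolding s'_def count_prog_def
proof (rule sem_for_rule[where I = "\<lambda>i t. r < i \<longrightarrow> narr t ''cnt'' r 0 = card R \<and>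
    (narr t ''bad'' r 0 \<noteq> 0 \<longleftrightarrow> exposes m (farr s ''A'') (vec_of s ''mc'') R)"], goal_cases)
  case (2 i t)
  note fr = framed_simps[OF 2(3)]
  let ?t = "setna ''bad'' i 0 0 (setna ''cnt'' i 0 0 (setn ''r'' i t))"
  have e: "nvar ?t ''n'' = n" "nvar ?t ''m'' = m" "nvar ?t ''r'' = i" "farr ?t ''A'' = farr s ''A''"
    "narr ?t ''mc'' = narr s ''mc''" "narr ?t ''d'' = narr s ''d''"
    using fr n by (simp_all add: count_row_def count_hits_def)
  have z: "narr ?t ''cnt'' (nvar ?t ''r'') 0 = 0" "narr ?t ''bad'' (nvar ?t ''r'') 0 = 0" using e
      by simp_all
  note c = count_row_correct[OF e(1,2) z, unfolded e]
  have "r < Suc i \<longrightarrow> narr (sem count_row ?t) ''cnt'' r 0 = card R \<and>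
      (narr (sem count_row ?t) ''bad'' r 0 \<noteq> 0 \<longleftrightarrow> exposes m (farr s ''A'') (vec_of s ''mc'') R)"
  proof (cases "r = i")
    case True
    then show ?thesis using c by (simp add: R_def)
  next
    case False
    have "narr (sem count_row ?t) ''cnt'' r 0 = narr ?t ''cnt'' r 0"
        "narr (sem count_row ?t) ''bad'' r 0 = narr ?t ''bad'' r 0"
      using c False by blast+
    then show ?thesis using False 2(2) by (simp add: less_Suc_eq)
  qed
  then show ?case by simp
qed (use n r in auto)

section \<open>Placing rows in order\<close>

definition ords :: "'a store \<Rightarrow> nat list" where
  "ords s = map (vec_of s ''ord'') [0..<nvar s ''q'']"

definition placed_ok :: "nat \<Rightarrow> 'a store \<Rightarrow> bool" where
  "placed_ok n s \<longleftrightarrow> distinct (ords s) \<and> set (ords s) \<subseteq> {..<n} \<and>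
     (\<forall>z<n. vec_of s ''placed'' z = 0 \<longleftrightarrow> z \<notin> set (ords s)) \<and>
     nvar s ''w'' = card {r \<in> set (ords s). vec_of s ''mr'' r \<noteq> 0}"

lemma length_ords [simp]: "length (ords s) = nvar s ''q''" by (simp add: ords_def)

lemma placed_ok_cong:
  "narr t ''ord'' = narr s ''ord'' \<Longrightarrow> nvar t ''q'' = nvar s ''q'' \<Longrightarrow> narr t ''placed'' =
    narr s ''placed'' \<Longrightarrow>
   nvar t ''w'' = nvar s ''w'' \<Longrightarrow> narr t ''mr'' = narr s ''mr'' \<Longrightarrow> placed_ok n t \<longleftrightarrow> placed_ok n s"
  by (simp add: placed_ok_def ords_def)

text \<open>The guard must describe a fixed set \<open>S\<close> in every framed store, that is,
  independently of what the loop writes. That the list grows only by appending keeps all recorded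
  prefixes valid.\<close>

lemma place_prog_correct:
  fixes s :: "'a :: field store"
  assumes n: "nvar s ''n'' = n" and ok: "placed_ok n s"
    and b: "\<And>z t. z < n \<Longrightarrow> framed (place_prog b) s t \<Longrightarrow> bval b (setn ''z'' z t) \<longleftrightarrow> z \<in> S"
  defines "s' \<equiv> sem (place_prog b) s"
  shows "placed_ok n s' \<and> set (ords s') = set (ords s) \<union> (S \<inter> {..<n}) \<and> (\<exists>xs. ords s' =
    ords s @ xs)"
  unfolding s'_def place_prog_def
proof (rule sem_for_rule[where I = "\<lambda>i t. placed_ok n t \<and> set (ords t) =
  set (ords s) \<union> (S \<inter> {..<i}) \<and> (\<exists>xs. ords t = ords s @ xs)"], goal_cases)
  case (2 i t)
  note fr = framed_simps[OF 2(3)]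
  have i: "i < n" using 2(1) n by simp
  have g: "bval b (setn ''z'' i t) \<longleftrightarrow> i \<in> S" using b[OF i] 2(3) by (simp add: place_prog_def)
  let ?t = "setn ''z'' i t"
  have ot: "ords ?t = ords t" by (simp add: ords_def)
  have mr: "narr t ''mr'' = narr s ''mr''" using fr by simp
  show ?case
  proof (cases "i \<in> S \<and> i \<notin> set (ords t)")
    case False
    then have g': "bval (BAnd b (NEq (vec_cell ''placed'' (NVar ''z'')) (NConst 0))) ?t = False"
      using g i 2(2) by (auto simp: placed_ok_def)
    have S: "S \<inter> {..<Suc i} = (if i \<in> S then insert i (S \<inter> {..<i}) else S \<inter> {..<i})"
        by (auto simp: less_Suc_eq)
    have "placed_ok n ?t"
    proof -
      have "placed_ok n t" using 2(2) by simp
      then show ?thesis by (simp add: placed_ok_def ot)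
    qed
    moreover have "set (ords t) = set (ords s) \<union> (S \<inter> {..<Suc i})"
    proof -
      have t: "set (ords t) = set (ords s) \<union> (S \<inter> {..<i})" using 2(2) by blast
      show ?thesis
      proof (cases "i \<in> S")
        case True
        then have "i \<in> set (ords t)" using False by blast
        then show ?thesis using True t S by auto
      qed (simp add: S t)
    qed
    moreover have "\<exists>xs. ords t = ords s @ xs" using 2(2) by blast
    ultimately show ?thesis unfolding sem.simps g' by (simp only: if_False ot simp_thms)
  next
    case True
    let ?u = "setna ''placed'' i 0 1 (setn ''q'' (Suc (nvar t ''q'')) (setna ''ord'' (nvar t ''q'')
      0 i ?t))"
    define v where "v = (if narr t ''mr'' i 0 = 0 then ?u else setn ''w'' (Suc (nvar t ''w'')) ?u)"
    have ov: "ords v = ords t @ [i]" by (auto simp: v_def ords_def)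
    have "{r \<in> set (ords v). vec_of t ''mr'' r \<noteq> 0} =
        (if vec_of t ''mr'' i = 0 then {} else {i}) \<union> {r \<in> set (ords t). vec_of t ''mr'' r \<noteq> 0}"
      by (auto simp: ov)
    moreover have pt: "placed_ok n t" using 2(2) by simp
    moreover have "vec_of v ''placed'' z = (if z = i then 1 else vec_of t ''placed'' z)"
      "narr v ''mr'' = narr t ''mr''"
      "nvar v ''w'' = (if vec_of t ''mr'' i = 0 then nvar t ''w'' else Suc (nvar t ''w''))" for z
        by (simp_all add: v_def)
    ultimately have "placed_ok n v" using True i by (auto simp: placed_ok_def ov)
    moreover have "S \<inter> {..<Suc i} = insert i (S \<inter> {..<i})" using True by (auto simp: less_Suc_eq)
    ultimately have "placed_ok n v \<and> set (ords v) = set (ords s) \<union> (S \<inter> {..<Suc i}) \<and> (\<exists>xs. ords v =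
      ords s @ xs)"
      using 2(2) by (auto simp: ov)
    moreover have "narr t ''placed'' i 0 = 0" using 2(2) True i by (simp add: placed_ok_def)
    ultimately show ?thesis using True g by (cases "narr t ''mr'' i 0 = 0") (simp_all add: v_def)
  qed
next
  case (3 t)
  have "ords (setn ''z'' v t) = ords t" "placed_ok n (setn ''z'' v t) = placed_ok n t" for v
    by (auto simp: ords_def placed_ok_def)
  then show ?case using 3(1) n by simp
qed (use ok in auto)


section \<open>Construction of the chain\<close>

locale searched = matched n m B mr mc
  for n m :: nat and B :: "nat \<Rightarrow> nat \<Rightarrow> 'a :: field" and mr mc :: "nat \<Rightarrow> nat" +
  assumes optimal: "\<not> exposes m B mc (level n B mr (free_rows n mr) n)"
begin

definition search_ok :: "'a store \<Rightarrow> bool" where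
  "search_ok s \<longleftrightarrow> nvar s ''n'' = n \<and> nvar s ''m'' = m \<and> farr s ''A'' = B \<and> vec_of s ''mr'' = mr \<and>
    vec_of s ''mc'' = mc \<and>
     (\<forall>a\<le>n. \<forall>r<n. narr s ''d'' a r \<noteq> 0 \<longleftrightarrow> r \<in> level n B mr (sources n mr a) n) \<and>
     (\<forall>r<n. narr s ''cnt'' r 0 = card (R r) \<and> (narr s ''bad'' r 0 = 0 \<longleftrightarrow> \<not> exposes m B mc (R r)))"

lemma search_ok_cong:
  "nvar t ''n'' = nvar s ''n'' \<Longrightarrow> nvar t ''m'' = nvar s ''m'' \<Longrightarrow> farr t ''A'' = farr s ''A'' \<Longrightarrow>
    narr t ''mr'' = narr s ''mr'' \<Longrightarrow>
   narr t ''mc'' = narr s ''mc'' \<Longrightarrow> narr t ''d'' = narr s ''d'' \<Longrightarrow> narr t ''cnt'' = narr s ''cnt'' \<Longrightarrow>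
     narr t ''bad'' = narr s ''bad'' \<Longrightarrow>
   search_ok t \<longleftrightarrow> search_ok s"
  by (simp add: search_ok_def)

text \<open>The members of the chain are not stored; each is recovered as a prefix of the placed
  rows from its recorded length.\<close>

definition recorded :: "nat set list \<Rightarrow> 'a store \<Rightarrow> bool" where
  "recorded Ls s \<longleftrightarrow> saturated Ls \<and> length Ls = Suc (nvar s ''h'') \<and>
     (\<forall>k\<le>nvar s ''h''. narr s ''i'' k 0 \<le> nvar s ''q'' \<and> Ls ! k =
       set (take (narr s ''i'' k 0) (ords s)) \<and>
        narr s ''j'' k 0 = m - card {r \<in> Ls ! k. mr r \<noteq> 0})"

lemma recorded_append:
  assumes "recorded Ls s" "ords t = ords s @ xs" "nvar t ''h'' = nvar s ''h''"
    "narr t ''i'' = narr s ''i''" "narr t ''j'' = narr s ''j''"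
  shows "recorded Ls t"
proof -
  have "nvar t ''q'' = nvar s ''q'' + length xs" using arg_cong[OF assms(2), of length] by simp
  then show ?thesis using assms by (auto simp: recorded_def)
qed

lemma place_reach:
  assumes s: "search_ok s" and ok: "placed_ok n s" and x: "nvar s ''x'' \<le> n"
  defines "s' \<equiv> sem (place_prog reach_guard) s"
  shows "placed_ok n s' \<and> set (ords s') = set (ords s) \<union> level n B mr (sources n mr (nvar s ''x''))
    n \<and> (\<exists>xs. ords s' = ords s @ xs)"
proof -
  let ?S = "level n B mr (sources n mr (nvar s ''x'')) n"
  have "?S \<inter> {..<n} = ?S" using level_subset[OF sources_subset, of n B mr mr "nvar s ''x''" n]
      by blast
  moreover have "placed_ok n s' \<and> set (ords s') = set (ords s) \<union> (?S \<inter> {..<n}) \<and> (\<exists>xs. ords s' =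
    ords s @ xs)"
    unfolding s'_def
  proof (rule place_prog_correct[OF _ ok])
    show "nvar s ''n'' = n" using s by (simp add: search_ok_def)
    fix z t assume z: "z < n" and f: "framed (place_prog reach_guard) s t"
    have "nvar t ''x'' = nvar s ''x''" "narr t ''d'' = narr s ''d''"
      using framed_simps[OF f] by (simp_all add: place_prog_def)
    then show "bval reach_guard (setn ''z'' z t) \<longleftrightarrow> z \<in> ?S"
      using s z x by (simp add: reach_guard_def search_ok_def)
  qed
  ultimately show ?thesis by simp
qed

lemma search_ok_place: "search_ok s \<Longrightarrow> search_ok (sem (place_prog b) s)"
  using search_ok_cong[of "sem (place_prog b) s" s] by (simp add: frame place_prog_def del:
    sem.simps)

lemma record_simps:
  "sem record_prog s = setna ''j'' (nvar s ''h'') 0 (nvar s ''m'' - nvar s ''w'') (setna ''i'' (nvar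
    s ''h'') 0 (nvar s ''q'') s)"
  by (simp add: record_prog_def)

lemma placed_ok_w: "placed_ok n s \<Longrightarrow> search_ok s \<Longrightarrow> nvar s ''w'' = card {r \<in> set (ords s). mr r \<noteq> 0}"
  unfolding placed_ok_def search_ok_def by metis

lemma order_start_correct:
  assumes s: "search_ok s"
  defines "s' \<equiv> sem order_start s"
  shows "search_ok s' \<and> placed_ok n s' \<and> (\<exists>Ls. recorded Ls s' \<and> last Ls = set (ords s'))"
proof -
  define s1 where "s1 = sem clear_prog (setn ''h'' 0 (setn ''w'' 0 (setn ''q'' 0 s)))"
  define s2 where "s2 = setn ''x'' n s1"
  define s3 where "s3 = sem (place_prog reach_guard) s2"
  let ?s0 = "setn ''h'' 0 (setn ''w'' 0 (setn ''q'' 0 s))"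
  have n0: "nvar ?s0 ''n'' = n" using s by (simp add: search_ok_def)
  have "\<forall>z<n. narr s1 ''placed'' z 0 = 0"
    unfolding s1_def clear_prog_def
  proof (rule sem_for_rule[where I = "\<lambda>i t. \<forall>z<i. narr t ''placed'' z 0 = 0"], goal_cases)
    case (2 i t)
    then show ?case by (simp add: less_Suc_eq)
  qed (use n0 in auto)
  moreover have q1: "nvar s1 ''q'' = 0" "nvar s1 ''w'' = 0" "nvar s1 ''h'' = 0" "nvar s1 ''n'' = n"
    using n0 by (simp_all add: s1_def frame clear_prog_def del: sem.simps)
  ultimately have p2: "placed_ok n s2" by (simp add: placed_ok_def ords_def s2_def)
  have "search_ok s1"
    using s search_ok_cong[of s1 s] by (simp add: s1_def frame clear_prog_def del: sem.simps)
  then have k2: "search_ok s2" using search_ok_cong[of s2 s1] by (simp add: s2_def)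
  have x2: "nvar s2 ''x'' = n" by (simp add: s2_def)
  let ?L0 = "level n B mr (free_rows n mr) n"
  have p3: "placed_ok n s3" "set (ords s3) = ?L0"
    using place_reach[OF k2 p2] x2 q1 by (simp_all add: s3_def) (simp add: ords_def s2_def)
  have k3: "search_ok s3" unfolding s3_def by (rule search_ok_place[OF k2])
  have h3: "nvar s3 ''h'' = 0" using q1 by (simp add: s3_def s2_def frame place_prog_def del:
      sem.simps)
  have m3: "nvar s3 ''m'' = m" using k3 by (simp add: search_ok_def)
  have nn: "nvar s1 ''n'' = n" by (rule q1)
  have s': "s' = setna ''j'' 0 0 (m - nvar s3 ''w'') (setna ''i'' 0 0 (nvar s3 ''q'') s3)"
    using n0 h3 m3 by (simp add: s'_def order_start_def s1_def[symmetric] nn s2_def[symmetric]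
      s3_def[symmetric] record_simps)
  have o: "ords s' = ords s3" by (simp add: ords_def s')
  have "recorded [?L0] s'"
    using saturated_initial[OF optimal] p3 placed_ok_w[OF p3(1) k3] o h3
    by (simp add: recorded_def s')
  moreover have "search_ok s'" using k3 search_ok_cong[of s' s3] by (simp add: s')
  moreover have "placed_ok n s'" using p3(1) placed_ok_cong[of s' s3] by (simp add: s')
  moreover have "last [?L0] = set (ords s')" using p3 o by simp
  ultimately show ?thesis by blast
qed

text \<open>Since the placed rows are exactly the top member, the premises of
  \<open>saturated_extend\<close> on \<open>last Ls\<close> become statements about placed rows,
  which the program can test.\<close>

definition chain_ok :: "'a store \<Rightarrow> bool" where
  "chain_ok s \<longleftrightarrow> search_ok s \<and> placed_ok n s \<and> (\<exists>Ls. recorded Ls s \<and> last Ls = set (ords s))"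

lemma chain_ok_setn:
  assumes "x \<in> {''k'', ''x'', ''z''}"
  shows "chain_ok (setn x v s) \<longleftrightarrow> chain_ok s" "ords (setn x v s) = ords s"
proof -
  have ne: "x \<noteq> ''n''" "x \<noteq> ''m''" "x \<noteq> ''q''" "x \<noteq> ''w''" "x \<noteq> ''h''" using assms by auto
  show o: "ords (setn x v s) = ords s" using ne by (simp add: ords_def)
  show "chain_ok (setn x v s) \<longleftrightarrow> chain_ok s"
    using ne by (simp add: chain_ok_def search_ok_def placed_ok_def recorded_def o)
qed

lemma chain_step_correct:
  assumes s: "chain_ok s" and x: "nvar s ''x'' = x" "x < n" "x \<notin> set (ords s)"
    "\<not> exposes m B mc (R x)"
    and small: "\<And>z. z < n \<Longrightarrow> \<not> exposes m B mc (R z) \<Longrightarrow> card (R z) < card (R x) \<Longrightarrow> z \<in> set (ords s)"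
  defines "s' \<equiv> sem chain_step s"
  shows "chain_ok s' \<and> set (ords s') = set (ords s) \<union> R x"
proof -
  obtain Ls where Ls: "recorded Ls s" "last Ls = set (ords s)" using s by (auto simp: chain_ok_def)
  define s1 where "s1 = sem (place_prog reach_guard) s"
  have ks: "search_ok s" and ps: "placed_ok n s" using s by (auto simp: chain_ok_def)
  obtain xs where p1: "placed_ok n s1" "set (ords s1) = set (ords s) \<union> R x" "ords s1 = ords s @ xs"
    using place_reach[OF ks ps] x by (auto simp: s1_def reach_def)
  have k1: "search_ok s1" unfolding s1_def by (rule search_ok_place[OF ks])
  have e1: "nvar s1 ''h'' = nvar s ''h''" "narr s1 ''i'' = narr s ''i''"
      "narr s1 ''j'' = narr s ''j''"
    by (simp_all add: s1_def frame place_prog_def del: sem.simps)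
  have r1: "recorded Ls s1" by (rule recorded_append[OF Ls(1) p1(3) e1])
  have m1: "nvar s1 ''m'' = m" using k1 by (simp add: search_ok_def)
  let ?h = "Suc (nvar s1 ''h'')"
  have s': "s' = setna ''j'' ?h 0 (m - nvar s1 ''w'') (setna ''i'' ?h 0 (nvar s1 ''q'') (setn ''h''
      ?h s1))"
    using m1 by (simp add: s'_def chain_step_def s1_def[symmetric] record_simps)
  have o: "ords s' = ords s1" by (simp add: ords_def s')
  have sat: "saturated (Ls @ [last Ls \<union> R x])"
    by (rule saturated_extend) (use Ls x small in \<open>auto simp: recorded_def\<close>)
  have lu: "last Ls \<union> R x = set (ords s1)" using p1(2) Ls(2) by simp
  have len: "length Ls = ?h" using r1 by (simp add: recorded_def)
  have "recorded (Ls @ [last Ls \<union> R x]) s'"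
    unfolding recorded_def
  proof (intro conjI allI impI)
    fix k assume k: "k \<le> nvar s' ''h''"
    have "narr s' ''i'' k 0 \<le> nvar s' ''q'' \<and> (Ls @ [last Ls \<union> R x]) ! k =
        set (take (narr s' ''i'' k 0) (ords s')) \<and>
        narr s' ''j'' k 0 = m - card {r \<in> (Ls @ [last Ls \<union> R x]) ! k. mr r \<noteq> 0}"
    proof (cases "k = ?h")
      case True
      then show ?thesis using placed_ok_w[OF p1(1) k1] by (simp add: nth_append len lu o) (simp add:
        s')
    next
      case False
      then have "k \<le> nvar s1 ''h''" using k by (simp add: s')
      then show ?thesis using r1 False unfolding o by (simp add: recorded_def nth_append s')
    qed
    then show "narr s' ''i'' k 0 \<le> nvar s' ''q''" "(Ls @ [last Ls \<union> R x]) ! k =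
      set (take (narr s' ''i'' k 0) (ords s'))"
        "narr s' ''j'' k 0 = m - card {r \<in> (Ls @ [last Ls \<union> R x]) ! k. mr r \<noteq> 0}" by auto
  qed (use sat len in \<open>simp_all add: s'\<close>)
  moreover have "search_ok s'" using k1 search_ok_cong[of s' s1] by (simp add: s')
  moreover have "placed_ok n s'" using p1(1) placed_ok_cong[of s' s1] by (simp add: s')
  ultimately show ?thesis unfolding chain_ok_def using lu o p1(2) by (metis last_snoc)
qed

text \<open>A row of size \<open>k\<close> may be placed together with an earlier one of the same
  size. The invariant therefore speaks of placed rows only; since their set grows,
  \<open>small\<close> stays available throughout the round.\<close>

lemma chain_round_correct:
  assumes s: "chain_ok s" and k: "nvar s ''k'' = k"
    and small: "\<And>z. z < n \<Longrightarrow> \<not> exposes m B mc (R z) \<Longrightarrow> card (R z) < k \<Longrightarrow> z \<in> set (ords s)"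
  defines "s' \<equiv> sem chain_round s"
  shows "chain_ok s' \<and> (\<forall>z<n. \<not> exposes m B mc (R z) \<longrightarrow> card (R z) \<le> k \<longrightarrow> z \<in> set (ords s'))"
  unfolding s'_def chain_round_def
proof (rule sem_for_rule[where I = "\<lambda>i t. chain_ok t \<and> set (ords s) \<subseteq> set (ords t) \<and>
    (\<forall>z<i. \<not> exposes m B mc (R z) \<longrightarrow> card (R z) = k \<longrightarrow> z \<in> set (ords t))"], goal_cases)
  case (2 i t)
  note fr = framed_simps[OF 2(3)]
  let ?t = "setn ''x'' i t"
  have i: "i < n" using 2(1) s by (simp add: chain_ok_def search_ok_def)
  have kt: "nvar t ''k'' = k" using fr k by (simp add: chain_step_def place_prog_def
      record_prog_def)
  have ct: "chain_ok t" using 2(2) by blast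
  then have "narr t ''cnt'' i 0 = card (R i)" "narr t ''bad'' i 0 = 0 \<longleftrightarrow> \<not> exposes m B mc (R i)"
    "narr t ''placed'' i 0 = 0 \<longleftrightarrow> i \<notin> set (ords t)"
    using i by (simp_all add: chain_ok_def search_ok_def placed_ok_def)
  then have g: "bval chain_guard ?t \<longleftrightarrow> card (R i) = k \<and> \<not> exposes m B mc (R i) \<and> i \<notin> set (ords t)"
    by (simp add: chain_guard_def kt)
  show ?case
  proof (cases "bval chain_guard ?t")
    case False
    then have "sem (PIf chain_guard chain_step PSkip) ?t = ?t" by simp
    moreover have "\<forall>z<Suc i. \<not> exposes m B mc (R z) \<longrightarrow> card (R z) = k \<longrightarrow> z \<in> set (ords t)"
      using 2(2) False g by (auto simp: less_Suc_eq)
    ultimately show ?thesis using 2(2) by (simp add: chain_ok_setn)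
  next
    case True
    then have h: "card (R i) = k" "\<not> exposes m B mc (R i)" "i \<notin> set (ords t)" using g by auto
    have "chain_ok (sem chain_step ?t) \<and> set (ords (sem chain_step ?t)) = set (ords ?t) \<union> R i"
    proof (rule chain_step_correct)
      fix z assume "z < n" "\<not> exposes m B mc (R z)" "card (R z) < card (R i)"
      then show "z \<in> set (ords ?t)" using small h 2(2) by (auto simp: chain_ok_setn)
    qed (use ct i h in \<open>simp_all add: chain_ok_setn\<close>)
    then show ?thesis using True 2(2) self_reach[of i] by (auto simp: chain_ok_setn less_Suc_eq)
  qed
next
  case (3 t)
  have "nval nN s = n" using s by (simp add: chain_ok_def search_ok_def)
  then show ?case using 3(1) small by (auto simp: chain_ok_setn le_less)
qed (use s in auto)

text \<open>Reachability sets lie in \<open>{..<n}\<close>, so the sizes up to \<open>n\<close>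
  exhaust all rows.\<close>

lemma chain_prog_correct:
  assumes s: "chain_ok s"
  defines "s' \<equiv> sem chain_prog s"
  shows "chain_ok s' \<and> (\<forall>z<n. \<not> exposes m B mc (R z) \<longrightarrow> z \<in> set (ords s'))"
  unfolding s'_def chain_prog_def
proof (rule sem_for_rule[where I = "\<lambda>i t. chain_ok t \<and> (\<forall>z<n. \<not> exposes m B mc (R z) \<longrightarrow>
  card (R z) < i \<longrightarrow> z \<in> set (ords t))"], goal_cases)
  case (2 i t)
  have "chain_ok (setn ''k'' i t)" using 2(2) by (simp add: chain_ok_setn)
  from chain_round_correct[OF this, of i] 2(2) show ?case
    by (simp add: chain_ok_setn less_Suc_eq_le)
next
  case (3 t)
  have "nval (NSuc nN) s = Suc n" using s by (simp add: chain_ok_def search_ok_def)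
  moreover have "card (R z) < Suc n" if "z < n" for z
    using card_mono[OF _ reach_subset[OF that]] by simp
  ultimately show ?case using 3(1) by (simp add: chain_ok_setn)
qed (use s in auto)

text \<open>Applied after \<open>chain_prog\<close>, this adds the rows that reach a free column.
  The list only becomes longer, so the chain stays recorded, with the former rows as its last
  member.\<close>

lemma place_rest_correct:
  assumes s: "chain_ok s"
  defines "s' \<equiv> sem (place_prog true_guard) s"
  shows "search_ok s' \<and> distinct (ords s') \<and> set (ords s') = {..<n} \<and> (\<exists>Ls. recorded Ls s' \<and>
    last Ls = set (ords s))"
proof -
  have ks: "search_ok s" and ps: "placed_ok n s" using s by (auto simp: chain_ok_def)
  obtain Ls where Ls: "recorded Ls s" "last Ls = set (ords s)" using s by (auto simp: chain_ok_def)
  have n: "nvar s ''n'' = n" using ks by (simp add: search_ok_def)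
  have p: "placed_ok n s'" "set (ords s') = set (ords s) \<union> (UNIV \<inter> {..<n})"
      "\<exists>xs. ords s' = ords s @ xs"
    using place_prog_correct[OF n ps, of true_guard UNIV] by (simp_all add: s'_def true_guard_def)
  have "set (ords s) \<subseteq> {..<n}" "distinct (ords s')" using ps p(1) by (simp_all add: placed_ok_def)
  moreover have "recorded Ls s'"
  proof -
    obtain xs where "ords s' = ords s @ xs" using p(3) by blast
    then show ?thesis by (rule recorded_append[OF Ls(1)]) (simp_all add: s'_def frame place_prog_def
      del: sem.simps)
  qed
  moreover have "search_ok s'" unfolding s'_def by (rule search_ok_place[OF ks])
  ultimately show ?thesis using p(2) Ls(2) by auto
qed

end

section \<open>Column order and output matrices\<close>

definition col_list :: "'a store \<Rightarrow> nat list" where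
  "col_list s = map (vec_of s ''co'') [0..<nvar s ''q'']"

lemma col_list_append: "col_list (setn ''q'' (Suc (nvar s ''q'')) (setna ''co'' (nvar s ''q'') 0 v
  s)) = col_list s @ [v]"
  by (simp add: col_list_def)

lemma col_list_setn: "x \<noteq> ''q'' \<Longrightarrow> col_list (setn x v s) = col_list s"
  by (simp add: col_list_def)

lemma free_cols_prog_correct:
  fixes s :: "'a :: field store"
  assumes "nvar s ''m'' = m" "nvar s ''q'' = 0"
  shows "col_list (sem free_cols_prog s) = filter (\<lambda>c. vec_of s ''mc'' c = 0) [0..<m]"
  unfolding free_cols_prog_def
proof (rule sem_for_rule[where I = "\<lambda>i t. col_list t = filter (\<lambda>c. vec_of s ''mc'' c =
  0) [0..<i]"], goal_cases)
  case (2 i t)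
  have "narr t ''mc'' = narr s ''mc''" using framed_simps[OF 2(3)] by simp
  then show ?case using 2(2) col_list_append[of "setn ''c'' i t" i] by (simp add: col_list_setn)
qed (use assms in \<open>auto simp: col_list_def\<close>)

lemma matched_cols_prog_correct:
  fixes s :: "'a :: field store"
  assumes "nvar s ''n'' = n"
  shows "col_list (sem matched_cols_prog s) = col_list s @ map (\<lambda>r. vec_of s ''mr'' r - 1)
    (filter (\<lambda>r. vec_of s ''mr'' r \<noteq> 0) (map (\<lambda>t. vec_of s ''ord'' (n - 1 - t)) [0..<n]))"
  unfolding matched_cols_prog_def
proof (rule sem_for_rule[where I = "\<lambda>i t. col_list t = col_list s @ map (\<lambda>r. vec_of s ''mr'' r - 1)
    (filter (\<lambda>r. vec_of s ''mr'' r \<noteq> 0) (map (\<lambda>t. vec_of s ''ord'' (n - 1 - t)) [0..<i]))"],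
      goal_cases)
  case (2 i t)
  have "narr t ''mr'' = narr s ''mr''" "narr t ''ord'' = narr s ''ord''" "nvar t ''n'' = n"
    using framed_simps[OF 2(3)] assms by simp_all
  then show ?case using 2(2) col_list_append[of "setn ''t'' i t"
    "narr s ''mr'' (narr s ''ord'' (n - Suc i) 0) 0 - 1"]
    by (simp add: col_list_setn)
qed (use assms in \<open>auto simp: col_list_setn\<close>)

text \<open>The expression is evaluated while \<open>X\<close> is being filled; the premise
  therefore fixes its value in all stores that differ from \<open>s\<close> at most in the two
  counters and in the arrays of field elements named \<open>X\<close>.\<close>

lemma fill_prog_correct:
  fixes s :: "'a :: field store"
  assumes e1: "nval e1 s = N1" and ne: "''t'' \<notin> nexp_vars e1 \<union> nexp_vars e2"
    "''z'' \<notin> nexp_vars e1 \<union> nexp_vars e2"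
    and e2: "nval e2 s = N2"
    and e: "\<And>u. \<lbrakk>nvar u ''t'' = t; nvar u ''z'' = z; \<And>x. x \<noteq> ''t'' \<Longrightarrow> x \<noteq> ''z'' \<Longrightarrow> nvar u x =
      nvar s x;
      narr u = narr s; \<And>y. y \<noteq> X \<Longrightarrow> farr u y = farr s y\<rbrakk> \<Longrightarrow> fval e u = v"
    and tz: "t < N1" "z < N2"
  shows "farr (sem (fill_prog X e2 e1 e) s) X z t = v"
proof -
  let ?b = "PSetFArr X (NVar ''z'') (NVar ''t'') e"
  have "t < N1 \<longrightarrow> farr (sem (fill_prog X e2 e1 e) s) X z t = v"
    unfolding fill_prog_def
  proof (rule sem_for_rule[where I = "\<lambda>i u. t < i \<longrightarrow> farr u X z t = v"], goal_cases)
    case (2 i u)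
    note fr = framed_simps[OF 2(3)]
    let ?u = "setn ''t'' i u"
    have N2: "nval e2 ?u = N2"
      unfolding e2[symmetric] by (rule nval_cong) (use ne fr in auto)
    have "z < N2 \<longrightarrow> t < Suc i \<longrightarrow> farr (sem (PFor ''z'' e2 ?b) ?u) X z t = v"
    proof (rule sem_for_rule[where I = "\<lambda>j w. (t < i \<longrightarrow> farr w X z t = v) \<and> (t = i \<longrightarrow> z < j \<longrightarrow>
      farr w X z t = v)"], goal_cases)
      case (2 j w)
      note fr2 = framed_simps[OF 2(3)]
      have wt: "nvar w ''t'' = i" using fr2 by simp
      have "fval e (setn ''z'' j w) = v" if "t = i" "z = j"
      proof (rule e)
        show "nvar (setn ''z'' j w) ''t'' = t" "nvar (setn ''z'' j w) ''z'' = z" using that wt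
            by simp_all
        show "nvar (setn ''z'' j w) x = nvar s x" if "x \<noteq> ''t''" "x \<noteq> ''z''" for x using that fr fr2
            by simp
        show "narr (setn ''z'' j w) = narr s" using fr fr2 by (auto simp: fun_eq_iff)
        show "farr (setn ''z'' j w) y = farr s y" if "y \<noteq> X" for y using that fr fr2 by simp
      qed
      then show ?case using 2(2) wt by (auto simp: less_Suc_eq)
    next
      case (3 w)
      then show ?case using N2 by (auto simp: less_Suc_eq)
    qed (use 2(2) in auto)
    then show ?case using tz by simp
  qed (use e1 in auto)
  then show ?thesis using tz by simp
qed

context matched
begin

text \<open>
  The partners are listed in reverse order because \<open>Y\<close> shrinks while \<open>X\<close> grows along the chain.
\<close>

lemma column_order:
  assumes os: "distinct os" "set os = {..<n}"
  defines "ls \<equiv> filter (\<lambda>c. mc c = 0) [0..<m] @ map (\<lambda>r. mr r - 1) (filter (\<lambda>r. mr r \<noteq> 0) (rev os))"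
  shows "distinct ls" "set ls = {..<m}"
    "unmatched m mc (set (take i os)) = set (take (card (unmatched m mc (set (take i os)))) ls)"
proof -
  have inj: "inj_on (\<lambda>r. mr r - 1) {r. r < n \<and> mr r \<noteq> 0}"
  proof (rule inj_onI)
    fix x y assume h: "x \<in> {r. r < n \<and> mr r \<noteq> 0}" "y \<in> {r. r < n \<and> mr r \<noteq> 0}" "mr x - 1 = mr y - 1"
    then have "mc (mr x - 1) = Suc x" "mc (mr y - 1) = Suc y" using partner_of_row by blast+
    then have "Suc x = Suc y" by (simp only: h(3))
    then show "x = y" by simp
  qed
  have dm: "distinct (map (\<lambda>r. mr r - 1) (filter (\<lambda>r. mr r \<noteq> 0) (rev os)))"
    unfolding distinct_map
  proof
    show "inj_on (\<lambda>r. mr r - 1) (set (filter (\<lambda>r. mr r \<noteq> 0) (rev os)))"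
      by (rule inj_on_subset[OF inj]) (use os(2) in auto)
  qed (use os(1) in simp)
  have nz: "mc (mr r - 1) \<noteq> 0 \<and> mr r - 1 < m" if "r < n" "mr r \<noteq> 0" for r
    using partner_of_row[OF that] by simp
  have "set (filter (\<lambda>c. mc c = 0) [0..<m]) \<inter> set (map (\<lambda>r. mr r - 1) (filter (\<lambda>r. mr r \<noteq> 0) (rev
      os))) = {}"
  proof -
    have "mc c \<noteq> 0" if "c \<in> set (map (\<lambda>r. mr r - 1) (filter (\<lambda>r. mr r \<noteq> 0) (rev os)))" for c
      using that os nz by auto
    moreover have "mc c = 0" if "c \<in> set (filter (\<lambda>c. mc c = 0) [0..<m])" for c
      using that by simp
    ultimately show ?thesis by blast
  qed
  then show d: "distinct ls" using dm by (simp add: ls_def)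
  \<comment> \<open>For a prefix of the rows, the unmatched columns are the free ones and the
    partners of the remaining rows. Reversal puts these partners first, so the set is a prefix of
    \<open>ls\<close>.\<close>
  have um: "unmatched m mc (set (take i os)) =
    set (filter (\<lambda>c. mc c = 0) [0..<m] @ map (\<lambda>r. mr r - 1) (filter (\<lambda>r. mr r \<noteq> 0) (rev (drop i
      os))))" for i
  proof (intro equalityI subsetI)
    fix c assume c: "c \<in> unmatched m mc (set (take i os))"
    show "c \<in> set (filter (\<lambda>c. mc c = 0) [0..<m] @ map (\<lambda>r. mr r - 1) (filter (\<lambda>r. mr r \<noteq> 0) (rev
        (drop i os))))"
    proof (cases "mc c = 0")
      case True
      then show ?thesis using c by (simp add: unmatched_def)
    next
      case False
      have cm: "c < m" using c by (simp add: unmatched_def)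
      define r where "r = mc c - 1"
      have r: "r < n" "mr r = Suc c" using partner_of_col[OF cm False] by (auto simp: r_def)
      have "r \<notin> set (take i os)" using c False by (simp add: unmatched_def r_def)
      moreover have "r \<in> set os" using r os by simp
      ultimately have "r \<in> set (drop i os)" by (metis Un_iff append_take_drop_id set_append)
      then have "c \<in> (\<lambda>r. mr r - 1) ` {r \<in> set (drop i os). mr r \<noteq> 0}" using r by force
      then show ?thesis by simp
    qed
  next
    fix c assume "c \<in> set (filter (\<lambda>c. mc c = 0) [0..<m] @ map (\<lambda>r. mr r - 1) (filter (\<lambda>r. mr r \<noteq> 0)
      (rev (drop i os))))"
    then consider "c < m" "mc c = 0" | r where "r \<in> set (drop i os)" "mr r \<noteq> 0" "c = mr r - 1"
      by auto
    then show "c \<in> unmatched m mc (set (take i os))"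
    proof cases
      case 1
      then show ?thesis by (simp add: unmatched_def)
    next
      case 2
      have "r < n" using 2(1) os(2) by (metis in_set_dropD lessThan_iff)
      then have "c < m" "mc c = Suc r" using partner_of_row[of r] 2 by auto
      moreover have "r \<notin> set (take i os)" using set_take_disj_set_drop_if_distinct[OF os(1), of i i]
        2(1) by auto
      ultimately show ?thesis by (simp add: unmatched_def)
    qed
  qed
  have "unmatched m mc {} = {..<m}" by (auto simp: unmatched_def)
  then show "set ls = {..<m}" using um[of 0] by (simp add: ls_def)
  let ?X = "filter (\<lambda>c. mc c = 0) [0..<m] @ map (\<lambda>r. mr r - 1) (filter (\<lambda>r. mr r \<noteq> 0) (rev (drop i
    os)))"
  have "rev os = rev (drop i os) @ rev (take i os)" by (metis append_take_drop_id rev_append)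
  then have ls: "ls = ?X @ map (\<lambda>r. mr r - 1) (filter (\<lambda>r. mr r \<noteq> 0) (rev (take i os)))"
    by (simp add: ls_def)
  have "distinct ?X"
    using d unfolding ls by (rule distinct_append[THEN iffD1, THEN conjunct1])
  then have "card (unmatched m mc (set (take i os))) = length ?X" unfolding um
    by (rule distinct_card)
  then show "unmatched m mc (set (take i os)) = set (take (card (unmatched m mc (set (take i os))))
    ls)"
    unfolding um[symmetric] using um[of i] ls by (metis append_eq_conv_conj)
qed

end

section \<open>Correctness of the whole program\<close>

lemma prepare_prog_correct:
  fixes A :: "'a :: field mat"
  assumes A: "A \<in> carrier_mat (sum_list ns) (sum_list ms)"
    and rank: "\<forall>\<alpha> < length ns. \<forall>\<beta> < length ms. vec_space.rank (ns ! \<alpha>) (block ns ms A \<alpha> \<beta>) \<le> 1"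
  defines "s \<equiv> sem prepare_prog (input_store ns ms A)"
  shows "is_block_fun ns (vec_of s ''rb'')" "is_block_fun ms (vec_of s ''cb'')"
    "good_state (sum_list ns) (sum_list ms) (vec_of s ''rb'') (vec_of s ''cb'') (\<lambda>i j. A $$ (i, j))
      s"
proof -
  let ?n = "sum_list ns" and ?m = "sum_list ms"
  define s0 where "s0 = input_store ns ms A"
  define s1 where "s1 = sem (block_prog ''rb'' ''mu'' ''ns'') s0"
  define s2 where "s2 = sem (block_prog ''cb'' ''nu'' ''ms'') s1"
  have s: "s = sem init_prog s2" by (simp add: s_def prepare_prog_def s0_def s1_def s2_def)
  have f0: "nvar s0 ''mu'' = length ns" "nvar s0 ''nu'' = length ms" "nvar s0 ''n'' = ?n"
      "nvar s0 ''m'' = ?m"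
    "\<And>\<alpha>. \<alpha> < length ns \<Longrightarrow> narr s0 ''ns'' \<alpha> 0 = ns ! \<alpha>" "\<And>\<beta>. \<beta> < length ms \<Longrightarrow> narr s0 ''ms'' \<beta> 0 =
      ms ! \<beta>"
    "narr s0 ''mr'' = (\<lambda>_ _. 0)" "narr s0 ''mc'' = (\<lambda>_ _. 0)"
    "\<And>x y. farr s0 ''A'' x y = (if x < ?n \<and> y < ?m then A $$ (x, y) else 0)"
    by (simp_all add: s0_def input_store_def)
  have f1: "nvar s1 ''nu'' = length ms" "nvar s1 ''n'' = ?n" "nvar s1 ''m'' = ?m"
    "narr s1 ''ms'' = narr s0 ''ms''" "narr s1 ''mr'' = narr s0 ''mr''"
      "narr s1 ''mc'' = narr s0 ''mc''"
    "farr s1 ''A'' = farr s0 ''A''"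
    using f0 by (simp_all add: s1_def frame block_prog_def del: sem.simps)
  have f2: "nvar s2 ''n'' = ?n" "nvar s2 ''m'' = ?m" "narr s2 ''rb'' = narr s1 ''rb''"
    "narr s2 ''mr'' = narr s0 ''mr''" "narr s2 ''mc'' = narr s0 ''mc''"
      "farr s2 ''A'' = farr s0 ''A''"
    using f1 by (simp_all add: s2_def frame block_prog_def del: sem.simps)
  have fs: "nvar s ''n'' = ?n" "nvar s ''m'' = ?m" "narr s ''rb'' = narr s1 ''rb''"
      "narr s ''cb'' = narr s2 ''cb''"
    "narr s ''mr'' = narr s0 ''mr''" "narr s ''mc'' = narr s0 ''mc''"
    using f2 by (simp_all add: s frame loop_defs del: sem.simps)
  show rb: "is_block_fun ns (vec_of s ''rb'')"
    unfolding fs s1_def by (rule block_prog_correct) (use f0 in simp_all)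
  show cb: "is_block_fun ms (vec_of s ''cb'')"
    unfolding fs s2_def by (rule block_prog_correct) (use f0 f1 in simp_all)
  let ?rb = "vec_of s ''rb''" and ?cb = "vec_of s ''cb''"
  \<comment> \<open>The rank hypothesis is turned into minors by shifting indices with equal block
    numbers into their common block.\<close>
  have "minors ?n ?m ?rb ?cb (\<lambda>i j. A $$ (i, j))"
    unfolding minors_def
  proof (intro allI impI)
    fix x x' y y'
    assume h: "x < ?n" "x' < ?n" "y < ?m" "y' < ?m" "?rb x = ?rb x'" "?cb y = ?cb y'"
    define \<alpha> where "\<alpha> = ?rb x"
    define \<beta> where "\<beta> = ?cb y"
    have a: "\<alpha> < length ns" "\<beta> < length ms" using rb cb h
        by (auto simp: is_block_fun_def \<alpha>_def \<beta>_def)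
    have rx: "offset ns \<alpha> \<le> x" "x < offset ns \<alpha> + ns ! \<alpha>" "offset ns \<alpha> \<le> x'"
        "x' < offset ns \<alpha> + ns ! \<alpha>"
      using block_fun_iff[OF rb h(1), of \<alpha>] block_fun_iff[OF rb h(2), of \<alpha>] h(5) offset_Suc[OF a(1)]
        by (auto simp: \<alpha>_def)
    have cy: "offset ms \<beta> \<le> y" "y < offset ms \<beta> + ms ! \<beta>" "offset ms \<beta> \<le> y'"
        "y' < offset ms \<beta> + ms ! \<beta>"
      using block_fun_iff[OF cb h(3), of \<beta>] block_fun_iff[OF cb h(4), of \<beta>] h(6) offset_Suc[OF a(2)]
        by (auto simp: \<beta>_def)
    have "block ns ms A \<alpha> \<beta> \<in> carrier_mat (ns ! \<alpha>) (ms ! \<beta>)" by (simp add: block_def)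
    moreover have "vec_space.rank (ns ! \<alpha>) (block ns ms A \<alpha> \<beta>) \<le> 1" using rank a by blast
    moreover have "x - offset ns \<alpha> < ns ! \<alpha>" "x' - offset ns \<alpha> < ns ! \<alpha>" "y - offset ms \<beta> < ms ! \<beta>"
      "y' - offset ms \<beta> < ms ! \<beta>"
      using rx cy by linarith+
    ultimately show "A $$ (x, y) * A $$ (x', y') = A $$ (x, y') * A $$ (x', y)"
      using rank_le_1_minor[of "block ns ms A \<alpha> \<beta>" "ns ! \<alpha>" "ms ! \<beta>" "x - offset ns \<alpha>"
        "x' - offset ns \<alpha>"
        "y - offset ms \<beta>" "y' - offset ms \<beta>"] rx cy by (simp add: block_def)
  qed
  then have "equivalent ?n ?m ?rb ?cb (\<lambda>i j. A $$ (i, j)) (farr s ''A'')"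
  proof (rule equivalent_initial[rotated])
    fix x y
    show "farr s ''A'' x y = (if x < ?n \<and> y = ?m + x \<or> y < ?m \<and> x = ?n + y then 1
      else if x < ?n \<and> y < ?m then A $$ (x, y) else 0)"
      unfolding s init_prog_correct[OF f2(1,2)] f2(6) f0(9) ..
  qed
  then show "good_state ?n ?m ?rb ?cb (\<lambda>i j. A $$ (i, j)) s"
    using fs f0 by (simp add: good_state_def normalized_def matching_def)
qed

lemma dims_le_input: "dims_le (input_size ns ms) (input_store ns ms A)"
proof -
  have "ks ! i \<le> sum_list ks" if "i < length ks" for ks :: "nat list" and i
    using that by (rule elem_le_sum_list)
  note le = order.trans[OF this]
  show ?thesis
    by (auto simp: dims_le_def dim_vars_def dim_arrs_def input_store_def input_size_def intro: le)
qed

lemma dm_prog_correct: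
  fixes A :: "'a :: field mat"
  assumes A: "A \<in> carrier_mat (sum_list ns) (sum_list ms)"
    and rank: "\<forall>\<alpha> < length ns. \<forall>\<beta> < length ms. vec_space.rank (ns ! \<alpha>) (block ns ms A \<alpha> \<beta>) \<le> 1"
  defines "s \<equiv> sem dm_prog (input_store ns ms A)"
  defines "E \<equiv> output_mat s ''E'' (sum_list ns) (sum_list ns)"
    and "F \<equiv> output_mat s ''F'' (sum_list ms) (sum_list ms)"
    and "D \<equiv> output_mat s ''D'' (sum_list ns) (sum_list ms)"
  shows "\<exists>Cs. (invertible_mat E \<and> block_diag_times_perm ns E \<and> invertible_mat F \<and>
    block_diag_times_perm ms F \<and>
    DM_decomposition ns ms A Cs E F D) \<and> output_chain ns ms s Cs"
proof -
  let ?n = "sum_list ns" and ?m = "sum_list ms"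
  define s1 where "s1 = sem prepare_prog (input_store ns ms A)"
  define s2 where "s2 = sem match_prog s1"
  define s4 where "s4 = sem count_prog (sem reach_all_prog s2)"
  define s6 where "s6 = sem chain_prog (sem order_start s4)"
  define s7 where "s7 = sem (place_prog true_guard) s6"
  define s8 where "s8 = sem free_cols_prog (setn ''q'' 0 s7)"
  define s9 where "s9 = sem matched_cols_prog s8"
  have s: "s = sem output_prog s9"
    by (simp add: s_def dm_prog_def s1_def s2_def s4_def s6_def s7_def s8_def s9_def)
  define rb where "rb = vec_of s1 ''rb''"
  define cb where "cb = vec_of s1 ''cb''"
  note pre = prepare_prog_correct[OF A rank, folded s1_def, folded rb_def cb_def]
  define B where "B = farr s2 ''A''"
  define mr where "mr = vec_of s2 ''mr''"
  define mc where "mc = vec_of s2 ''mc''"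
  have g2: "good_state ?n ?m rb cb (\<lambda>i j. A $$ (i, j)) s2" and ne2: "\<not> exposed_at ?n ?m s2 ?n"
    using match_prog_correct[OF pre(3)] by (simp_all add: s2_def)
  from g2 have f2: "nvar s2 ''n'' = ?n" "nvar s2 ''m'' = ?m"
    and nf: "normalized ?n ?m rb cb (\<lambda>i j. A $$ (i, j)) B mr mc"
    by (simp_all add: good_state_def B_def mr_def mc_def)
  have ok: "rows_ok ?n ?m rb B" "rows_ok ?m ?n cb (swap_args B)"
    using nf by (simp_all add: normalized_def equivalent_def)
  obtain Pi where Pi: "Pi \<in> carrier_mat ?n ?n" "Pi * tmat ?n ?m B = 1\<^sub>m ?n"
    "tmat ?n ?m B * Pi = 1\<^sub>m ?n"
    using tmat_inverse[OF ok(1)] .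
  obtain Qi where Qi: "Qi \<in> carrier_mat ?m ?m" "Qi * tmat ?m ?n (swap_args B) = 1\<^sub>m ?m"
    "tmat ?m ?n (swap_args B) * Qi = 1\<^sub>m ?m"
    using tmat_inverse[OF ok(2)] .
  interpret dm: dm_form ns ms rb cb B Pi Qi A mr mc
    using pre ok Pi Qi A nf by unfold_locales
  interpret sr: searched ?n ?m B mr mc
    by unfold_locales (use ne2 in \<open>simp add: exposed_at_def B_def mr_def mc_def\<close>)
  have f3: "nvar (sem reach_all_prog s2) ''n'' = ?n" "nvar (sem reach_all_prog s2) ''m'' = ?m"
    "farr (sem reach_all_prog s2) ''A'' = B" "vec_of (sem reach_all_prog s2) ''mr'' = mr"
      "vec_of (sem reach_all_prog s2) ''mc'' = mc"
    using f2 by (simp_all add: frame order_defs loop_defs B_def mr_def mc_def del: sem.simps)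
  have f4: "nvar s4 ''n'' = ?n" "nvar s4 ''m'' = ?m" "farr s4 ''A'' = B" "vec_of s4 ''mr'' = mr"
      "vec_of s4 ''mc'' = mc"
    "narr s4 ''d'' = narr (sem reach_all_prog s2) ''d''"
    using f3 by (simp_all add: s4_def frame count_prog_def count_row_def count_hits_def del:
      sem.simps)
  have d: "narr (sem reach_all_prog s2) ''d'' a r \<noteq> 0 \<longleftrightarrow> r \<in> level ?n B mr (sources ?n mr a) ?n"
      if "a \<le> ?n" "r < ?n" for a r
    using reach_all_prog_correct[OF f2(1) that] unfolding B_def mr_def .
  have "{z. z < ?n \<and> narr (sem reach_all_prog s2) ''d'' r z \<noteq> 0} = dm.R r" if "r < ?n" for r
    using d[of r] that dm.reach_subset[OF that] by (auto simp: reach_def)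
  then have cb4: "narr s4 ''cnt'' r 0 = card (dm.R r) \<and> (narr s4 ''bad'' r 0 \<noteq> 0 \<longleftrightarrow>
    exposes ?m B mc (dm.R r))" if "r < ?n" for r
    using count_prog_correct[OF f3(1,2) that] that unfolding s4_def f3(3,5) by simp
  have "sr.search_ok s4"
    unfolding sr.search_ok_def
  proof (intro conjI allI impI)
    show "narr s4 ''d'' a r \<noteq> 0 \<longleftrightarrow> r \<in> level ?n B mr (sources ?n mr a) ?n" if "a \<le> ?n" "r < ?n"
        for a r
      unfolding f4(6) by (rule d[OF that])
    show "narr s4 ''cnt'' r 0 = card (dm.R r)" "narr s4 ''bad'' r 0 = 0 \<longleftrightarrow>
        \<not> exposes ?m B mc (dm.R r)" if "r < ?n" for r
      using cb4[OF that] by blast+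
  qed (rule f4)+
  then have "sr.chain_ok (sem order_start s4)" using sr.order_start_correct
    unfolding sr.chain_ok_def by blast
  from sr.chain_prog_correct[OF this] have c6: "sr.chain_ok s6"
    and all: "\<And>z. z < ?n \<Longrightarrow> \<not> exposes ?m B mc (dm.R z) \<Longrightarrow> z \<in> set (ords s6)"
    by (simp_all add: s6_def)
  define ks where "ks = ords s7"
  from sr.place_rest_correct[OF c6] obtain Ls where k7: "sr.search_ok s7" and ks: "distinct ks"
    "set ks = {..<?n}"
    and Ls: "sr.recorded Ls s7" "last Ls = set (ords s6)"
    unfolding s7_def ks_def by blast
  have len: "length ks = ?n" using ks by (metis card_lessThan distinct_card)
  then have q7: "nvar s7 ''q'' = ?n" by (simp add: ks_def)
  have sat: "dm.saturated Ls" using Ls(1) by (simp add: sr.recorded_def)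
  have f7: "nvar s7 ''n'' = ?n" "nvar s7 ''m'' = ?m" "farr s7 ''A'' = B" "vec_of s7 ''mr'' = mr"
      "vec_of s7 ''mc'' = mc"
    using k7 by (simp_all add: sr.search_ok_def)
  have m7: "narr s7 ''mc'' c 0 = mc c" "narr s7 ''mr'' c 0 = mr c" for c using f7(4,5)
      by (auto dest: fun_cong)
  define ls where "ls = filter (\<lambda>c. mc c = 0) [0..<?m] @ map (\<lambda>r. mr r - 1) (filter (\<lambda>r. mr r \<noteq> 0)
    (rev ks))"
  have ko: "ks ! t = narr s7 ''ord'' t 0" if "t < ?n" for t using that q7
      by (simp add: ks_def ords_def)
  have rk: "rev ks ! t = narr s7 ''ord'' (?n - 1 - t) 0" if "t < ?n" for t
    using that ko[of "?n - 1 - t"] len by (simp add: rev_nth)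
  have f8: "nvar s8 ''n'' = ?n" "nvar s8 ''m'' = ?m" "farr s8 ''A'' = B"
      "narr s8 ''mr'' = narr s7 ''mr''"
    "narr s8 ''ord'' = narr s7 ''ord''" "nvar s8 ''h'' = nvar s7 ''h''"
      "narr s8 ''i'' = narr s7 ''i''" "narr s8 ''j'' = narr s7 ''j''"
    using f7 by (simp_all add: s8_def frame free_cols_prog_def del: sem.simps)
  have f9: "nvar s9 ''n'' = ?n" "nvar s9 ''m'' = ?m" "farr s9 ''A'' = B"
    "narr s9 ''ord'' = narr s7 ''ord''" "nvar s9 ''h'' = nvar s7 ''h''"
      "narr s9 ''i'' = narr s7 ''i''" "narr s9 ''j'' = narr s7 ''j''"
    using f8 by (simp_all add: s9_def frame matched_cols_prog_def del: sem.simps)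
  have c8: "col_list s8 = filter (\<lambda>c. mc c = 0) [0..<?m]"
    using free_cols_prog_correct[of "setn ''q'' 0 s7" ?m] f7(2) by (simp add: s8_def m7)
  have "map (\<lambda>t. narr s7 ''ord'' (?n - 1 - t) 0) [0..<?n] = rev ks"
    by (rule nth_equalityI) (use len rk in auto)
  then have c9: "col_list s9 = ls"
    using matched_cols_prog_correct[OF f8(1)] c8 f8(4,5) by (simp add: s9_def ls_def m7)
  note lo = dm.column_order[OF ks, folded ls_def]
  have "length ls = ?m" using lo(1,2) by (metis card_lessThan distinct_card)
  then have "nvar s9 ''q'' = ?m" using arg_cong[OF c9, of length] by (simp add: col_list_def)
  then have lk: "ls ! t = narr s9 ''co'' t 0" if "t < ?m" for t
    using that by (simp add: c9[symmetric] col_list_def)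
  define t1 where "t1 = sem (fill_prog ''E'' nN nN (FArr ''A'' (rev_ord (NVar ''t'')) (NPlus mN
    (NVar ''z'')))) s9"
  define t2 where "t2 = sem (fill_prog ''F'' mN mN (FArr ''A'' (NPlus nN (NVar ''z'')) (vec_cell
    ''co'' (NVar ''t'')))) t1"
  have st: "s = sem (fill_prog ''D'' nN mN (FArr ''A'' (rev_ord (NVar ''z'')) (vec_cell ''co'' (NVar
      ''t'')))) t2"
    by (simp add: s output_prog_def t1_def t2_def)
  have u1: "nvar t1 ''n'' = ?n" "nvar t1 ''m'' = ?m" "narr t1 = narr s9" "farr t1 ''A'' = B"
    using f9 by (simp_all add: t1_def frame fill_prog_def fun_eq_iff del: sem.simps)
  have u2: "nvar t2 ''n'' = ?n" "nvar t2 ''m'' = ?m" "narr t2 = narr s9" "farr t2 ''A'' = B"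
      "farr t2 ''E'' = farr t1 ''E''"
    using u1 by (simp_all add: t2_def frame fill_prog_def fun_eq_iff del: sem.simps)
  have us: "narr s = narr s9" "farr s ''E'' = farr t1 ''E''" "farr s ''F'' = farr t2 ''F''"
      "nvar s ''h'' = nvar s7 ''h''"
    using u2 f9 by (simp_all add: st t2_def t1_def frame fill_prog_def fun_eq_iff del: sem.simps)
  have E: "E = mat ?n ?n (\<lambda>(i, t). B (rev ks ! t) (?m + i))"
  proof -
    have "farr t1 ''E'' z t = B (narr s7 ''ord'' (?n - 1 - t) 0) (?m + z)" if "t < ?n" "z < ?n"
        for z t
      unfolding t1_def
      by (rule fill_prog_correct[of nN s9 ?n nN ?n]) (use f9 that in auto)
    then show ?thesis unfolding E_def output_mat_def us
      by (intro cong_mat refl) (use rk in auto)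
  qed
  have F: "F = mat ?m ?m (\<lambda>(j, t). B (?n + j) (ls ! t))"
  proof -
    have "farr t2 ''F'' z t = B (?n + z) (narr s9 ''co'' t 0)" if "t < ?m" "z < ?m" for z t
      unfolding t2_def
      by (rule fill_prog_correct[of mN t1 ?m mN ?m]) (use u1 that in auto)
    then show ?thesis unfolding F_def output_mat_def us
      by (intro cong_mat refl) (use lk in auto)
  qed
  have D: "D = mat ?n ?m (\<lambda>(z, t). B (rev ks ! z) (ls ! t))"
  proof -
    have "farr s ''D'' z t = B (narr s7 ''ord'' (?n - 1 - z) 0) (narr s9 ''co'' t 0)" if "t < ?m"
        "z < ?n" for z t
      unfolding st
      by (rule fill_prog_correct[of mN t2 ?m nN ?n]) (use u2 f9 that in auto)
    then show ?thesis unfolding D_def output_mat_def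
      by (intro cong_mat refl) (use rk lk in auto)
  qed
  have rec: "narr s7 ''i'' k 0 \<le> ?n" "Ls ! k = set (take (narr s7 ''i'' k 0) ks)"
      "narr s7 ''j'' k 0 = ?m - card {r \<in> Ls ! k. mr r \<noteq> 0}" if "k \<le> nvar s7 ''h''" for k
    using Ls(1) that q7 by (simp_all add: sr.recorded_def ks_def)
  have lenLs: "length Ls = Suc (nvar s7 ''h'')" using Ls(1) by (simp add: sr.recorded_def)
  \<comment> \<open>\<open>ks\<close> is distinct, so the recorded length of a prefix is the
    cardinality of its set.\<close>
  have cardL: "card (Ls ! k) = narr s7 ''i'' k 0" if "k \<le> nvar s7 ''h''" for k
    using rec(1,2)[OF that] ks(1) len by (simp add: distinct_card)
  have idx: "\<exists>k\<le>nvar s7 ''h''. L = Ls ! k" if "L \<in> set Ls" for L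
    using that lenLs by (metis in_set_conv_nth less_Suc_eq_le)
  have dmd: "invertible_mat E \<and> block_diag_times_perm ns E \<and> invertible_mat F \<and>
      block_diag_times_perm ms F \<and>
    DM_decomposition ns ms A (map dm.stable_pair_of Ls) E F D"
  proof (rule dm.DM_decomposition_of_rows[OF _ _ _ _ ks _ lo(1,2) _ E F D])
    show "Ls \<noteq> []" "sorted_wrt (\<subset>) Ls" using sat by (simp_all add: dm.saturated_def)
    show "dm.rows_closed L" if "L \<in> set Ls" for L using sat that by (simp add: dm.saturated_def)
    show "L \<in> set Ls" if "dm.rows_closed L" "\<And>L'. L' \<in> set Ls \<Longrightarrow> L \<subseteq> L' \<or> L' \<subseteq> L" for L
      by (rule dm.saturated_final[OF sat _ that]) (use all Ls(2) in auto)
    show "L = set (take (card L) ks)" if "L \<in> set Ls" for L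
      using idx[OF that] cardL rec(2) by metis
    show "unmatched ?m mc L = set (take (card (unmatched ?m mc L)) ls)" if "L \<in> set Ls" for L
      using idx[OF that] lo(3) rec(2) by metis
  qed
  have "output_chain ns ms s (map dm.stable_pair_of Ls)"
    unfolding output_chain_def us
  proof (intro conjI allI impI)
    fix k assume k: "k \<le> nvar s7 ''h''"
    have Lk: "Ls ! k \<subseteq> {..<?n}" using rec(2)[OF k] ks(2) by (metis set_take_subset)
    have k': "k < length Ls" using k lenLs by simp
    show "narr s9 ''i'' k 0 = subspace_dim ?n (fst (map dm.stable_pair_of Ls ! k))"
      using k' cardL[OF k] dm.U.dim_coord_space[OF Lk] by (simp add: f9 dm.stable_pair_of_def)
    \<comment> \<open>\<open>card_unmatched_to\<close> turns the recorded difference into the number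
      of unmatched columns.\<close>
    show "narr s9 ''j'' k 0 = subspace_dim ?m (snd (map dm.stable_pair_of Ls ! k))"
      using k' rec(3)[OF k] dm.card_unmatched_to[OF Lk] dm.V.dim_coord_space[OF
        dm.unmatched_to_subset[of "Ls ! k"]]
      by (simp add: f9 dm.stable_pair_of_def)
  qed (simp add: lenLs)
  with dmd show ?thesis by blast
qed

theorem theorem1p1:
  shows "\<exists>(P :: com) (p :: nat poly).
    \<forall>(ns :: nat list) (ms :: nat list) (A :: 'a :: field mat).
      A \<in> carrier_mat (sum_list ns) (sum_list ms) \<longrightarrow>
      (\<forall>\<alpha> < length ns. \<forall>\<beta> < length ms. vec_space.rank (ns ! \<alpha>) (block ns ms A \<alpha> \<beta>) \<le> 1) \<longrightarrow>
      (\<exists>t s. runs P (input_store ns ms A) t s \<and>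
             t \<le> poly p (input_size ns ms) \<and>
             (let E = output_mat s ''E'' (sum_list ns) (sum_list ns);
                  F = output_mat s ''F'' (sum_list ms) (sum_list ms);
                  D = output_mat s ''D'' (sum_list ns) (sum_list ms)
              in invertible_mat E \<and> block_diag_times_perm ns E \<and>
                 invertible_mat F \<and> block_diag_times_perm ms F \<and>
                 (\<exists>Cs. DM_decomposition ns ms A Cs E F D \<and> output_chain ns ms s Cs)))"
\<comment> \<open>Both witnesses are closed terms: they depend neither on the input nor on the
  field, which enters only through the store.\<close>
proof (rule exI[of _ "compile dm_prog"], rule exI[of _ "cost dm_prog"], intro allI impI)
  fix ns ms :: "nat list" and A :: "'a mat"
  assume A: "A \<in> carrier_mat (sum_list ns) (sum_list ms)"
    and rank: "\<forall>\<alpha> < length ns. \<forall>\<beta> < length ms. vec_space.rank (ns ! \<alpha>) (block ns ms A \<alpha> \<beta>) \<le> 1"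
  let ?s = "sem dm_prog (input_store ns ms A)"
  obtain t where t: "runs (compile dm_prog) (input_store ns ms A) t ?s" "t \<le> poly (cost dm_prog) (input_size ns ms)"
    using runs_compile[OF wf_dm_prog dims_le_input] by blast
  show "\<exists>t s. runs (compile dm_prog) (input_store ns ms A) t s \<and> t \<le> poly (cost dm_prog) (input_size ns ms) \<and>
             (let E = output_mat s ''E'' (sum_list ns) (sum_list ns);
                  F = output_mat s ''F'' (sum_list ms) (sum_list ms);
                  D = output_mat s ''D'' (sum_list ns) (sum_list ms)
              in invertible_mat E \<and> block_diag_times_perm ns E \<and>
                 invertible_mat F \<and> block_diag_times_perm ms F \<and>
                 (\<exists>Cs. DM_decomposition ns ms A Cs E F D \<and> output_chain ns ms s Cs))"
    unfolding Let_def using t dm_prog_correct[OF A rank] by blast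
qed

end
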